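(* Let $n$ be a positive integer, let $1\le p_n<p_{n-1}<\cdots<p_1<\infty$, let $\mathcal{X}=\ell_{p_1}\oplus\ell_{p_2}\oplus\cdots\oplus\ell_{p_n}$ (over the complex scalars), and let $T\in\mathcal{L}(\mathcal{X})$. For $i=1,\dots,n$ let $P_{\ell_{p_i}}$ be the natural projection from $\mathcal{X}$ onto $\ell_{p_i}$. Then $T$ is a commutator if and only if for each $1\le i\le n$ the operator $P_{\ell_{p_i}}TP_{\ell_{p_i}}$ is a commutator as an operator acting on $\ell_{p_i}$.
   Context: $\mathcal{L}(\mathcal{Z})$ denotes the algebra of bounded linear operators on a Banach space $\mathcal{Z}$. An operator $T\in\mathcal{L}(\mathcal{Z})$ is a commutator (on $\mathcal{Z}$) if $T=AB-BA$ for some $A,B\in\mathcal{L}(\mathcal{Z})$. *)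

theory Defs
  imports Complex_Main "HOL-Library.Function_Algebras"
begin

text \<open>
  The exponent \<open>p\<close> is a variable real number, so \<open>\<ell>\<^sub>p\<close> cannot be a type depending on it.
  A complex normed space is therefore a set of vectors inside an ambient additive group, together
  with scalar multiplication and norm; addition and subtraction are those of the ambient type
  (pointwise for functions, by \<open>Function_Algebras\<close>).
\<close>

record 'a cspace =
  vecs :: "'a set"
  smul :: "complex \<Rightarrow> 'a \<Rightarrow> 'a"
  nrm  :: "'a \<Rightarrow> real"

text \<open>
  Operators are functions on the ambient type of which only the values on \<open>vecs Z\<close> matter.
\<close>

definition bounded_operators :: "'a::ab_group_add cspace \<Rightarrow> ('a \<Rightarrow> 'a) set" where
  "bounded_operators Z = {T.
     (\<forall>x\<in>vecs Z. T x \<in> vecs Z) \<and>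
     (\<forall>x\<in>vecs Z. \<forall>y\<in>vecs Z. T (x + y) = T x + T y) \<and>
     (\<forall>c. \<forall>x\<in>vecs Z. T (smul Z c x) = smul Z c (T x)) \<and>
     (\<exists>K. \<forall>x\<in>vecs Z. nrm Z (T x) \<le> K * nrm Z x)}"

definition is_commutator_on :: "'a::ab_group_add cspace \<Rightarrow> ('a \<Rightarrow> 'a) \<Rightarrow> bool" where
  "is_commutator_on Z T \<longleftrightarrow>
     (\<exists>A\<in>bounded_operators Z. \<exists>B\<in>bounded_operators Z.
        \<forall>x\<in>vecs Z. T x = A (B x) - B (A x))"

definition ell :: "real \<Rightarrow> (nat \<Rightarrow> complex) cspace" where
  "ell p = \<lparr>
     vecs = {x. summable (\<lambda>k. cmod (x k) powr p)},
     smul = (\<lambda>c x k. c * x k),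
     nrm = (\<lambda>x. (\<Sum>k. cmod (x k) powr p) powr (1 / p)) \<rparr>"

text \<open>
  The direct sum of the spaces \<open>Z i\<close>, \<open>i \<in> I\<close>, for finite \<open>I\<close>. A tuple is a function on \<open>nat\<close> that
  is zero off \<open>I\<close>. The norm is the sum of the norms of the components; any of the usual norms
  on a finite direct sum is equivalent to it and gives the same bounded operators.
\<close>

definition direct_sum ::
    "nat set \<Rightarrow> (nat \<Rightarrow> 'a::ab_group_add cspace) \<Rightarrow> (nat \<Rightarrow> 'a) cspace" where
  "direct_sum I Z = \<lparr>
     vecs = {x. (\<forall>i\<in>I. x i \<in> vecs (Z i)) \<and> (\<forall>i. i \<notin> I \<longrightarrow> x i = 0)},
     smul = (\<lambda>c x i. smul (Z i) c (x i)),
     nrm = (\<lambda>x. \<Sum>i\<in>I. nrm (Z i) (x i)) \<rparr>"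

definition summand_incl :: "nat \<Rightarrow> 'a::zero \<Rightarrow> (nat \<Rightarrow> 'a)" where
  "summand_incl i y = (\<lambda>j. if j = i then y else 0)"

definition summand_proj :: "nat \<Rightarrow> (nat \<Rightarrow> 'a::zero) \<Rightarrow> (nat \<Rightarrow> 'a)" where
  "summand_proj i x = (\<lambda>j. if j = i then x j else 0)"

text \<open>
  An operator \<open>S\<close> on a direct sum that maps the \<open>i\<close>-th summand into itself, viewed as an operator
  acting on the \<open>i\<close>-th space through the identification \<open>summand_incl i\<close> of that space with
  the range of \<open>summand_proj i\<close>.
\<close>

definition on_summand :: "nat \<Rightarrow> ((nat \<Rightarrow> 'a::zero) \<Rightarrow> (nat \<Rightarrow> 'a)) \<Rightarrow> 'a \<Rightarrow> 'a" where
  "on_summand i S y = S (summand_incl i y) i"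

end

theory Submission
  imports Defs "HOL-Analysis.Analysis"
begin

text \<open>
  Write \<open>T\<close> as an operator matrix \<open>(T\<^sub>i\<^sub>j)\<close>. If the \<open>T\<^sub>i\<^sub>i = [A\<^sub>i, B\<^sub>i]\<close> are commutators, replace \<open>A\<^sub>i\<close> by
  \<open>A\<^sub>i + \<mu>\<^sub>i\<close> with far apart scalars \<open>\<mu>\<^sub>i\<close>; the off-diagonal equations
  \<open>(A\<^sub>i + \<mu>\<^sub>i) Z - Z (A\<^sub>j + \<mu>\<^sub>j) = T\<^sub>i\<^sub>j\<close> are then solved by a Neumann series.

  Conversely, if \<open>T = [A, B]\<close> then \<open>T\<^sub>i\<^sub>i\<close> differs from \<open>[A\<^sub>i\<^sub>i, B\<^sub>i\<^sub>i]\<close> by products that factor through a summand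
  with another exponent, and these are compact by Pitt's theorem. So it suffices that on a single
  \<open>\<ell>\<^sub>p\<close> a commutator plus a compact operator is a commutator. Either \<open>T\<^sub>i\<^sub>i\<close> is a scalar modulo the
  compact operators; the scalar is 0 by Wielandt's argument, and compact operators are commutators
  with a shift of infinite multiplicity. Or a gliding hump yields \<open>U\<close> and \<open>V\<close> with \<open>V U = 0\<close> and
  \<open>V T U = 1\<close>, which makes \<open>T\<close> similar to a \<open>2 \<times> 2\<close> operator matrix whose diagonal entries each kill a
  complemented copy of \<open>\<ell>\<^sub>p\<close>; such entries are commutators, again by shifts of infinite multiplicity.
\<close>

section \<open>Sequence spaces\<close>

text \<open>The argument is uniform in 1 \<le> p < \<infinity>, and p = 1 is the obstacle that
  shapes it. There bounded sequences need not have weakly convergent subsequences, and a compact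
  operator may keep all unit vectors large. So humps are obtained as differences of two vectors that
  nearly agree, together with their images, on an initial segment; and norming functionals are
  estimated by Jensen's inequality, without a conjugate exponent.

  No quotient algebra is formed. Compactness means finite nets, and Wielandt's norm estimate turns
  into the statement that the distance from a power of \<open>B\<close> to the compact operators can
  be halved again and again.

  Shifts of infinite multiplicity enter because a shift \<open>R\<close> with left inverse
  \<open>L\<close> makes S - R S L = D solvable without any smallness: when \<open>D\<close> lives
  on the space that \<open>R\<close> misses, \<open>S\<close> repeats \<open>D\<close> along the
  orbit of the shift. The complemented copy of the whole space supplies the room for these
  repetitions.

  A scalar added to \<open>A\<^sub>i\<close> is invisible in the diagonal commutators but separates
  the coefficients of the off-diagonal equations.\<close>

type_synonym vec = "nat \<Rightarrow> complex"

abbreviation lp :: "real \<Rightarrow> vec set" where "lp p \<equiv> vecs (ell p)"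
abbreviation lpn :: "real \<Rightarrow> vec \<Rightarrow> real" where "lpn p \<equiv> nrm (ell p)"

definition scl :: "complex \<Rightarrow> vec \<Rightarrow> vec" where "scl c x = (\<lambda>k. c * x k)"

lemma scl_apply [simp]: "scl c x k = c * x k"
  by (simp add: scl_def)

lemma smul_ell: "smul (ell p) = scl"
  by (auto simp: ell_def scl_def fun_eq_iff)

lemma scl_simps [simp]: "scl 0 x = 0" "scl 1 x = x" "scl c 0 = 0" "scl a (scl b x) = scl (a * b) x"
  by (auto simp: fun_eq_iff)

lemma scl_arith: "scl c (x + y) = scl c x + scl c y" "scl c (x - y) = scl c x - scl c y"
  "scl c (- x) = - scl c x" "scl (- c) x = - scl c x"
  "scl (a + b) x = scl a x + scl b x" "scl (a - b) x = scl a x - scl b x"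
  by (auto simp: fun_eq_iff algebra_simps)

lemma lp_iff: "x \<in> lp p \<longleftrightarrow> summable (\<lambda>k. cmod (x k) powr p)"
  by (simp add: ell_def)

lemma lpn_def: "lpn p x = (\<Sum>k. cmod (x k) powr p) powr (1 / p)"
  by (simp add: ell_def)

lemma lpn_nonneg [simp]: "0 \<le> lpn p x"
  by (simp add: lpn_def)

lemma lpn_powr:
  assumes "1 \<le> p" "x \<in> lp p" shows "lpn p x powr p = (\<Sum>k. cmod (x k) powr p)"
  using assms by (simp add: lpn_def powr_powr lp_iff suminf_nonneg)

lemma lp_bound_sum:
  assumes "1 \<le> p" "x \<in> lp p" "finite F"
  shows "(\<Sum>k\<in>F. cmod (x k) powr p) \<le> lpn p x powr p"
  using assms by (simp add: lpn_powr lp_iff sum_le_suminf)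

lemma lpI:
  assumes "1 \<le> p" "0 \<le> C" "\<And>n. (\<Sum>k<n. cmod (x k) powr p) \<le> C powr p"
  shows "x \<in> lp p" "lpn p x \<le> C"
proof -
  have s: "summable (\<lambda>k. cmod (x k) powr p)"
    by (rule bounded_imp_summable[where B = "C powr p"])
      (use assms(3)[of "Suc _"] in \<open>auto simp: lessThan_Suc_atMost\<close>)
  then show x: "x \<in> lp p" by (simp add: lp_iff)
  have "lpn p x powr p \<le> C powr p"
    unfolding lpn_powr[OF assms(1) x] by (rule suminf_le_const[OF s assms(3)])
  then show "lpn p x \<le> C"
    using assms(1,2) powr_less_mono2[of p C "lpn p x"] by (smt (verit))
qed

section \<open>Convexity of the power function and Minkowski's inequality\<close>

lemma convex_on_powr_nonneg:
  assumes "1 \<le> (p::real)" shows "convex_on {0..} (\<lambda>x. x powr p)"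
proof (rule convex_on_linorderI)
  fix t x y :: real assume h: "0 < t" "t < 1" "x \<in> {0..}" "y \<in> {0..}" "x < y"
  \<comment> \<open>This settles the end point 0, where convexity reduces to t^p \<le> t for 0 < t <
    1.\<close>
  have sc: "t powr p \<le> t" 
    using powr_mono'[of 1 p t] h assms by simp
  show "((1 - t) *\<^sub>R x + t *\<^sub>R y) powr p \<le> (1 - t) * x powr p + t * y powr p"
  proof (cases "x = 0")
    case True
    then show ?thesis using h sc assms
      by (simp add: powr_mult mult_right_mono)
  next
    case False
    then show ?thesis using convex_onD[OF powr_convex[OF assms], of t x y] h by auto
  qed
qed auto

lemma zero_in_lp [simp]: "0 \<in> lp p"
  by (simp add: lp_iff)

lemma lpn_zero [simp]: "lpn p 0 = 0"
  by (simp add: lpn_def)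

lemma coord_le_lpn:
  assumes "1 \<le> p" "x \<in> lp p" shows "cmod (x k) \<le> lpn p x"
proof -
  have "cmod (x k) powr p \<le> lpn p x powr p"
    using lp_bound_sum[OF assms, of "{k}"] by simp
  then show ?thesis
    using assms(1) powr_less_mono2[of p "lpn p x" "cmod (x k)"] by (smt (verit) lpn_nonneg)
qed

lemma lpn_eq_0:
  assumes "1 \<le> p" "x \<in> lp p" "lpn p x = 0" shows "x = 0"
  using coord_le_lpn[OF assms(1,2)] assms(3) by (auto simp: fun_eq_iff)

lemma lp_mono:
  assumes "1 \<le> p" "x \<in> lp p" "\<And>k. cmod (y k) \<le> cmod (x k)"
  shows "y \<in> lp p" "lpn p y \<le> lpn p x"
proof -
  have "(\<Sum>k<n. cmod (y k) powr p) \<le> lpn p x powr p" for n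
  proof -
    have "(\<Sum>k<n. cmod (y k) powr p) \<le> (\<Sum>k<n. cmod (x k) powr p)"
      using assms by (intro sum_mono powr_mono2) auto
    then show ?thesis using lp_bound_sum[OF assms(1,2), of "{..<n}"] by auto
  qed
  from lpI[OF assms(1) lpn_nonneg this] show "y \<in> lp p" "lpn p y \<le> lpn p x" by auto
qed

lemma scl_lp:
  assumes "1 \<le> p" "x \<in> lp p" shows "scl c x \<in> lp p" "lpn p (scl c x) = cmod c * lpn p x"
proof -
  have le: "scl c x \<in> lp p \<and> lpn p (scl c x) \<le> cmod c * lpn p x" if "x \<in> lp p" for c x
  proof -
    have "(\<Sum>k<n. cmod (scl c x k) powr p) \<le> (cmod c * lpn p x) powr p" for n
      using lp_bound_sum[OF assms(1) that, of "{..<n}"]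
      by (simp add: norm_mult powr_mult mult_left_mono flip: sum_distrib_left)
    then show ?thesis using lpI[OF assms(1), of "cmod c * lpn p x" "scl c x"] by auto
  qed
  then show "scl c x \<in> lp p" using assms by blast
  show "lpn p (scl c x) = cmod c * lpn p x"
  proof (cases "c = 0")
    case False
    have "lpn p x \<le> cmod (1 / c) * lpn p (scl c x)"
      using le[of "scl c x" "1/c"] le[OF assms(2), of c] False by simp
    then have "cmod c * lpn p x \<le> lpn p (scl c x)"
      using False by (simp add: norm_divide field_simps)
    then show ?thesis using le[OF assms(2), of c] by auto
  qed auto
qed

text \<open>Minkowski's inequality from convexity alone: with a and b the two norms, (x + y) / (a +
  b) is a convex combination of the normalised vectors x / a and y / b, and the p-th powers are
  summed coordinatewise. This treats p = 1 and p > 1 alike.\<close>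

lemma add_lp:
  assumes "1 \<le> p" "x \<in> lp p" "y \<in> lp p"
  shows "x + y \<in> lp p" "lpn p (x + y) \<le> lpn p x + lpn p y"
proof -
  let ?a = "lpn p x" and ?b = "lpn p y"
  have "x + y \<in> lp p \<and> lpn p (x + y) \<le> ?a + ?b"
  proof (cases "?a = 0 \<or> ?b = 0")
    case True
    then have "x = 0 \<or> y = 0" using lpn_eq_0 assms by blast
    then show ?thesis using assms by auto
  next
    case False
    then have pos: "?a > 0" "?b > 0" using lpn_nonneg by (metis less_eq_real_def)+
    define t where "t = ?b / (?a + ?b)"
    have t: "0 \<le> t" "t \<le> 1" "1 - t = ?a / (?a + ?b)" using pos by (auto simp: t_def field_simps)
    have pt: "cmod ((x + y) k) powr p \<le>
        (?a + ?b) powr p * ((1 - t) * (cmod (x k) powr p / ?a powr p) + t * (cmod (y k) powr p / ?b powr p))" for k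
    proof -
      have "cmod ((x + y) k) \<le> (?a + ?b) * ((1 - t) * (cmod (x k) / ?a) + t * (cmod (y k) / ?b))"
      proof -
        have "(?a + ?b) * ((1 - t) * (cmod (x k) / ?a) + t * (cmod (y k) / ?b)) = cmod (x k) + cmod (y k)"
          unfolding t(3) using pos add_pos_pos[OF pos] by (simp add: t_def distrib_left)
        then show ?thesis using norm_triangle_ineq[of "x k" "y k"] by simp
      qed
      then have "cmod ((x + y) k) powr p \<le> ((?a + ?b) * ((1 - t) * (cmod (x k) / ?a) + t * (cmod (y k) / ?b))) powr p"
        using assms by (intro powr_mono2) auto
      also have "\<dots> = (?a + ?b) powr p * ((1 - t) * (cmod (x k) / ?a) + t * (cmod (y k) / ?b)) powr p"
        using pos t by (simp add: powr_mult)
      also have "\<dots> \<le> (?a + ?b) powr p * ((1 - t) * (cmod (x k) / ?a) powr p + t * (cmod (y k) / ?b) powr p)"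
        using convex_onD[OF convex_on_powr_nonneg[OF assms(1)] t(1,2), of "cmod (x k) / ?a" "cmod (y k) / ?b"] pos
        by (intro mult_left_mono) auto
      finally show ?thesis using pos by (simp add: powr_divide)
    qed
    have "(\<Sum>k<n. cmod ((x + y) k) powr p) \<le> (?a + ?b) powr p" for n
    proof -
      have "(\<Sum>k<n. cmod ((x + y) k) powr p) \<le> (\<Sum>k<n. (?a + ?b) powr p *
          ((1 - t) * (cmod (x k) powr p / ?a powr p) + t * (cmod (y k) powr p / ?b powr p)))"
        by (rule sum_mono[OF pt])
      also have "\<dots> = (?a + ?b) powr p * ((1 - t) * ((\<Sum>k<n. cmod (x k) powr p) / ?a powr p)
          + t * ((\<Sum>k<n. cmod (y k) powr p) / ?b powr p))"
        by (simp add: sum.distrib sum_divide_distrib sum_distrib_left distrib_left mult.assoc)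
      also have "\<dots> \<le> (?a + ?b) powr p * ((1 - t) * 1 + t * 1)"
        using lp_bound_sum[OF assms(1,2), of "{..<n}"] lp_bound_sum[OF assms(1,3), of "{..<n}"] t pos
        by (intro mult_left_mono add_mono) (auto simp: divide_le_eq_1)
      finally show ?thesis by simp
    qed
    then show ?thesis using lpI[OF assms(1), of "?a + ?b" "x + y"] by (auto simp: add_nonneg_nonneg)
  qed
  then show "x + y \<in> lp p" "lpn p (x + y) \<le> ?a + ?b" by auto
qed

lemma uminus_lp:
  assumes "1 \<le> p" "x \<in> lp p" shows "- x \<in> lp p" "lpn p (- x) = lpn p x"
proof -
  have "- x = scl (-1) x" by (auto simp: fun_eq_iff)
  then show "- x \<in> lp p" "lpn p (- x) = lpn p x" using scl_lp[OF assms, of "-1"] by auto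
qed

lemma diff_lp:
  assumes "1 \<le> p" "x \<in> lp p" "y \<in> lp p"
  shows "x - y \<in> lp p" "lpn p (x - y) \<le> lpn p x + lpn p y"
  using add_lp[OF assms(1,2) uminus_lp(1)[OF assms(1,3)]] uminus_lp(2)[OF assms(1,3)] by auto

lemma lpn_triangle_sub:
  assumes "1 \<le> p" "x \<in> lp p" "y \<in> lp p" shows "lpn p x \<le> lpn p (x - y) + lpn p y"
  using add_lp(2)[OF assms(1) diff_lp(1)[OF assms] assms(3)] by simp

lemma sum_lp:
  fixes x :: "'i \<Rightarrow> vec"
  assumes "1 \<le> p" "\<And>i. i \<in> I \<Longrightarrow> x i \<in> lp p"
  shows "sum x I \<in> lp p" "lpn p (sum x I) \<le> (\<Sum>i\<in>I. lpn p (x i))"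
proof -
  have "sum x I \<in> lp p \<and> lpn p (sum x I) \<le> (\<Sum>i\<in>I. lpn p (x i))"
    using assms(2)
  proof (induction I rule: infinite_finite_induct)
    case (insert i I)
    then have "x i \<in> lp p" "sum x I \<in> lp p" "lpn p (sum x I) \<le> (\<Sum>i\<in>I. lpn p (x i))" by auto
    from add_lp[OF assms(1) this(1,2)] this(3) show ?case
      unfolding sum.insert[OF insert(1,2)] by linarith
  qed auto
  then show "sum x I \<in> lp p" "lpn p (sum x I) \<le> (\<Sum>i\<in>I. lpn p (x i))" by auto
qed

lemma sum_fun_apply: "(sum x I) k = (\<Sum>i\<in>I. x i k)" for x :: "'i \<Rightarrow> 'b \<Rightarrow> 'c::comm_monoid_add"
  by (induction I rule: infinite_finite_induct) auto

text \<open>Norm balls are closed under coordinatewise limits. This replaces completeness: limits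
  are formed coordinate by coordinate and shown afterwards to lie in the space.\<close>

lemma lp_fatou:
  assumes "1 \<le> p" "\<And>n. x n \<in> lp p" "\<And>n. lpn p (x n) \<le> C" "\<And>k. (\<lambda>n. x n k) \<longlonglongrightarrow> y k"
  shows "y \<in> lp p" "lpn p y \<le> C"
proof -
  have "0 \<le> C" using assms(3)[of 0] lpn_nonneg order_trans by blast
  moreover have "(\<Sum>k<m. cmod (y k) powr p) \<le> C powr p" for m
  proof (rule LIMSEQ_le_const2)
    show "(\<lambda>n. \<Sum>k<m. cmod (x n k) powr p) \<longlonglongrightarrow> (\<Sum>k<m. cmod (y k) powr p)"
      using assms(1,4) by (intro tendsto_sum tendsto_powr' tendsto_norm tendsto_const) auto
    have "(\<Sum>k<m. cmod (x n k) powr p) \<le> C powr p" for n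
    proof -
      have "lpn p (x n) powr p \<le> C powr p"
        using assms(1,3) by (intro powr_mono2) auto
      then show ?thesis using lp_bound_sum[OF assms(1) assms(2)[of n], of "{..<m}"] by auto
    qed
    then show "\<exists>N. \<forall>n\<ge>N. (\<Sum>k<m. cmod (x n k) powr p) \<le> C powr p" by blast
  qed
  ultimately show "y \<in> lp p" "lpn p y \<le> C" using lpI[OF assms(1)] by blast+
qed

text \<open>The sum of a series of vectors is taken in each coordinate, so it does not mention p; a
  summable majorant of the norms makes it a norm limit as well.\<close>

definition vsum :: "(nat \<Rightarrow> vec) \<Rightarrow> vec" where "vsum y = (\<lambda>k. \<Sum>n. y n k)"

lemma vsum_coord:
  assumes "1 \<le> p" "\<And>n. y n \<in> lp p" "\<And>n. lpn p (y n) \<le> c n" "summable c"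
  shows "summable (\<lambda>n. y n k)"
  using assms(4)
  by (rule summable_comparison_test[rotated]) (use coord_le_lpn[OF assms(1,2)] assms(3) order_trans in blast)

lemma vsum_lp:
  assumes "1 \<le> p" "\<And>n. y n \<in> lp p" "\<And>n. lpn p (y n) \<le> c n" "summable c"
  shows "vsum y \<in> lp p" "lpn p (vsum y) \<le> suminf c"
proof -
  have c: "0 \<le> c n" for n using assms(3)[of n] lpn_nonneg order_trans by blast
  have lim: "(\<lambda>n. sum y {..<n} k) \<longlonglongrightarrow> vsum y k" for k
    using summable_LIMSEQ[OF vsum_coord[OF assms]] by (simp add: sum_fun_apply vsum_def)
  have b: "lpn p (sum y {..<n}) \<le> suminf c" for n
  proof -
    have "lpn p (sum y {..<n}) \<le> (\<Sum>i<n. c i)"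
      using sum_lp(2)[OF assms(1), of "{..<n}" y, OF assms(2)] sum_mono[of "{..<n}" "\<lambda>i. lpn p (y i)" c] assms(3)
      by (meson order_trans)
    also have "\<dots> \<le> suminf c" using assms(4) c by (intro sum_le_suminf) auto
    finally show ?thesis .
  qed
  show "vsum y \<in> lp p" "lpn p (vsum y) \<le> suminf c"
    using lp_fatou[OF assms(1) sum_lp(1)[OF assms(1)] b lim] assms(2) by auto
qed

lemma vsum_split:
  assumes "1 \<le> p" "\<And>n. y n \<in> lp p" "\<And>n. lpn p (y n) \<le> c n" "summable c"
  shows "vsum y = sum y {..<m} + vsum (\<lambda>n. y (n + m))"
proof
  fix k
  show "vsum y k = (sum y {..<m} + vsum (\<lambda>n. y (n + m))) k"
    using suminf_split_initial_segment[OF vsum_coord[OF assms], of k m]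
    by (simp add: vsum_def sum_fun_apply add.commute)
qed

lemma vsum_tail:
  assumes "1 \<le> p" "\<And>n. y n \<in> lp p" "\<And>n. lpn p (y n) \<le> c n" "summable c"
  shows "lpn p (vsum y - sum y {..<m}) \<le> (\<Sum>n. c (n + m))"
  using vsum_lp(2)[OF assms(1), of "\<lambda>n. y (n + m)" "\<lambda>n. c (n + m)"] assms(2-4)
  by (simp add: vsum_split[OF assms, of m])

section \<open>Truncations and unit vectors\<close>

definition cut :: "nat set \<Rightarrow> vec \<Rightarrow> vec" where "cut S x = (\<lambda>k. if k \<in> S then x k else 0)"

lemma cut_apply [simp]: "cut S x k = (if k \<in> S then x k else 0)"
  by (simp add: cut_def)

lemma cut_lp:
  assumes "1 \<le> p" "x \<in> lp p" shows "cut S x \<in> lp p" "lpn p (cut S x) \<le> lpn p x"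
  by (rule lp_mono[OF assms]; simp)+

lemma lp_tail_small:
  assumes "1 \<le> p" "x \<in> lp p" "0 < \<epsilon>"
  obtains n where "\<And>S. S \<subseteq> {n..} \<Longrightarrow> lpn p (cut S x) \<le> \<epsilon>"
proof -
  let ?g = "\<lambda>k. cmod (x k) powr p"
  have s: "summable ?g" using assms by (simp add: lp_iff)
  have "\<epsilon> powr p > 0" using assms by simp
  then obtain n where n: "\<And>m. \<bar>sum ?g {n..<m}\<bar> < \<epsilon> powr p"
    using s[unfolded summable_Cauchy] by (metis order_refl real_norm_def)
  have "lpn p (cut S x) \<le> \<epsilon>" if "S \<subseteq> {n..}" for S
  proof (rule lpI(2)[OF assms(1)])
    fix m
    have "(\<Sum>k<m. cmod (cut S x k) powr p) \<le> sum ?g {n..<m}"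
    proof -
      have "(\<Sum>k<m. cmod (cut S x k) powr p) = (\<Sum>k\<in>{..<m} \<inter> S. ?g k)"
        by (subst sum.inter_restrict) (auto intro!: sum.cong simp: assms)
      also have "\<dots> \<le> sum ?g {n..<m}" using that by (intro sum_mono2) auto
      finally show ?thesis .
    qed
    then show "(\<Sum>k<m. cmod (cut S x k) powr p) \<le> \<epsilon> powr p" using n[of m] by linarith
  qed (use assms in auto)
  then show ?thesis using that by blast
qed

lemma lp_coord_small:
  assumes "1 \<le> p" "x \<in> lp p" "0 < \<epsilon>"
  obtains n where "\<And>k. k \<ge> n \<Longrightarrow> cmod (x k) \<le> \<epsilon>"
proof -
  obtain n where n: "\<And>S. S \<subseteq> {n..} \<Longrightarrow> lpn p (cut S x) \<le> \<epsilon>"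
    using lp_tail_small[OF assms] by blast
  have "cmod (x k) \<le> \<epsilon>" if "k \<ge> n" for k
    using coord_le_lpn[OF assms(1) cut_lp(1)[OF assms(1,2)], of "{k}" k] n[of "{k}"] that by auto
  then show ?thesis using that by blast
qed

definition unit :: "nat \<Rightarrow> vec" where "unit k = (\<lambda>j. if j = k then 1 else 0)"

lemma unit_apply [simp]: "unit k j = (if j = k then 1 else 0)"
  by (simp add: unit_def)

lemma unit_lp [simp]:
  assumes "1 \<le> p" shows "unit k \<in> lp p" "lpn p (unit k) = 1"
proof -
  have "(\<lambda>j. cmod (unit k j) powr p) = (\<lambda>j. if j = k then 1 else 0)" using assms by auto
  moreover have "(\<lambda>j. if j = k then 1 else (0::real)) sums 1" using sums_single[of k "\<lambda>_. 1::real"] by simp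
  ultimately show "unit k \<in> lp p" "lpn p (unit k) = 1"
    by (auto simp: lp_iff lpn_def sums_iff simp del: unit_apply)
qed

lemma cut_lessThan_eq_sum: "cut {..<n} x = (\<Sum>k<n. scl (x k) (unit k))"
proof
  fix j
  have "(\<Sum>k<n. x k * (if j = k then 1 else 0)) = (\<Sum>k<n. if k = j then x j else 0)"
    by (rule sum.cong) auto
  then show "cut {..<n} x j = (\<Sum>k<n. scl (x k) (unit k)) j" by (simp add: sum_fun_apply)
qed

lemma finite_support_lp:
  assumes "1 \<le> p" "\<And>k. n \<le> k \<Longrightarrow> x k = 0" shows "x \<in> lp p"
proof -
  have "x = cut {..<n} x" using assms(2) by (auto simp: fun_eq_iff not_less)
  then show ?thesis unfolding cut_lessThan_eq_sum
    by (metis (no_types, lifting) assms(1) scl_lp(1) sum_lp(1) unit_lp(1))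
qed

lemma lp_head_le:
  assumes "1 \<le> p" "x \<in> lp p" "\<And>k. k < n \<Longrightarrow> cmod (x k) \<le> \<eta>"
  shows "lpn p (cut {..<n} x) \<le> real n * \<eta>"
proof -
  have "lpn p (cut {..<n} x) \<le> (\<Sum>k<n. lpn p (scl (x k) (unit k)))"
    unfolding cut_lessThan_eq_sum by (rule sum_lp) (use assms scl_lp in auto)
  also have "\<dots> \<le> (\<Sum>k<n. \<eta>)"
    using assms scl_lp(2)[OF assms(1) unit_lp(1)[OF assms(1)]] by (intro sum_mono) auto
  finally show ?thesis by simp
qed

section \<open>Bounded operators\<close>

text \<open>The bound is a parameter instead of an operator norm, so no supremum is taken; Neumann
  series and halving arguments work with explicit constants.\<close>

definition opb :: "real \<Rightarrow> real \<Rightarrow> real \<Rightarrow> (vec \<Rightarrow> vec) \<Rightarrow> bool" where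
  "opb p q K T \<longleftrightarrow>
     (\<forall>x\<in>lp p. T x \<in> lp q \<and> lpn q (T x) \<le> K * lpn p x) \<and>
     (\<forall>x\<in>lp p. \<forall>y\<in>lp p. T (x + y) = T x + T y) \<and>
     (\<forall>c. \<forall>x\<in>lp p. T (scl c x) = scl c (T x))"

definition ops :: "real \<Rightarrow> real \<Rightarrow> (vec \<Rightarrow> vec) set" where
  "ops p q = {T. \<exists>K\<ge>0. opb p q K T}"

lemma opb_mono: "opb p q K T \<Longrightarrow> K \<le> M \<Longrightarrow> opb p q M T"
  unfolding opb_def by (meson lpn_nonneg mult_right_mono order_trans)

lemma opb_ops: "opb p q K T \<Longrightarrow> T \<in> ops p q"
  unfolding ops_def mem_Collect_eq by (rule exI[of _ "max 0 K"]) (simp add: opb_mono)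

lemma opsE:
  assumes "T \<in> ops p q" obtains K where "0 \<le> K" "opb p q K T"
  using assms by (auto simp: ops_def)

lemma bounded_operators_ell: "bounded_operators (ell p) = ops p p"
proof (intro equalityI subsetI)
  fix T assume "T \<in> bounded_operators (ell p)"
  then obtain K where "opb p p K T"
    by (auto simp: bounded_operators_def smul_ell opb_def)
  then show "T \<in> ops p p" by (rule opb_ops)
qed (auto simp: bounded_operators_def smul_ell opb_def ops_def)

lemma opb_in: "opb p q K T \<Longrightarrow> x \<in> lp p \<Longrightarrow> T x \<in> lp q"
  and opb_le: "opb p q K T \<Longrightarrow> x \<in> lp p \<Longrightarrow> lpn q (T x) \<le> K * lpn p x"
  by (auto simp: opb_def)

lemma op_in: "T \<in> ops p q \<Longrightarrow> x \<in> lp p \<Longrightarrow> T x \<in> lp q"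
  and op_add: "T \<in> ops p q \<Longrightarrow> x \<in> lp p \<Longrightarrow> y \<in> lp p \<Longrightarrow> T (x + y) = T x + T y"
  and op_scl: "T \<in> ops p q \<Longrightarrow> x \<in> lp p \<Longrightarrow> T (scl c x) = scl c (T x)"
  by (auto simp: ops_def opb_def)

lemma op_zero: assumes "T \<in> ops p q" shows "T 0 = 0"
  using op_scl[OF assms, of 0 0] by simp

lemma op_uminus: assumes "T \<in> ops p q" "x \<in> lp p" shows "T (- x) = - T x"
proof -
  have "- x = scl (-1) x" "- T x = scl (-1) (T x)" by (auto simp: fun_eq_iff)
  then show ?thesis using op_scl[OF assms] by metis
qed

lemma op_diff:
  assumes "1 \<le> p" "T \<in> ops p q" "x \<in> lp p" "y \<in> lp p" shows "T (x - y) = T x - T y"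
  using op_add[OF assms(2,3) uminus_lp(1)[OF assms(1,4)]] op_uminus[OF assms(2,4)] by simp

lemma op_sum:
  fixes x :: "'i \<Rightarrow> vec"
  assumes "1 \<le> p" "T \<in> ops p q" "\<And>i. i \<in> I \<Longrightarrow> x i \<in> lp p"
  shows "T (sum x I) = (\<Sum>i\<in>I. T (x i))"
  using assms(3)
proof (induction I rule: infinite_finite_induct)
  case (insert i I)
  have "T (x i + sum x I) = T (x i) + T (sum x I)"
    using insert sum_lp(1)[OF assms(1), of I x] by (intro op_add[OF assms(2)]) auto
  also have "T (sum x I) = (\<Sum>i\<in>I. T (x i))" using insert by auto
  finally show ?case unfolding sum.insert[OF insert(1,2)] .
qed (use op_zero[OF assms(2)] in auto)

lemma opb_comp:
  assumes "opb p q K T" "opb q r M S" "0 \<le> M" shows "opb p r (M * K) (S \<circ> T)"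
proof -
  have "lpn r (S (T x)) \<le> M * K * lpn p x" if "x \<in> lp p" for x
    using opb_le[OF assms(2) opb_in[OF assms(1) that]]
      mult_left_mono[OF opb_le[OF assms(1) that] assms(3)] by (simp add: mult.assoc)
  then show ?thesis using assms by (auto simp: opb_def)
qed

lemma ops_comp: "T \<in> ops p q \<Longrightarrow> S \<in> ops q r \<Longrightarrow> S \<circ> T \<in> ops p r"
  by (blast elim!: opsE intro: opb_ops[OF opb_comp])

lemma opb_add:
  assumes "1 \<le> q" "opb p q K T" "opb p q M S" shows "opb p q (K + M) (T + S)"
proof -
  have "lpn q (T x + S x) \<le> (K + M) * lpn p x" if "x \<in> lp p" for x
    using add_lp(2)[OF assms(1) opb_in[OF assms(2) that] opb_in[OF assms(3) that]]
      opb_le[OF assms(2) that] opb_le[OF assms(3) that] by (simp add: algebra_simps)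
  then show ?thesis using assms by (auto simp: opb_def add_lp scl_arith)
qed

lemma ops_add: "1 \<le> q \<Longrightarrow> T \<in> ops p q \<Longrightarrow> S \<in> ops p q \<Longrightarrow> T + S \<in> ops p q"
  by (blast elim!: opsE intro: opb_ops[OF opb_add])

lemma opb_uminus: "1 \<le> q \<Longrightarrow> opb p q K T \<Longrightarrow> opb p q K (- T)"
  by (auto simp: opb_def uminus_lp scl_arith)

lemma ops_uminus: "1 \<le> q \<Longrightarrow> T \<in> ops p q \<Longrightarrow> - T \<in> ops p q"
  by (blast elim!: opsE intro: opb_ops[OF opb_uminus])

lemma opb_diff: "1 \<le> q \<Longrightarrow> opb p q K T \<Longrightarrow> opb p q M S \<Longrightarrow> opb p q (K + M) (T - S)"
  using opb_add[of q p K T M "- S"] opb_uminus by simp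

lemma ops_diff: "1 \<le> q \<Longrightarrow> T \<in> ops p q \<Longrightarrow> S \<in> ops p q \<Longrightarrow> T - S \<in> ops p q"
  by (blast elim!: opsE intro: opb_ops[OF opb_diff])

definition sop :: "complex \<Rightarrow> (vec \<Rightarrow> vec) \<Rightarrow> vec \<Rightarrow> vec" where "sop c T = (\<lambda>x. scl c (T x))"

lemma sop_apply [simp]: "sop c T x = scl c (T x)"
  by (simp add: sop_def)

lemma opb_sop:
  assumes "1 \<le> q" "opb p q K T" shows "opb p q (cmod c * K) (sop c T)"
proof -
  have "lpn q (scl c (T x)) \<le> cmod c * K * lpn p x" if "x \<in> lp p" for x
    using scl_lp(2)[OF assms(1) opb_in[OF assms(2) that]]
      mult_left_mono[OF opb_le[OF assms(2) that], of "cmod c"] by (simp add: mult.assoc)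
  then show ?thesis using assms by (auto simp: opb_def scl_lp scl_arith mult.commute)
qed

lemma ops_sop: "1 \<le> q \<Longrightarrow> T \<in> ops p q \<Longrightarrow> sop c T \<in> ops p q"
  by (blast elim!: opsE intro: opb_ops[OF opb_sop])

lemma opb_id: "opb p p 1 id"
  by (auto simp: opb_def)

lemma ops_id: "id \<in> ops p p"
  by (rule opb_ops[OF opb_id])

lemma opb_zero: "opb p q 0 0"
  by (auto simp: opb_def)

lemma ops_zero: "0 \<in> ops p q"
  by (rule opb_ops[OF opb_zero])

lemma op_vsum:
  assumes "1 \<le> p" "1 \<le> q" "T \<in> ops p q"
    "\<And>n. y n \<in> lp p" "\<And>n. lpn p (y n) \<le> c n" "summable c"
  shows "T (vsum y) = vsum (\<lambda>n. T (y n))"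
proof -
  obtain K where K: "0 \<le> K" "opb p q K T" using assms(3) by (rule opsE)
  have vs: "vsum y \<in> lp p" by (rule vsum_lp[OF assms(1,4-6)])
  have "T (vsum y) k = vsum (\<lambda>n. T (y n)) k" for k
  proof -
    have "(\<lambda>m. T (sum y {..<m}) k - T (vsum y) k) \<longlonglongrightarrow> 0"
    proof (rule Lim_null_comparison)
      show "\<forall>\<^sub>F m in sequentially. norm (T (sum y {..<m}) k - T (vsum y) k) \<le> K * (\<Sum>n. c (n + m))"
      proof (intro always_eventually allI)
        fix m
        have s: "sum y {..<m} \<in> lp p" by (rule sum_lp[OF assms(1,4)])
        have "norm (T (sum y {..<m}) k - T (vsum y) k) = cmod (T (vsum y - sum y {..<m}) k)"
          using op_diff[OF assms(1,3) vs s] by (simp add: norm_minus_commute)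
        also have "\<dots> \<le> lpn q (T (vsum y - sum y {..<m}))"
          using coord_le_lpn[OF assms(2)] opb_in[OF K(2)] diff_lp(1)[OF assms(1) vs s] by blast
        also have "\<dots> \<le> K * lpn p (vsum y - sum y {..<m})"
          using opb_le[OF K(2)] diff_lp(1)[OF assms(1) vs s] by blast
        also have "\<dots> \<le> K * (\<Sum>n. c (n + m))"
          by (intro mult_left_mono vsum_tail assms K)
        finally show "norm (T (sum y {..<m}) k - T (vsum y) k) \<le> K * (\<Sum>n. c (n + m))" .
      qed
      have "(\<lambda>m. \<Sum>n. c (n + m)) \<longlonglongrightarrow> 0" using suminf_exist_split2[OF assms(6)] by simp
      then show "(\<lambda>m. K * (\<Sum>n. c (n + m))) \<longlonglongrightarrow> 0"
        using tendsto_mult_right_zero by blast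
    qed
    then have "(\<lambda>m. T (sum y {..<m}) k) \<longlonglongrightarrow> T (vsum y) k"
      by (simp add: LIM_zero_iff)
    moreover have "T (sum y {..<m}) k = (\<Sum>n<m. T (y n) k)" for m
      using op_sum[OF assms(1,3), of "{..<m}" y] assms(4) by (simp add: sum_fun_apply)
    ultimately have "(\<lambda>n. T (y n) k) sums T (vsum y) k" by (simp add: sums_def)
    then show ?thesis by (simp add: vsum_def sums_iff)
  qed
  then show ?thesis by (rule ext)
qed

lemma opb_series:
  assumes "1 \<le> p" "1 \<le> q" "\<And>n. opb p q (K n) (T n)" "summable K"
  shows "opb p q (suminf K) (\<lambda>x. vsum (\<lambda>n. T n x))"
proof -
  have s: "summable (\<lambda>n. K n * lpn p x)" for x using assms(4) by (rule summable_mult2)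
  have in_q: "T n x \<in> lp q" and le: "lpn q (T n x) \<le> K n * lpn p x" if "x \<in> lp p" for n x
    using assms(3)[of n] that by (auto simp: opb_def)
  note co = vsum_coord[OF assms(2) in_q le s]
  have "lpn q (vsum (\<lambda>n. T n x)) \<le> suminf K * lpn p x" "vsum (\<lambda>n. T n x) \<in> lp q" if "x \<in> lp p" for x
    using vsum_lp[OF assms(2) in_q[OF that] le[OF that] s] suminf_mult2[OF assms(4), of "lpn p x"] by auto
  moreover have "vsum (\<lambda>n. T n (x + y)) = vsum (\<lambda>n. T n x) + vsum (\<lambda>n. T n y)" if "x \<in> lp p" "y \<in> lp p" for x y
  proof -
    have "T n (x + y) = T n x + T n y" for n using assms(3)[of n] that by (auto simp: opb_def)
    then have "vsum (\<lambda>n. T n (x + y)) k = (vsum (\<lambda>n. T n x) + vsum (\<lambda>n. T n y)) k" for k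
      using suminf_add[OF co[OF that(1), of k] co[OF that(2), of k]] that by (simp add: vsum_def)
    then show ?thesis by (rule ext)
  qed
  moreover have "vsum (\<lambda>n. T n (scl c x)) = scl c (vsum (\<lambda>n. T n x))" if "x \<in> lp p" for c x
  proof -
    have "T n (scl c x) = scl c (T n x)" for n using assms(3)[of n] that by (auto simp: opb_def)
    then show ?thesis using suminf_mult[OF co[OF that], of c] that by (auto simp: vsum_def fun_eq_iff)
  qed
  ultimately show ?thesis by (auto simp: opb_def)
qed

text \<open>Truncations are finite combinations of unit vectors, and the tails of \<open>x\<close>
  tend to 0 in norm because p is finite. Later identities between operators are checked on unit
  vectors through this lemma.\<close>

lemma op_ext:
  assumes "1 \<le> p" "1 \<le> q" "T \<in> ops p q" "S \<in> ops p q" "\<And>k. T (unit k) = S (unit k)" "x \<in> lp p"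
  shows "T x = S x"
proof -
  have D: "T - S \<in> ops p q" using assms by (intro ops_diff)
  then obtain K where K: "0 \<le> K" "opb p q K (T - S)" by (rule opsE)
  have "lpn q ((T - S) x) \<le> \<epsilon>" if "0 < \<epsilon>" for \<epsilon>
  proof -
    have "\<epsilon> / (K + 1) > 0" using that K by simp
    then obtain n where n: "\<And>S. S \<subseteq> {n..} \<Longrightarrow> lpn p (cut S x) \<le> \<epsilon> / (K + 1)"
      using lp_tail_small[OF assms(1,6)] by metis
    have "x = cut {..<n} x + cut {n..} x" by (auto simp: fun_eq_iff)
    then have "(T - S) x = (T - S) (cut {..<n} x) + (T - S) (cut {n..} x)"
      using op_add[OF D cut_lp(1)[OF assms(1,6)] cut_lp(1)[OF assms(1,6)]] by metis
    moreover have "(T - S) (cut {..<n} x) = (\<Sum>k<n. (T - S) (scl (x k) (unit k)))"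
      unfolding cut_lessThan_eq_sum
      by (rule op_sum[OF assms(1) D]) (rule scl_lp(1)[OF assms(1) unit_lp(1)[OF assms(1)]])
    moreover have "(T - S) (scl (x k) (unit k)) = 0" for k
      using op_scl[OF D unit_lp(1)[OF assms(1)]] assms(5) by simp
    ultimately have "lpn q ((T - S) x) = lpn q ((T - S) (cut {n..} x))" by simp
    also have "\<dots> \<le> K * lpn p (cut {n..} x)"
      by (rule opb_le[OF K(2) cut_lp(1)[OF assms(1,6)]])
    also have "\<dots> \<le> (K + 1) * (\<epsilon> / (K + 1))"
      using K n[of "{n..}"] by (intro mult_mono) auto
    finally show ?thesis using K by simp
  qed
  then have "lpn q ((T - S) x) = 0"
    by (metis dense_ge lpn_nonneg order_antisym)
  then have "(T - S) x = 0" using lpn_eq_0[OF assms(2)] op_in[OF D assms(6)] by blast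
  then show ?thesis by simp
qed

section \<open>Operators induced by injections of the index set, and ampliations\<close>

definition res :: "(nat \<Rightarrow> nat) \<Rightarrow> vec \<Rightarrow> vec" where "res f x = (\<lambda>k. x (f k))"

text \<open>For injective \<open>f\<close> this is the isometry taking \<open>unit k\<close> to
  \<open>unit (f k)\<close>, and \<open>res f\<close> is its left inverse.\<close>

definition emb :: "(nat \<Rightarrow> nat) \<Rightarrow> vec \<Rightarrow> vec" where
  "emb f x = (\<lambda>k. if k \<in> range f then x (inv f k) else 0)"

lemma res_apply [simp]: "res f x k = x (f k)"
  by (simp add: res_def)

lemma emb_apply: "inj f \<Longrightarrow> emb f x (f k) = x k"
  by (simp add: emb_def)

lemma emb_notin: "k \<notin> range f \<Longrightarrow> emb f x k = 0"
  by (simp add: emb_def)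

lemma res_emb: "inj f \<Longrightarrow> res f (emb f x) = x"
  by (auto simp: fun_eq_iff emb_apply)

lemma emb_res: "inj f \<Longrightarrow> emb f (res f x) = cut (range f) x"
  by (auto simp: fun_eq_iff emb_def)

lemma emb_unit: "inj f \<Longrightarrow> emb f (unit k) = unit (f k)"
  by (auto simp: fun_eq_iff emb_def inj_eq)

lemma res_lin: "res f (x + y) = res f x + res f y" "res f (scl c x) = scl c (res f x)"
  by (rule ext; simp)+

lemma emb_lin: "emb f (x + y) = emb f x + emb f y" "emb f (scl c x) = scl c (emb f x)"
  by (rule ext; simp add: emb_def)+

lemma opb_res:
  assumes "1 \<le> p" "inj f" shows "opb p p 1 (res f)"
proof -
  have "res f x \<in> lp p \<and> lpn p (res f x) \<le> lpn p x" if "x \<in> lp p" for x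
  proof -
    have "(\<Sum>k<n. cmod (res f x k) powr p) \<le> lpn p x powr p" for n
      using lp_bound_sum[OF assms(1) that, of "f ` {..<n}"] assms(2)
      by (simp add: sum.reindex inj_on_def)
    then show ?thesis using lpI[OF assms(1) lpn_nonneg, of "res f x" p x] by blast
  qed
  then show ?thesis by (auto simp: opb_def res_lin)
qed

lemma opb_emb:
  assumes "1 \<le> p" "inj f" shows "opb p p 1 (emb f)"
proof -
  have "emb f x \<in> lp p \<and> lpn p (emb f x) \<le> lpn p x" if "x \<in> lp p" for x
  proof -
    have "(\<Sum>k<n. cmod (emb f x k) powr p) \<le> lpn p x powr p" for n
    proof -
      have "(\<Sum>k<n. cmod (emb f x k) powr p) = (\<Sum>k\<in>{..<n} \<inter> range f. cmod (x (inv f k)) powr p)"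
        by (subst sum.inter_restrict) (auto intro!: sum.cong simp: emb_def)
      also have "\<dots> = (\<Sum>j\<in>inv f ` ({..<n} \<inter> range f). cmod (x j) powr p)"
        using inj_on_subset[OF inj_on_inv_into[OF order_refl], of "{..<n} \<inter> range f" f] by (simp add: sum.reindex)
      also have "\<dots> \<le> lpn p x powr p" by (rule lp_bound_sum[OF assms(1) that]) auto
      finally show ?thesis .
    qed
    then show ?thesis using lpI[OF assms(1) lpn_nonneg, of "emb f x" p x] by blast
  qed
  then show ?thesis by (auto simp: opb_def emb_lin)
qed

lemmas ops_res = opb_ops[OF opb_res]
lemmas ops_emb = opb_ops[OF opb_emb]

text \<open>Under \<open>prod_encode\<close> a sequence is a grid with infinitely many rows, each a
  full copy of the space. The ampliation applies \<open>G\<close> to every row, as a block diagonal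
  operator with constant diagonal.\<close>

definition amp :: "(vec \<Rightarrow> vec) \<Rightarrow> vec \<Rightarrow> vec" where
  "amp G x = (\<lambda>k. G (res (\<lambda>j. prod_encode (fst (prod_decode k), j)) x) (snd (prod_decode k)))"

lemma amp_encode [simp]: "amp G x (prod_encode (i, j)) = G (res (\<lambda>j. prod_encode (i, j)) x) j"
  by (simp add: amp_def)

lemma vec_eq_encodeI: "(\<And>i j. x (prod_encode (i, j)) = y (prod_encode (i, j))) \<Longrightarrow> x = y"
  by (metis ext prod_decode_inverse surj_pair)

lemma inj_encode_row: "inj (\<lambda>j. prod_encode (i, j))"
  by (auto intro!: injI)

text \<open>A finite piece of the grid contributes a finite subsum of the p-th power of the norm;
  then the number of columns tends to infinity.\<close>

lemma rows_lpn_sum: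
  assumes "1 \<le> p" "x \<in> lp p"
  shows "(\<Sum>i<m. lpn p (res (\<lambda>j. prod_encode (i, j)) x) powr p) \<le> lpn p x powr p"
proof (rule LIMSEQ_le_const2)
  have r: "res (\<lambda>j. prod_encode (i, j)) x \<in> lp p" for i
    using opb_in[OF opb_res[OF assms(1) inj_encode_row] assms(2)] .
  show "(\<lambda>n. \<Sum>i<m. \<Sum>j<n. cmod (res (\<lambda>j. prod_encode (i, j)) x j) powr p)
      \<longlonglongrightarrow> (\<Sum>i<m. lpn p (res (\<lambda>j. prod_encode (i, j)) x) powr p)"
    unfolding lpn_powr[OF assms(1) r]
    by (intro tendsto_sum summable_LIMSEQ) (use r in \<open>simp add: lp_iff\<close>)
  have "(\<Sum>i<m. \<Sum>j<n. cmod (res (\<lambda>j. prod_encode (i, j)) x j) powr p) \<le> lpn p x powr p" for n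
  proof -
    have "(\<Sum>i<m. \<Sum>j<n. cmod (res (\<lambda>j. prod_encode (i, j)) x j) powr p)
        = (\<Sum>k\<in>prod_encode ` ({..<m} \<times> {..<n}). cmod (x k) powr p)"
      by (subst sum.reindex) (auto simp: sum.cartesian_product inj_prod_encode intro!: sum.cong)
    then show ?thesis using lp_bound_sum[OF assms, of "prod_encode ` ({..<m} \<times> {..<n})"] by simp
  qed
  then show "\<exists>N. \<forall>n\<ge>N. (\<Sum>i<m. \<Sum>j<n. cmod (res (\<lambda>j. prod_encode (i, j)) x j) powr p) \<le> lpn p x powr p"
    by blast
qed

lemma opb_amp:
  assumes "1 \<le> p" "opb p p K G" "0 \<le> K" shows "opb p p K (amp G)"
proof -
  let ?r = "\<lambda>i. res (\<lambda>j. prod_encode (i, j))"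
  have r: "?r i x \<in> lp p" if "x \<in> lp p" for i x
    using opb_in[OF opb_res[OF assms(1) inj_encode_row] that] .
  have "amp G x \<in> lp p \<and> lpn p (amp G x) \<le> K * lpn p x" if x: "x \<in> lp p" for x
  proof -
    have "(\<Sum>k<n. cmod (amp G x k) powr p) \<le> (K * lpn p x) powr p" for n
    proof -
      \<comment> \<open>The code of a pair is at least as large as both components, so the first
        \<open>n\<close> coordinates lie in the first \<open>n\<close> rows and columns.\<close>
      have sub: "{..<n} \<subseteq> prod_encode ` ({..<n} \<times> {..<n})"
      proof
        fix k assume k: "k \<in> {..<n}"
        obtain i j where ij: "k = prod_encode (i, j)" by (metis prod_decode_inverse surj_pair)
        then have "i \<le> k" "j \<le> k" using le_prod_encode_1 le_prod_encode_2 by auto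
        then show "k \<in> prod_encode ` ({..<n} \<times> {..<n})" using ij k by auto
      qed
      have "(\<Sum>k<n. cmod (amp G x k) powr p) \<le> (\<Sum>k\<in>prod_encode ` ({..<n} \<times> {..<n}). cmod (amp G x k) powr p)"
        using sub by (intro sum_mono2) auto
      also have "\<dots> = (\<Sum>i<n. \<Sum>j<n. cmod (G (?r i x) j) powr p)"
        by (subst sum.reindex) (auto simp: sum.cartesian_product inj_prod_encode intro!: sum.cong)
      also have "\<dots> \<le> (\<Sum>i<n. lpn p (G (?r i x)) powr p)"
        using opb_in[OF assms(2) r[OF x]] by (intro sum_mono lp_bound_sum[OF assms(1)]) auto
      also have "\<dots> \<le> (\<Sum>i<n. (K * lpn p (?r i x)) powr p)"
        using opb_le[OF assms(2) r[OF x]] assms(1) by (intro sum_mono powr_mono2) auto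
      also have "\<dots> = K powr p * (\<Sum>i<n. lpn p (?r i x) powr p)"
        using assms(3) by (simp add: powr_mult sum_distrib_left)
      also have "\<dots> \<le> K powr p * lpn p x powr p"
        by (intro mult_left_mono rows_lpn_sum[OF assms(1) x]) auto
      finally show ?thesis using assms(3) by (simp add: powr_mult)
    qed
    then show ?thesis using lpI[OF assms(1), of "K * lpn p x" "amp G x"] assms(3) by auto
  qed
  moreover have "amp G (x + y) = amp G x + amp G y" if "x \<in> lp p" "y \<in> lp p" for x y
  proof (rule vec_eq_encodeI)
    fix i j
    have "?r i (x + y) = ?r i x + ?r i y" by (auto simp: fun_eq_iff)
    then show "amp G (x + y) (prod_encode (i, j)) = (amp G x + amp G y) (prod_encode (i, j))"
      using op_add[OF opb_ops[OF assms(2)] r[OF that(1)] r[OF that(2)], of i i] by simp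
  qed
  moreover have "amp G (scl c x) = scl c (amp G x)" if "x \<in> lp p" for c x
  proof (rule vec_eq_encodeI)
    fix i j
    have "?r i (scl c x) = scl c (?r i x)" by (auto simp: fun_eq_iff)
    then show "amp G (scl c x) (prod_encode (i, j)) = scl c (amp G x) (prod_encode (i, j))"
      using op_scl[OF opb_ops[OF assms(2)] r[OF that], of c i] by simp
  qed
  ultimately show ?thesis by (auto simp: opb_def)
qed

lemma ops_amp: "1 \<le> p \<Longrightarrow> G \<in> ops p p \<Longrightarrow> amp G \<in> ops p p"
  by (blast elim!: opsE intro: opb_ops[OF opb_amp])

definition colop :: "(nat \<Rightarrow> vec) \<Rightarrow> vec \<Rightarrow> vec" where
  "colop v x = vsum (\<lambda>m. scl (x m) (v m))"

text \<open>Coordinates are bounded by the norm, so summable column norms give a bounded operator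
  for any two exponents. Errors with geometrically small columns are collected into one operator
  this way.\<close>

lemma opb_colop:
  assumes "1 \<le> p" "1 \<le> q" "\<And>m. v m \<in> lp q" "\<And>m. lpn q (v m) \<le> c m" "summable c"
  shows "opb p q (suminf c) (colop v)"
  unfolding colop_def
proof (rule opb_series[OF assms(1,2) _ assms(5)])
  fix m
  have "lpn q (scl (x m) (v m)) \<le> c m * lpn p x" if "x \<in> lp p" for x
    using mult_mono[OF assms(4)[of m] coord_le_lpn[OF assms(1) that, of m]] scl_lp(2)[OF assms(2,3)]
      order_trans[OF lpn_nonneg assms(4)[of m]]
    by (simp add: mult.commute)
  then show "opb p q (c m) (\<lambda>x. scl (x m) (v m))"
    using scl_lp(1)[OF assms(2,3)] by (auto simp: opb_def scl_arith)
qed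

lemma colop_unit: "colop v (unit k) = v k"
proof
  fix j
  have "(\<lambda>m. (if m = k then 1 else 0) * v m j) = (\<lambda>m. if m = k then v k j else 0)" by auto
  then show "colop v (unit k) j = v k j"
    using sums_single[of k "\<lambda>_. v k j"] by (simp add: colop_def vsum_def sums_iff)
qed

section \<open>The Rosenblum equation\<close>

text \<open>The map \<open>F Z = - (C Z + Z E)\<close> has bound \<open>c + e\<close> on operators,
  so \<mu> - F is inverted by a Neumann series: Z is the sum of \<open>F ^^ n\<close> applied to
  \<open>Y\<close>, divided by \<mu>^(n+1). It converges once |\<mu>| exceeds
  \<open>c + e\<close>.\<close>

lemma rosenblum:
  assumes p: "1 \<le> p" and q: "1 \<le> q" and C: "opb q q c C" and E: "opb p p e E" and ce: "0 \<le> c" "0 \<le> e"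
    and Y: "Y \<in> ops p q" and lam: "c + e < cmod \<mu>"
  obtains Z where "Z \<in> ops p q" "\<And>x. x \<in> lp p \<Longrightarrow> scl \<mu> (Z x) + C (Z x) + Z (E x) = Y x"
proof -
  define F where "F = (\<lambda>Z. - ((C \<circ> Z) + (Z \<circ> E)))"
  define W where "W n = (F ^^ n) Y" for n
  define T where "T n = sop (1 / \<mu> ^ Suc n) (W n)" for n
  define r where "r = (c + e) / cmod \<mu>"
  obtain y where y: "0 \<le> y" "opb p q y Y" using Y by (rule opsE)
  have l0: "\<mu> \<noteq> 0" using lam ce by auto
  have r: "0 \<le> r" "r < 1" using lam ce by (auto simp: r_def divide_less_eq)
  have W: "opb p q ((c + e) ^ n * y) (W n)" for n
  proof (induction n)
    case 0
    then show ?case using y by (simp add: W_def)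
  next
    case (Suc n)
    have "opb p q (c * ((c + e) ^ n * y) + ((c + e) ^ n * y) * e) ((C \<circ> W n) + (W n \<circ> E))"
      by (rule opb_add[OF q opb_comp[OF Suc C] opb_comp[OF E Suc]]) (use ce y in auto)
    moreover have "W (Suc n) = F (W n)" by (simp only: W_def funpow.simps o_apply)
    then have "W (Suc n) = - ((C \<circ> W n) + (W n \<circ> E))" by (simp only: F_def)
    ultimately have "opb p q (c * ((c + e) ^ n * y) + ((c + e) ^ n * y) * e) (W (Suc n))"
      using opb_uminus[OF q] by metis
    then show ?case by (simp add: algebra_simps)
  qed
  have T: "opb p q (y / cmod \<mu> * r ^ n) (T n)" for n
    using opb_sop[OF q W, of "1 / \<mu> ^ Suc n" n] by (simp add: T_def r_def norm_divide norm_power power_divide norm_mult mult_ac)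
  have s: "summable (\<lambda>n. y / cmod \<mu> * r ^ n)" using r by (intro summable_mult summable_geometric) auto
  define Z where "Z x = vsum (\<lambda>n. T n x)" for x
  have Z: "Z \<in> ops p q" using opb_ops[OF opb_series[OF p q T s]] unfolding Z_def .
  have eq: "scl \<mu> (Z x) + C (Z x) + Z (E x) = Y x" if x: "x \<in> lp p" for x
  proof
    fix k
    have in_q: "T n x \<in> lp q" and le: "lpn q (T n x) \<le> y / cmod \<mu> * r ^ n * lpn p x" if "x \<in> lp p" for n x
      using T[of n] that by (auto simp: opb_def)
    note s' = summable_mult2[OF s]
    have Ex: "E x \<in> lp p" using opb_in[OF E x] .
    have Wx: "W n x \<in> lp q" for n using opb_in[OF W x] .
    note co = vsum_coord[OF q in_q[OF x] le[OF x] s', of k]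
    have coE: "summable (\<lambda>n. T n (E x) k)" using vsum_coord[OF q in_q[OF Ex] le[OF Ex] s'] .
    have coS: "summable (\<lambda>n. T (Suc n) x k)" using co by (subst summable_Suc_iff)
    have "C (Z x) = vsum (\<lambda>n. C (T n x))"
      unfolding Z_def by (rule op_vsum[OF q q opb_ops[OF C] in_q[OF x] le[OF x] s'])
    \<comment> \<open>Applying \<open>F\<close> to a term of the series gives \<mu> times the next
      term, so the left side of the equation telescopes to \<mu> times the term of index 0, which is
      \<open>Y x\<close>.\<close>
    moreover have step: "C (T n x) k + T n (E x) k = - (\<mu> * T (Suc n) x k)" for n
    proof -
      have "C (T n x) = scl (1 / \<mu> ^ Suc n) (C (W n x))"
        using op_scl[OF opb_ops[OF C] Wx] by (simp add: T_def)
      then show ?thesis using l0 by (simp add: T_def W_def F_def field_simps)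
    qed
    moreover have Csum: "summable (\<lambda>n. C (T n x) k)"
    proof -
      have "summable (\<lambda>n. - (\<mu> * T (Suc n) x k) - T n (E x) k)"
        by (intro summable_diff summable_minus summable_mult coS coE)
      then show ?thesis by (simp add: step[symmetric])
    qed
    ultimately have "C (Z x) k + Z (E x) k = (\<Sum>n. - (\<mu> * T (Suc n) x k))"
      using suminf_add[OF Csum coE] by (simp add: vsum_def Z_def)
    also have "\<dots> = - (\<mu> * (\<Sum>n. T (Suc n) x k))"
      using suminf_minus[OF summable_mult[OF coS, of \<mu>]] suminf_mult[OF coS, of \<mu>] by simp
    also have "(\<Sum>n. T (Suc n) x k) = Z x k - T 0 x k"
      using suminf_split_head[OF co] by (simp add: vsum_def Z_def)
    finally have "C (Z x) k + Z (E x) k = - (\<mu> * (Z x k - T 0 x k))" .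
    moreover have "\<mu> * T 0 x k = Y x k" using l0 by (simp add: T_def W_def)
    ultimately show "(scl \<mu> (Z x) + C (Z x) + Z (E x)) k = Y x k"
      by (simp add: algebra_simps)
  qed
  show ?thesis using that[OF Z eq] .
qed

section \<open>Block shift and ampliation\<close>

text \<open>In grid coordinates this moves one row down, while \<open>oidx\<close> enumerates row 0.
  Since every row is a copy of the whole space, the induced shift has infinite multiplicity.\<close>

definition sidx :: "nat \<Rightarrow> nat" where
  "sidx k = prod_encode (Suc (fst (prod_decode k)), snd (prod_decode k))"

definition oidx :: "nat \<Rightarrow> nat" where "oidx j = prod_encode (0, j)"

lemma inj_sidx: "inj sidx"
  by (auto intro!: injI simp: sidx_def prod_eq_iff[symmetric])

lemma inj_oidx: "inj oidx"
  by (auto intro!: injI simp: oidx_def)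

definition "shift = emb sidx"
definition "shift_adj = res sidx"
definition "incl0 = emb oidx"
definition "proj0 = res oidx"

lemma sidx_encode [simp]: "sidx (prod_encode (i, j)) = prod_encode (Suc i, j)"
  by (simp add: sidx_def)

lemma block_coords [simp]:
  "shift x (prod_encode (Suc i, j)) = x (prod_encode (i, j))"
  "shift x (prod_encode (0, j)) = 0"
  "shift_adj x (prod_encode (i, j)) = x (prod_encode (Suc i, j))"
  "incl0 x (prod_encode (0, j)) = x j"
  "incl0 x (prod_encode (Suc i, j)) = 0"
  "proj0 x j = x (prod_encode (0, j))"
proof -
  show "shift x (prod_encode (Suc i, j)) = x (prod_encode (i, j))"
    using emb_apply[OF inj_sidx, of x "prod_encode (i, j)"] by (simp add: shift_def)
  show "shift x (prod_encode (0, j)) = 0"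
    unfolding shift_def by (rule emb_notin) (auto simp: sidx_def)
  show "incl0 x (prod_encode (0, j)) = x j"
    using emb_apply[OF inj_oidx, of x j] by (simp add: incl0_def oidx_def)
  show "incl0 x (prod_encode (Suc i, j)) = 0"
    unfolding incl0_def by (rule emb_notin) (auto simp: oidx_def)
qed (auto simp: shift_adj_def proj0_def oidx_def)

lemma opb_block:
  assumes "1 \<le> p"
  shows "opb p p 1 shift" "opb p p 1 shift_adj" "opb p p 1 incl0" "opb p p 1 proj0"
  using opb_emb[OF assms] opb_res[OF assms] inj_sidx inj_oidx
  by (auto simp: shift_def shift_adj_def incl0_def proj0_def)

lemmas ops_block = opb_block[THEN opb_ops]

lemma block_lin:
  "shift (x + y) = shift x + shift y" "shift (x - y) = shift x - shift y" "shift 0 = 0"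
  "shift_adj (x + y) = shift_adj x + shift_adj y" "shift_adj (x - y) = shift_adj x - shift_adj y" "shift_adj 0 = 0"
  "incl0 (x + y) = incl0 x + incl0 y" "incl0 (x - y) = incl0 x - incl0 y" "incl0 0 = 0"
  "proj0 (x + y) = proj0 x + proj0 y" "proj0 (x - y) = proj0 x - proj0 y" "proj0 0 = 0"
  unfolding shift_def shift_adj_def incl0_def proj0_def
  by (rule ext, simp add: emb_def)+

lemma block_rels [simp]:
  "shift_adj (shift x) = x" "proj0 (incl0 x) = x" "proj0 (shift x) = 0" "shift_adj (incl0 x) = 0"
proof -
  show "shift_adj (shift x) = x" "shift_adj (incl0 x) = 0" by (rule vec_eq_encodeI; simp)+
  show "proj0 (incl0 x) = x" "proj0 (shift x) = 0" by (rule ext; simp)+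
qed

text \<open>Row 0 and the other rows exhaust the grid. This identity, 1 - R L = projection onto row
  0, closes every shift argument below.\<close>

lemma block_decomp: "shift (shift_adj x) + incl0 (proj0 x) = x"
proof (rule vec_eq_encodeI)
  show "(shift (shift_adj x) + incl0 (proj0 x)) (prod_encode (i, j)) = x (prod_encode (i, j))" for i j
    by (cases i) auto
qed

lemma row_block:
  "res (\<lambda>j. prod_encode (0, j)) (shift x) = 0"
  "res (\<lambda>j. prod_encode (Suc i, j)) (shift x) = res (\<lambda>j. prod_encode (i, j)) x"
  "res (\<lambda>j. prod_encode (i, j)) (shift_adj x) = res (\<lambda>j. prod_encode (Suc i, j)) x"
  "res (\<lambda>j. prod_encode (0, j)) (incl0 x) = x"
  "res (\<lambda>j. prod_encode (Suc i, j)) (incl0 x) = 0"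
  "res (\<lambda>j. prod_encode (i, j)) (amp G x) = G (res (\<lambda>j. prod_encode (i, j)) x)"
  by (rule ext; simp)+

text \<open>An ampliation acts in the same way on each row, so it commutes with moving rows. The
  condition \<open>G 0 = 0\<close> serves the rows that \<open>shift\<close> and
  \<open>incl0\<close> leave empty.\<close>

lemma amp_rels:
  assumes "G 0 = 0"
  shows "amp G (shift x) = shift (amp G x)" "amp G (shift_adj x) = shift_adj (amp G x)"
    "amp G (incl0 x) = incl0 (G x)" "proj0 (amp G x) = G (proj0 x)"
proof -
  show "amp G (shift x) = shift (amp G x)"
  proof (rule vec_eq_encodeI)
    show "amp G (shift x) (prod_encode (i, j)) = shift (amp G x) (prod_encode (i, j))" for i j
      by (cases i) (auto simp: row_block assms)
  qed
  show "amp G (shift_adj x) = shift_adj (amp G x)"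
    by (rule vec_eq_encodeI) (simp add: row_block)
  show "amp G (incl0 x) = incl0 (G x)"
  proof (rule vec_eq_encodeI)
    show "amp G (incl0 x) (prod_encode (i, j)) = incl0 (G x) (prod_encode (i, j))" for i j
      by (cases i) (auto simp: row_block assms)
  qed
  have "res (\<lambda>j. prod_encode (0, j)) x = proj0 x" by (rule ext) simp
  then show "proj0 (amp G x) = G (proj0 x)"
    by (intro ext) simp
qed

lemma amp_comp: "amp G (amp H x) = amp (G \<circ> H) x"
  by (rule vec_eq_encodeI) (simp add: row_block)

lemma amp_cong:
  assumes "1 \<le> p" "\<And>x. x \<in> lp p \<Longrightarrow> G x = H x" "x \<in> lp p" shows "amp G x = amp H x"
proof (rule vec_eq_encodeI)
  fix i j
  have "res (\<lambda>j. prod_encode (i, j)) x \<in> lp p"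
    using opb_in[OF opb_res[OF assms(1) inj_encode_row] assms(3)] .
  then show "amp G x (prod_encode (i, j)) = amp H x (prod_encode (i, j))" by (simp add: assms(2))
qed

section \<open>Operators of column type\<close>

text \<open>
  \<open>N\<close> lives on the range of \<open>\<zeta>\<close> and kills a complemented copy of the whole space. \<open>R\<close> is a shift of
  infinite multiplicity on the range of \<open>\<zeta>\<close> whose left inverse has kernel exactly the range of
  \<open>\<pi>\<close>; the diagonal operator \<open>S\<close> solves \<open>S - R S L = \<pi> N\<close>.
\<close>

lemma column_commutator:
  assumes p: "1 \<le> p" and ops: "\<zeta> \<in> ops p p" "\<Phi> \<in> ops p p" "\<Psi> \<in> ops p p" "N \<in> ops p p"
    and z\<Phi>: "\<And>x. x \<in> lp p \<Longrightarrow> \<zeta> (\<Phi> x) = \<Phi> x" and \<Psi>z: "\<And>x. x \<in> lp p \<Longrightarrow> \<Psi> (\<zeta> x) = \<Psi> x"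
    and \<Psi>\<Phi>: "\<And>x. x \<in> lp p \<Longrightarrow> \<Psi> (\<Phi> x) = x" and zz: "\<And>x. x \<in> lp p \<Longrightarrow> \<zeta> (\<zeta> x) = \<zeta> x"
    and Nz: "\<And>x. x \<in> lp p \<Longrightarrow> N (\<zeta> x) = N x" and zN: "\<And>x. x \<in> lp p \<Longrightarrow> \<zeta> (N x) = N x"
    and N\<Phi>: "\<And>x. x \<in> lp p \<Longrightarrow> N (\<Phi> x) = 0"
  obtains R B where "R \<in> ops p p" "B \<in> ops p p"
    "\<And>x. x \<in> lp p \<Longrightarrow> B (R x) - R (B x) = N x"
    "\<And>x. x \<in> lp p \<Longrightarrow> R (\<zeta> x) = R x" "\<And>x. x \<in> lp p \<Longrightarrow> \<zeta> (R x) = R x"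
    "\<And>x. x \<in> lp p \<Longrightarrow> B (\<zeta> x) = B x" "\<And>x. x \<in> lp p \<Longrightarrow> \<zeta> (B x) = B x"
proof -
  note [simp] = add_lp(1)[OF p] diff_lp(1)[OF p] op_in[OF ops(1)] op_in[OF ops(2)] op_in[OF ops(3)] op_in[OF ops(4)]
    ops_block[OF p, THEN op_in] z\<Phi> \<Psi>z \<Psi>\<Phi> zz Nz zN N\<Phi> block_lin op_zero[OF ops(1)] op_zero[OF ops(2)] op_zero[OF ops(3)] op_zero[OF ops(4)]
  note [simp] = ops[THEN op_add] ops[THEN op_diff[OF p]]
  note cmp = ops_comp[where p=p and q=p and r=p]
  \<comment> \<open>The projection, inside the range of \<open>\<zeta>\<close>, onto the kernel of
    \<open>\<Psi>\<close> along the range of \<open>\<Phi>\<close>. Thus the range of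
    \<open>\<zeta>\<close> is the range of \<open>\<pi>\<close> plus a copy of the whole
    space.\<close>
  define \<pi> where "\<pi> = \<zeta> - (\<Phi> \<circ> \<Psi>)"
  have \<pi>: "\<pi> \<in> ops p p" unfolding \<pi>_def by (intro ops_diff p ops cmp)
  have \<pi>_apply: "\<pi> x = \<zeta> x - \<Phi> (\<Psi> x)" for x by (simp add: \<pi>_def)
  note [simp] = op_in[OF \<pi>] op_zero[OF \<pi>] op_add[OF \<pi>] op_diff[OF p \<pi>]
  have [simp]: "\<pi> (\<pi> x) = \<pi> x" "\<pi> (\<Phi> x) = 0" "\<Psi> (\<pi> x) = 0" "\<pi> (\<zeta> x) = \<pi> x" "\<zeta> (\<pi> x) = \<pi> x" "N (\<pi> x) = N x"
    if "x \<in> lp p" for x using that by (simp_all add: \<pi>_apply)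
  define e where "e = amp \<pi>"
  have e: "e \<in> ops p p" unfolding e_def by (intro ops_amp p \<pi>)
  note [simp] = op_in[OF e] op_zero[OF e] op_add[OF e] op_diff[OF p e]
  have [simp]: "e (e x) = e x" if "x \<in> lp p" for x
    unfolding e_def amp_comp using that by (intro amp_cong[OF p]) auto
  have e_rels: "e (shift x) = shift (e x)" "e (shift_adj x) = shift_adj (e x)"
    "e (incl0 x) = incl0 (\<pi> x)" "proj0 (e x) = \<pi> (proj0 x)" for x
    unfolding e_def by (rule amp_rels; simp)+
  \<comment> \<open>The range of \<open>e\<close> consists of the grids whose rows all lie in the
    range of \<open>\<pi>\<close>. There \<open>M\<close> is the block shift and \<open>M'\<close>
    its left inverse; on the complement both are the identity.\<close>
  define M where "M = (shift \<circ> e) + id - e"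
  define M' where "M' = (shift_adj \<circ> e) + id - e"
  have M: "M \<in> ops p p" "M' \<in> ops p p"
    unfolding M_def M'_def by (intro ops_diff ops_add cmp ops_id e ops_block p)+
  have M_apply: "M x = shift (e x) + x - e x" "M' x = shift_adj (e x) + x - e x" for x
    by (simp_all add: M_def M'_def)
  note [simp] = M[THEN op_in] M[THEN op_zero] M[THEN op_add] M[THEN op_diff[OF p]]
  \<comment> \<open>\<open>R\<close> sends the range of \<open>\<pi>\<close> to row 0 of the copy
    behind \<open>\<Phi>\<close>, where \<open>M\<close> has made room. Hence
    \<open>Lo (R x) = \<zeta> x\<close>, and \<open>R (Lo x) = \<Phi> (\<Psi> x)\<close> misses
    exactly the range of \<open>\<pi>\<close>.\<close>
  define R where "R = (\<Phi> \<circ> incl0 \<circ> \<pi>) + (\<Phi> \<circ> M \<circ> \<Psi>)"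
  define Lo where "Lo = (\<pi> \<circ> proj0 \<circ> \<Psi>) + (\<Phi> \<circ> M' \<circ> \<Psi>)"
  have R: "R \<in> ops p p" and Lo: "Lo \<in> ops p p"
    unfolding R_def Lo_def by (intro ops_add cmp ops M \<pi> ops_block p)+
  have R_apply: "R x = \<Phi> (incl0 (\<pi> x)) + \<Phi> (M (\<Psi> x))" and Lo_apply: "Lo x = \<pi> (proj0 (\<Psi> x)) + \<Phi> (M' (\<Psi> x))" for x
    by (simp_all add: R_def Lo_def)
  define H where "H = \<pi> \<circ> N"
  have H: "H \<in> ops p p" unfolding H_def by (intro cmp ops \<pi>)
  have H_apply: "H x = \<pi> (N x)" for x by (simp add: H_def)
  define aH where "aH = amp H"
  have aH: "aH \<in> ops p p" unfolding aH_def by (intro ops_amp p H)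
  note [simp] = op_in[OF R] op_in[OF Lo] op_in[OF H] op_in[OF aH] op_zero[OF H]
  have aH_rels: "aH (shift_adj x) = shift_adj (aH x)" "incl0 (H (proj0 x)) = incl0 (proj0 (aH x))" for x
    unfolding aH_def by (simp_all add: amp_rels)
  have [simp]: "aH (e x) = aH x" if "x \<in> lp p" for x
    unfolding e_def aH_def amp_comp using that by (intro amp_cong[OF p]) (auto simp: H_apply)
  have [simp]: "e (aH x) = aH x" if "x \<in> lp p" for x
    unfolding e_def aH_def amp_comp using that by (intro amp_cong[OF p]) (auto simp: H_apply)
  \<comment> \<open>\<open>H\<close> is repeated on the range of \<open>\<pi>\<close> and on every
    row. Conjugation by the shift moves all copies one place on, so \<open>S - R S Lo\<close> leaves
    only the first one.\<close>
  define S where "S = H + (\<Phi> \<circ> aH \<circ> \<Psi>)"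
  have S: "S \<in> ops p p" unfolding S_def by (intro ops_add cmp H aH ops p)
  have S_apply: "S x = H x + \<Phi> (aH (\<Psi> x))" for x by (simp add: S_def)
  \<comment> \<open>\<open>N\<close> kills the range of \<open>\<Phi>\<close> and so the range of
    \<open>R\<close>; hence \<open>B R = S\<close>. In \<open>R B\<close> the second term of
    \<open>B\<close> supplies \<open>\<Phi> \<Psi> N\<close>, the part of \<open>N\<close> that
    \<open>H = \<pi> N\<close> omits.\<close>
  define B where "B = (S \<circ> Lo) - (Lo \<circ> N)"
  have B: "B \<in> ops p p" unfolding B_def by (intro ops_diff cmp S Lo ops p)
  have B_apply: "B x = S (Lo x) - Lo (N x)" for x by (simp add: B_def)
  note [simp] = op_in[OF S] op_add[OF S] op_diff[OF p S] op_diff[OF p R] op_add[OF R]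
    op_add[OF aH] op_diff[OF p aH]
  have LoR: "Lo (R x) = \<zeta> x" if x: "x \<in> lp p" for x
  proof -
    have 1: "\<Psi> (R x) = incl0 (\<pi> x) + M (\<Psi> x)" using x by (simp add: R_apply)
    have 2: "M' (incl0 (\<pi> x)) = 0" using x by (simp add: M_apply e_rels)
    have 3: "M' (M (\<Psi> x)) = \<Psi> x" using x by (simp add: M_apply e_rels algebra_simps)
    have 4: "\<pi> (proj0 (M (\<Psi> x))) = 0" using x by (simp add: M_apply e_rels)
    have "Lo (R x) = \<pi> x + \<Phi> (\<Psi> x)" unfolding Lo_apply 1 using x 2 3 4 by simp
    then show ?thesis by (simp add: \<pi>_apply)
  qed
  have RLo: "R (Lo x) = \<Phi> (\<Psi> x)" if x: "x \<in> lp p" for x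
  proof -
    have 1: "\<Psi> (Lo x) = M' (\<Psi> x)" "\<pi> (Lo x) = \<pi> (proj0 (\<Psi> x))" using x by (simp_all add: Lo_apply)
    have 2: "M (M' y) = shift (shift_adj (e y)) + y - e y" if "y \<in> lp p" for y
      using that by (simp add: M_apply e_rels algebra_simps)
    have 3: "incl0 (\<pi> (proj0 y)) = incl0 (proj0 (e y))" for y by (simp add: e_rels)
    have 4: "incl0 (proj0 (e y)) + (shift (shift_adj (e y)) + y - e y) = y" for y
      using block_decomp[of "e y"] by (simp add: algebra_simps)
    have "R (Lo x) = \<Phi> (incl0 (proj0 (e (\<Psi> x))) + (shift (shift_adj (e (\<Psi> x))) + \<Psi> x - e (\<Psi> x)))"
      unfolding R_apply 1 using x by (subst op_add[OF ops(2)]) (auto simp: 2 3)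
    then show ?thesis unfolding 4 .
  qed
  have S_eq: "S x - R (S (Lo x)) = H x" if x: "x \<in> lp p" for x
  proof -
    have 1: "H (Lo x) = H (proj0 (\<Psi> x))" using x by (simp add: H_apply Lo_apply)
    have 2: "aH (M' y) = shift_adj (aH y)" if "y \<in> lp p" for y
      using that by (simp add: M_apply aH_rels)
    have 3: "S (Lo x) = H (proj0 (\<Psi> x)) + \<Phi> (shift_adj (aH (\<Psi> x)))"
      unfolding S_apply 1 using x by (simp add: Lo_apply 2)
    have 4: "\<pi> (H y) = H y" "\<Psi> (H y) = 0" if "y \<in> lp p" for y using that by (simp_all add: H_apply)
    have 5: "M (shift_adj (aH y)) = shift (shift_adj (aH y))" if "y \<in> lp p" for y
      using that by (simp add: M_apply e_rels)
    have "R (S (Lo x)) = \<Phi> (incl0 (proj0 (aH (\<Psi> x)))) + \<Phi> (shift (shift_adj (aH (\<Psi> x))))"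
      unfolding 3 R_apply using x by (simp add: 4 5 aH_rels)
    also have "\<dots> = \<Phi> (aH (\<Psi> x))"
      using x block_decomp[of "aH (\<Psi> x)"] by (subst op_add[OF ops(2), symmetric]) (auto simp: add.commute)
    finally show ?thesis by (simp add: S_apply)
  qed
  have R\<zeta>: "R (\<zeta> x) = R x" "\<zeta> (R x) = R x" if "x \<in> lp p" for x using that by (simp_all add: R_apply)
  have L\<zeta>: "Lo (\<zeta> x) = Lo x" "\<zeta> (Lo x) = Lo x" if "x \<in> lp p" for x using that by (simp_all add: Lo_apply)
  have S\<zeta>: "S (\<zeta> x) = S x" "\<zeta> (S x) = S x" if "x \<in> lp p" for x using that by (simp_all add: S_apply H_apply)
  have main: "B (R x) - R (B x) = N x" if x: "x \<in> lp p" for x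
  proof -
    have "N (R x) = 0" using x by (simp add: R_apply)
    then have "B (R x) = S x" using x by (simp add: B_apply LoR S\<zeta> op_zero[OF Lo])
    moreover have "R (B x) = R (S (Lo x)) - \<Phi> (\<Psi> (N x))"
      using x by (simp add: B_apply RLo)
    ultimately have "B (R x) - R (B x) = H x + \<Phi> (\<Psi> (N x))" using S_eq[OF x] by (simp add: algebra_simps)
    then show ?thesis using x by (simp add: H_apply \<pi>_apply)
  qed
  have "B (\<zeta> x) = B x" "\<zeta> (B x) = B x" if "x \<in> lp p" for x using that by (simp_all add: B_apply L\<zeta> S\<zeta>)
  then show ?thesis using that[OF R B main R\<zeta>] by blast
qed

section \<open>Commutators from a factorisation of the identity\<close>

lemma commutatorI:
  assumes "A \<in> ops p p" "B \<in> ops p p" "\<And>x. x \<in> lp p \<Longrightarrow> T x = A (B x) - B (A x)"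
  shows "is_commutator_on (ell p) T"
  using assms unfolding is_commutator_on_def bounded_operators_ell by blast

lemma commutatorE:
  assumes "is_commutator_on (ell p) T"
  obtains A B where "A \<in> ops p p" "B \<in> ops p p" "\<And>x. x \<in> lp p \<Longrightarrow> T x = A (B x) - B (A x)"
  using assms unfolding is_commutator_on_def bounded_operators_ell by blast

lemma commutator_similar:
  assumes p: "1 \<le> p" and ops: "G \<in> ops p p" "G' \<in> ops p p" "T \<in> ops p p"
    and GG': "\<And>x. x \<in> lp p \<Longrightarrow> G (G' x) = x" "\<And>x. x \<in> lp p \<Longrightarrow> G' (G x) = x"
    and comm: "is_commutator_on (ell p) (G \<circ> T \<circ> G')"
  shows "is_commutator_on (ell p) T"
proof -
  obtain A B where AB: "A \<in> ops p p" "B \<in> ops p p"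
    and eq: "\<And>x. x \<in> lp p \<Longrightarrow> (G \<circ> T \<circ> G') x = A (B x) - B (A x)"
    using commutatorE[OF comm] by blast
  note cmp = ops_comp[where p=p and q=p and r=p]
  note [simp] = op_in[OF AB(1)] op_in[OF AB(2)] ops[THEN op_in] GG'
  show ?thesis
  proof (rule commutatorI)
    show "G' \<circ> A \<circ> G \<in> ops p p" "G' \<circ> B \<circ> G \<in> ops p p" by (intro cmp ops AB)+
    fix x assume x: "x \<in> lp p"
    have "T x = G' (G (T (G' (G x))))" using x by simp
    also have "G (T (G' (G x))) = A (B (G x)) - B (A (G x))" using eq[of "G x"] x by simp
    also have "G' \<dots> = G' (A (B (G x))) - G' (B (A (G x)))" using x by (intro op_diff[OF p ops(2)]) simp_all
    finally show "T x = (G' \<circ> A \<circ> G) ((G' \<circ> B \<circ> G) x) - (G' \<circ> B \<circ> G) ((G' \<circ> A \<circ> G) x)"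
      using x by simp
  qed
qed

text \<open>
  Along the splitting of the space into the kernel of \<open>V\<close> and the range of \<open>T \<circ> U\<close>, the lower left
  corner \<open>c\<close> of \<open>T\<close> has the right inverse \<open>U\<close>. A unipotent similarity therefore makes both diagonal
  corners of column type, so each of them is a commutator. Adding a large scalar to one of the
  two shifts makes the off-diagonal equations Rosenblum equations with separated coefficients.
\<close>

lemma commutator_of_factorization:
  assumes p: "1 \<le> p" and ops: "T \<in> ops p p" "U \<in> ops p p" "V \<in> ops p p"
    and VU: "\<And>x. x \<in> lp p \<Longrightarrow> V (U x) = 0" and VTU: "\<And>x. x \<in> lp p \<Longrightarrow> V (T (U x)) = x"
  shows "is_commutator_on (ell p) T"
proof -
  note cmp = ops_comp[where p=p and q=p and r=p]
  note [simp] = add_lp(1)[OF p] diff_lp(1)[OF p] ops[THEN op_in] ops[THEN op_zero]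
    ops[THEN op_add] ops[THEN op_diff[OF p]] ops_block[OF p, THEN op_in] block_lin VU VTU
  \<comment> \<open>As \<open>V T U = 1\<close>, the product \<open>T U V\<close> is idempotent, and
    \<open>\<zeta>\<close> projects onto the kernel of \<open>V\<close> along the range of
    \<open>T U\<close>.\<close>
  define \<zeta> where "\<zeta> = id - (T \<circ> U \<circ> V)"
  have \<zeta>: "\<zeta> \<in> ops p p" unfolding \<zeta>_def by (intro ops_diff cmp ops ops_id p)
  have \<zeta>_apply: "\<zeta> x = x - T (U (V x))" for x by (simp add: \<zeta>_def)
  note [simp] = op_in[OF \<zeta>] op_zero[OF \<zeta>] op_add[OF \<zeta>] op_diff[OF p \<zeta>]
  have [simp]: "\<zeta> (T (U x)) = 0" "V (\<zeta> x) = 0" "\<zeta> (U x) = U x" "\<zeta> (\<zeta> x) = \<zeta> x" if "x \<in> lp p" for x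
    using that by (simp_all add: \<zeta>_apply)
  \<comment> \<open>Corners of \<open>T\<close> for the splitting given by \<open>\<zeta>\<close>,
    with the range of \<open>T U\<close> read through \<open>V\<close> as a copy of the whole space.
    Since \<open>V U = 0\<close>, the corner \<open>c\<close> satisfies
    \<open>c U = 1\<close>.\<close>
  define a where "a = \<zeta> \<circ> T \<circ> \<zeta>"
  define c where "c = V \<circ> T \<circ> \<zeta>"
  define d where "d = V \<circ> T \<circ> T \<circ> U"
  have acd: "a \<in> ops p p" "c \<in> ops p p" "d \<in> ops p p"
    unfolding a_def c_def d_def by (intro cmp ops \<zeta>)+
  have acd_apply: "a x = \<zeta> (T (\<zeta> x))" "c x = V (T (\<zeta> x))" "d x = V (T (T (U x)))" for x
    by (simp_all add: a_def c_def d_def)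
  note [simp] = acd[THEN op_in] acd[THEN op_zero] acd[THEN op_add] acd[THEN op_diff[OF p]]
  have [simp]: "c (U x) = x" "c (\<zeta> x) = c x" "a (\<zeta> x) = a x" "\<zeta> (a x) = a x" if "x \<in> lp p" for x
    using that by (simp_all add: acd_apply)
  \<comment> \<open>Row 0 and the other rows get different tasks. On row 0, \<open>c X = d\<close>,
    so \<open>d - c X\<close> kills row 0; on the other rows \<open>X = - a U\<close>, so
    \<open>a + X c\<close> kills \<open>U\<close> of the range of the shift.\<close>
  define X where "X = (U \<circ> d \<circ> incl0 \<circ> proj0) - (a \<circ> U \<circ> shift \<circ> shift_adj)"
  have X: "X \<in> ops p p" unfolding X_def by (intro ops_diff cmp ops acd ops_block p)
  have X_apply: "X x = U (d (incl0 (proj0 x))) - a (U (shift (shift_adj x)))" for x by (simp add: X_def)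
  note [simp] = op_in[OF X] op_zero[OF X] op_add[OF X] op_diff[OF p X]
  have [simp]: "\<zeta> (X x) = X x" if "x \<in> lp p" for x using that by (simp add: X_apply)
  have [simp]: "V (X x) = 0" if "x \<in> lp p" for x
    using that \<open>x \<in> lp p \<Longrightarrow> \<zeta> (X x) = X x\<close> by (metis \<open>\<And>x. x \<in> lp p \<Longrightarrow> V (\<zeta> x) = 0\<close> op_in[OF X])
  have cX: "c (X x) = V (T (X x))" if "x \<in> lp p" for x using that by (simp add: acd_apply)
  define a' where "a' = a + (X \<circ> c)"
  define d' where "d' = d - (c \<circ> X)"
  have ad': "a' \<in> ops p p" "d' \<in> ops p p"
    unfolding a'_def d'_def by (intro ops_add ops_diff cmp acd X p)+
  have ad'_apply: "a' x = a x + X (c x)" "d' x = d x - c (X x)" for x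
    by (simp_all add: a'_def d'_def)
  have a'z: "a' (\<zeta> x) = a' x" "\<zeta> (a' x) = a' x" if "x \<in> lp p" for x using that by (simp_all add: ad'_apply)
  \<comment> \<open>In the first corner the complemented copy sits on \<open>U\<close> of the range
    of the shift, with left inverse \<open>shift_adj \<circ> c\<close>; in the second corner, on row
    0.\<close>
  obtain R1 B1 where RB1: "R1 \<in> ops p p" "B1 \<in> ops p p" "\<And>x. x \<in> lp p \<Longrightarrow> B1 (R1 x) - R1 (B1 x) = a' x"
    and z1: "\<And>x. x \<in> lp p \<Longrightarrow> R1 (\<zeta> x) = R1 x" "\<And>x. x \<in> lp p \<Longrightarrow> \<zeta> (R1 x) = R1 x"
      "\<And>x. x \<in> lp p \<Longrightarrow> B1 (\<zeta> x) = B1 x" "\<And>x. x \<in> lp p \<Longrightarrow> \<zeta> (B1 x) = B1 x"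
  proof (rule column_commutator[OF p \<zeta> _ _ ad'(1), of "U \<circ> shift" "shift_adj \<circ> c"])
    show "U \<circ> shift \<in> ops p p" "shift_adj \<circ> c \<in> ops p p" by (intro cmp ops acd ops_block p)+
  qed (simp_all add: a'z, simp add: ad'_apply X_apply)
  obtain R2 B2 where RB2: "R2 \<in> ops p p" "B2 \<in> ops p p" "\<And>x. x \<in> lp p \<Longrightarrow> B2 (R2 x) - R2 (B2 x) = d' x"
    by (rule column_commutator[OF p ops_id ops_block(3)[OF p] ops_block(4)[OF p] ad'(2)])
      (simp_all, simp add: ad'_apply X_apply)
  \<comment> \<open>\<open>V X = 0\<close>, so \<open>X V\<close> has square zero and
    \<open>1 - X V\<close> is the inverse of \<open>1 + X V\<close>.\<close>
  define G where "G = id + (X \<circ> V)"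
  define G' where "G' = id - (X \<circ> V)"
  have G: "G \<in> ops p p" "G' \<in> ops p p" unfolding G_def G'_def by (intro ops_add ops_diff ops_id cmp X ops p)+
  have G_apply: "G x = x + X (V x)" "G' x = x - X (V x)" for x by (simp_all add: G_def G'_def)
  define T' where "T' = G \<circ> T \<circ> G'"
  have T': "T' \<in> ops p p" unfolding T'_def by (intro cmp G ops)
  have T'_apply: "T' x = G (T (G' x))" for x by (simp add: T'_def)
  note [simp] = G[THEN op_in] op_in[OF T'] op_add[OF T'] op_diff[OF p T'] RB1(1,2)[THEN op_in] RB2(1,2)[THEN op_in]
    RB1(1,2)[THEN op_add] RB2(1,2)[THEN op_add] RB1(1,2)[THEN op_diff[OF p]] RB2(1,2)[THEN op_diff[OF p]] z1
    RB1(1,2)[THEN op_scl] RB2(1,2)[THEN op_scl] ops[THEN op_scl] scl_lp(1)[OF p]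
  define b' where "b' = \<zeta> \<circ> T' \<circ> T \<circ> U"
  have b': "b' \<in> ops p p" unfolding b'_def by (intro cmp T' ops \<zeta>)
  \<comment> \<open>The similarity turns the diagonal corners into \<open>a'\<close> and
    \<open>d'\<close> and leaves the lower left corner \<open>c\<close> unchanged.\<close>
  have VT': "V (T' x) = c x + d' (V x)" if x: "x \<in> lp p" for x
  proof -
    have x_eq: "x = \<zeta> x + T (U (V x))" by (simp add: \<zeta>_apply)
    have "V (T' x) = V (T x) - V (T (X (V x)))" using x by (simp add: T'_apply G_apply)
    moreover have "V (T x) = V (T (\<zeta> x)) + V (T (T (U (V x))))"
      using x by (subst x_eq) (simp del: add_diff_cancel)
    ultimately show ?thesis using x by (simp add: ad'_apply cX) (simp add: acd_apply)
  qed
  have zT': "\<zeta> (T' x) = a' x + b' (V x)" if x: "x \<in> lp p" for x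
  proof -
    have x_eq: "x = \<zeta> x + T (U (V x))" by (simp add: \<zeta>_apply)
    have "\<zeta> (T' x) = \<zeta> (T' (\<zeta> x)) + \<zeta> (T' (T (U (V x))))"
      using x by (subst x_eq) (simp del: add_diff_cancel)
    moreover have "\<zeta> (T' (\<zeta> x)) = a' x"
    proof -
      have "T' (\<zeta> x) = T (\<zeta> x) + X (V (T (\<zeta> x)))" using x by (simp add: T'_apply G_apply)
      then show ?thesis using x by (simp add: ad'_apply) (simp add: acd_apply)
    qed
    ultimately show ?thesis by (simp add: b'_def)
  qed
  obtain r1 where r1: "0 \<le> r1" "opb p p r1 R1" using RB1(1) by (rule opsE)
  obtain r2 where r2: "0 \<le> r2" "opb p p r2 R2" using RB2(1) by (rule opsE)
  define \<mu> where "\<mu> = complex_of_real (r1 + r2 + 1)"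
  have \<mu>: "r1 + r2 < cmod \<mu>" "r2 + r1 < cmod \<mu>" using r1 r2 by (simp_all add: \<mu>_def del: of_real_add)
  obtain Z12 where Z12: "Z12 \<in> ops p p"
    and eq12: "\<And>x. x \<in> lp p \<Longrightarrow> scl \<mu> (Z12 x) + (- R1) (Z12 x) + Z12 (R2 x) = b' x"
    using rosenblum[OF p p opb_uminus[OF p r1(2)] r2(2) r1(1) r2(1) b' \<mu>(1)] by blast
  obtain Z21 where Z21: "Z21 \<in> ops p p"
    and eq21: "\<And>x. x \<in> lp p \<Longrightarrow> scl \<mu> (Z21 x) + R2 (Z21 x) + Z21 ((- R1) x) = (- c) x"
    using rosenblum[OF p p r2(2) opb_uminus[OF p r1(2)] r2(1) r1(1) ops_uminus[OF p acd(2)] \<mu>(2)] by blast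
  \<comment> \<open>The Rosenblum solutions act on the whole space. Composing with
    \<open>\<zeta>\<close> restricts them to the corners and keeps the equations, since
    \<open>R1\<close> begins and ends in the range of \<open>\<zeta>\<close>.\<close>
  define \<beta> where "\<beta> = \<zeta> \<circ> Z12"
  define \<gamma> where "\<gamma> = Z21 \<circ> \<zeta>"
  have \<beta>\<gamma>: "\<beta> \<in> ops p p" "\<gamma> \<in> ops p p" unfolding \<beta>_def \<gamma>_def by (intro cmp \<zeta> Z12 Z21)+
  note [simp] = op_in[OF Z12] op_in[OF Z21] \<beta>\<gamma>[THEN op_in] \<beta>\<gamma>[THEN op_add] \<beta>\<gamma>[THEN op_diff[OF p]] \<beta>\<gamma>[THEN op_scl] op_scl[OF \<zeta>]
  have [simp]: "\<zeta> (\<beta> x) = \<beta> x" "\<gamma> (\<zeta> x) = \<gamma> x" "V (\<beta> x) = 0" if "x \<in> lp p" for x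
    using that by (simp_all add: \<beta>_def \<gamma>_def)
  have \<beta>: "scl \<mu> (\<beta> x) + \<beta> (R2 x) - R1 (\<beta> x) = b' x" if x: "x \<in> lp p" for x
  proof -
    have "\<zeta> (scl \<mu> (Z12 x) - R1 (Z12 x) + Z12 (R2 x)) = \<zeta> (b' x)" using eq12[OF x] by simp
    moreover have "\<zeta> (b' x) = b' x" using x by (simp add: b'_def)
    ultimately show ?thesis using x by (simp add: \<beta>_def algebra_simps)
  qed
  have \<gamma>: "scl \<mu> (\<gamma> x) + R2 (\<gamma> x) - \<gamma> (R1 x) = - c x" if x: "x \<in> lp p" for x
    using eq21[of "\<zeta> x"] x op_uminus[OF Z21] by (simp add: \<gamma>_def)
  have [simp]: "V (R1 x) = 0" "V (B1 x) = 0" if "x \<in> lp p" for x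
    using that by (metis \<open>\<And>x. x \<in> lp p \<Longrightarrow> V (\<zeta> x) = 0\<close> z1(2,4) op_in[OF RB1(1)] op_in[OF RB1(2)])+
  define W where "W = T \<circ> U"
  have W: "W \<in> ops p p" unfolding W_def by (intro cmp ops)
  have [simp]: "V (W x) = x" "\<zeta> (W x) = 0" if "x \<in> lp p" for x using that by (simp_all add: W_def)
  note [simp] = op_in[OF W] op_add[OF W] op_diff[OF p W] op_zero[OF W]
  have R1W[simp]: "R1 (W x) = 0" "B1 (W x) = 0" "\<gamma> (W x) = 0" if "x \<in> lp p" for x
    using z1(1)[of "W x"] z1(3)[of "W x"] that op_zero[OF RB1(1)] op_zero[OF RB1(2)] op_zero[OF \<beta>\<gamma>(2)]
      \<open>\<And>x. x \<in> lp p \<Longrightarrow> \<gamma> (\<zeta> x) = \<gamma> x\<close>[of "W x"] by simp_all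
  \<comment> \<open>In block form \<open>A\<close> is diagonal with entries \<open>R1\<close> and
    \<mu> + \<open>R2\<close>, while \<open>B\<close> has diagonal \<open>B1\<close>,
    \<open>B2\<close> and off-diagonal corners \<open>\<beta>\<close>, \<open>\<gamma>\<close>. The
    four corners of \<open>B A - A B\<close> are those of \<open>T'\<close>.\<close>
  define A where "A = R1 + (W \<circ> (sop \<mu> id + R2) \<circ> V)"
  define B where "B = B1 + (W \<circ> B2 \<circ> V) + (\<beta> \<circ> V) + (W \<circ> \<gamma>)"
  have AB: "A \<in> ops p p" "B \<in> ops p p"
    unfolding A_def B_def by (intro ops_add cmp ops_sop ops_id W ops RB1 RB2 \<beta>\<gamma> p)+
  have AB_apply: "A x = R1 x + W (scl \<mu> (V x) + R2 (V x))" "B x = B1 x + W (B2 (V x)) + \<beta> (V x) + W (\<gamma> x)" for x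
    by (simp_all add: A_def B_def)
  have "T' x = B (A x) - A (B x)" if x: "x \<in> lp p" for x
  proof -
    have VA: "V (A x) = scl \<mu> (V x) + R2 (V x)" using x by (simp add: AB_apply)
    have VB: "V (B x) = B2 (V x) + \<gamma> x" using x by (simp add: AB_apply)
    have BA: "B (A x) = B1 (R1 x) + W (B2 (scl \<mu> (V x) + R2 (V x))) + \<beta> (scl \<mu> (V x) + R2 (V x)) + W (\<gamma> (R1 x))"
      unfolding AB_apply(2)[of "A x"] VA using x by (simp add: AB_apply)
    have ABx: "A (B x) = R1 (B1 x) + R1 (\<beta> (V x)) + W (scl \<mu> (B2 (V x) + \<gamma> x) + R2 (B2 (V x) + \<gamma> x))"
      unfolding AB_apply(1)[of "B x"] VB using x by (simp add: AB_apply)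
    have "B (A x) - A (B x) = (B1 (R1 x) - R1 (B1 x)) + (scl \<mu> (\<beta> (V x)) + \<beta> (R2 (V x)) - R1 (\<beta> (V x)))
       + W ((B2 (R2 (V x)) - R2 (B2 (V x))) - (scl \<mu> (\<gamma> x) + R2 (\<gamma> x) - \<gamma> (R1 x)))"
      unfolding BA ABx using x by (simp add: scl_arith algebra_simps)
    also have "\<dots> = a' x + b' (V x) + W (d' (V x) - (- c x))"
      using x by (simp add: \<beta> \<gamma> RB1(3) RB2(3))
    also have "\<dots> = \<zeta> (T' x) + W (V (T' x))"
      using x by (simp add: zT' VT' add.commute)
    also have "\<dots> = T' x" by (simp add: \<zeta>_apply W_def)
    finally show ?thesis by simp
  qed
  then have "is_commutator_on (ell p) T'" by (intro commutatorI[OF AB(2,1)])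
  then show ?thesis
    unfolding T'_def by (rule commutator_similar[OF p G ops(1), rotated -1]) (simp_all add: G_apply)
qed

section \<open>Compact operators\<close>

text \<open>Compactness is total boundedness of the image of the unit ball. Finite nets can be
  added, mapped by operators and transferred to nearby operators directly.\<close>

definition cpt :: "real \<Rightarrow> real \<Rightarrow> (vec \<Rightarrow> vec) \<Rightarrow> bool" where
  "cpt p q T \<longleftrightarrow> T \<in> ops p q \<and> (\<forall>\<epsilon>>0. \<exists>F. finite F \<and> F \<subseteq> lp q \<and>
     (\<forall>x\<in>lp p. lpn p x \<le> 1 \<longrightarrow> (\<exists>y\<in>F. lpn q (T x - y) \<le> \<epsilon>)))"

lemma cpt_ops: "cpt p q T \<Longrightarrow> T \<in> ops p q"
  by (simp add: cpt_def)

lemma cptE: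
  assumes "cpt p q T" "0 < \<epsilon>"
  obtains F where "finite F" "F \<subseteq> lp q" "\<And>x. x \<in> lp p \<Longrightarrow> lpn p x \<le> 1 \<Longrightarrow> \<exists>y\<in>F. lpn q (T x - y) \<le> \<epsilon>"
  using assms unfolding cpt_def by metis

lemma cptI:
  assumes "T \<in> ops p q" "\<And>\<epsilon>. 0 < \<epsilon> \<Longrightarrow> \<exists>F. finite F \<and> F \<subseteq> lp q \<and>
     (\<forall>x\<in>lp p. lpn p x \<le> 1 \<longrightarrow> (\<exists>y\<in>F. lpn q (T x - y) \<le> \<epsilon>))"
  shows "cpt p q T"
  using assms by (simp add: cpt_def)

lemma opb_cong:
  assumes "1 \<le> p" "opb p q K T" "\<And>x. x \<in> lp p \<Longrightarrow> S x = T x" shows "opb p q K S"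
  using assms(2,3) by (auto simp: opb_def add_lp(1)[OF assms(1)] scl_lp(1)[OF assms(1)])

lemma ops_cong:
  assumes "1 \<le> p" "T \<in> ops p q" "\<And>x. x \<in> lp p \<Longrightarrow> S x = T x" shows "S \<in> ops p q"
  using assms(2) by (rule opsE) (rule opb_ops[OF opb_cong[OF assms(1) _ assms(3)]])

lemma cpt_cong:
  assumes "1 \<le> p" "cpt p q T" "\<And>x. x \<in> lp p \<Longrightarrow> S x = T x" shows "cpt p q S"
  using ops_cong[OF assms(1) cpt_ops[OF assms(2)] assms(3)] assms(2,3) by (simp add: cpt_def)

lemma cpt_zero: "cpt p q 0"
  by (rule cptI[OF ops_zero]) (auto intro!: exI[of _ "{0}"])

lemma cpt_add:
  assumes "1 \<le> q" "cpt p q T" "cpt p q S" shows "cpt p q (T + S)"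
proof (rule cptI)
  show "T + S \<in> ops p q" using assms by (intro ops_add cpt_ops)
  fix \<epsilon> :: real assume "0 < \<epsilon>"
  then have e: "0 < \<epsilon> / 2" by simp
  obtain F where F: "finite F" "F \<subseteq> lp q" "\<And>x. x \<in> lp p \<Longrightarrow> lpn p x \<le> 1 \<Longrightarrow> \<exists>y\<in>F. lpn q (T x - y) \<le> \<epsilon> / 2"
    using cptE[OF assms(2) e] by metis
  obtain F' where F': "finite F'" "F' \<subseteq> lp q" "\<And>x. x \<in> lp p \<Longrightarrow> lpn p x \<le> 1 \<Longrightarrow> \<exists>y\<in>F'. lpn q (S x - y) \<le> \<epsilon> / 2"
    using cptE[OF assms(3) e] by metis
  have "\<exists>y\<in>(\<lambda>(y, z). y + z) ` (F \<times> F'). lpn q ((T + S) x - y) \<le> \<epsilon>" if x: "x \<in> lp p" "lpn p x \<le> 1" for x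
  proof -
    obtain y z where yz: "y \<in> F" "lpn q (T x - y) \<le> \<epsilon> / 2" "z \<in> F'" "lpn q (S x - z) \<le> \<epsilon> / 2"
      using F(3)[OF x] F'(3)[OF x] by blast
    have in_q: "T x - y \<in> lp q" "S x - z \<in> lp q"
      using yz F(2) F'(2) x op_in[OF cpt_ops[OF assms(2)]] op_in[OF cpt_ops[OF assms(3)]] diff_lp(1)[OF assms(1)] by blast+
    have eq: "(T + S) x - (y + z) = (T x - y) + (S x - z)" by simp
    have "lpn q ((T + S) x - (y + z)) \<le> \<epsilon>"
      unfolding eq using add_lp(2)[OF assms(1) in_q] yz(2,4) by linarith
    then show ?thesis using yz by force
  qed
  moreover have "(\<lambda>(y, z). y + z) ` (F \<times> F') \<subseteq> lp q" using F(2) F'(2) add_lp(1)[OF assms(1)] by auto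
  ultimately show "\<exists>F. finite F \<and> F \<subseteq> lp q \<and> (\<forall>x\<in>lp p. lpn p x \<le> 1 \<longrightarrow> (\<exists>y\<in>F. lpn q ((T + S) x - y) \<le> \<epsilon>))"
    using F(1) F'(1) by (intro exI[of _ "(\<lambda>(y, z). y + z) ` (F \<times> F')"]) auto
qed

lemma cpt_comp_left:
  assumes "1 \<le> q" "1 \<le> r" "cpt p q T" "S \<in> ops q r" shows "cpt p r (S \<circ> T)"
proof (rule cptI)
  show "S \<circ> T \<in> ops p r" using assms by (intro ops_comp[OF cpt_ops])
  fix \<epsilon> :: real assume e: "0 < \<epsilon>"
  obtain M where M: "0 \<le> M" "opb q r M S" using assms(4) by (rule opsE)
  have e': "0 < \<epsilon> / (M + 1)" using e M by simp
  obtain F where F: "finite F" "F \<subseteq> lp q" "\<And>x. x \<in> lp p \<Longrightarrow> lpn p x \<le> 1 \<Longrightarrow> \<exists>y\<in>F. lpn q (T x - y) \<le> \<epsilon> / (M + 1)"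
    using cptE[OF assms(3) e'] by metis
  have "\<exists>y\<in>S ` F. lpn r ((S \<circ> T) x - y) \<le> \<epsilon>" if x: "x \<in> lp p" "lpn p x \<le> 1" for x
  proof -
    obtain y where y: "y \<in> F" "lpn q (T x - y) \<le> \<epsilon> / (M + 1)" using F(3)[OF x] by blast
    have Tx: "T x \<in> lp q" "y \<in> lp q" using op_in[OF cpt_ops[OF assms(3)] x(1)] y F(2) by auto
    have "lpn r (S (T x) - S y) \<le> M * lpn q (T x - y)"
      using opb_le[OF M(2) diff_lp(1)[OF assms(1) Tx]] op_diff[OF assms(1,4) Tx] by simp
    also have "\<dots> \<le> (M + 1) * (\<epsilon> / (M + 1))" using y M by (intro mult_mono) auto
    finally have "lpn r (S (T x) - S y) \<le> \<epsilon>" using M by simp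
    then show ?thesis using y by auto
  qed
  then show "\<exists>F. finite F \<and> F \<subseteq> lp r \<and> (\<forall>x\<in>lp p. lpn p x \<le> 1 \<longrightarrow> (\<exists>y\<in>F. lpn r ((S \<circ> T) x - y) \<le> \<epsilon>))"
    using F(1,2) op_in[OF assms(4)] by (intro exI[of _ "S ` F"]) auto
qed

lemma cpt_sop: "1 \<le> q \<Longrightarrow> cpt p q T \<Longrightarrow> cpt p q (sop c T)"
  using cpt_comp_left[of q q p T "sop c id"] ops_sop[OF _ ops_id, of q c] by (simp add: o_def sop_def)

lemma cpt_uminus:
  assumes "1 \<le> q" "cpt p q T" shows "cpt p q (- T)"
proof -
  have "sop (-1) T = - T" by (intro ext) (simp add: sop_def)
  then show ?thesis using cpt_sop[OF assms, of "-1"] by simp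
qed

lemma cpt_diff: "1 \<le> q \<Longrightarrow> cpt p q T \<Longrightarrow> cpt p q S \<Longrightarrow> cpt p q (T - S)"
  using cpt_add[of q p T "- S"] cpt_uminus by simp

lemma cpt_comp_right:
  assumes "1 \<le> p" "1 \<le> q" "1 \<le> r" "cpt q r T" "S \<in> ops p q" shows "cpt p r (T \<circ> S)"
proof (rule cptI)
  show "T \<circ> S \<in> ops p r" using assms by (intro ops_comp[OF assms(5)] cpt_ops)
  fix \<epsilon> :: real assume e: "0 < \<epsilon>"
  obtain M where M: "0 \<le> M" "opb p q M S" using assms(5) by (rule opsE)
  define c where "c = complex_of_real (M + 1)"
  have c: "c \<noteq> 0" "cmod c = M + 1" using M by (auto simp: c_def simp del: of_real_add)
  have e': "0 < \<epsilon> / (M + 1)" using e M by simp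
  obtain F where F: "finite F" "F \<subseteq> lp r" "\<And>x. x \<in> lp q \<Longrightarrow> lpn q x \<le> 1 \<Longrightarrow> \<exists>y\<in>F. lpn r (T x - y) \<le> \<epsilon> / (M + 1)"
    using cptE[OF assms(4) e'] by metis
  have "\<exists>y\<in>scl c ` F. lpn r ((T \<circ> S) x - y) \<le> \<epsilon>" if x: "x \<in> lp p" "lpn p x \<le> 1" for x
  proof -
    have Sx: "S x \<in> lp q" using op_in[OF assms(5) x(1)] .
    have "lpn q (S x) \<le> M + 1" using opb_le[OF M(2) x(1)] mult_left_mono[OF x(2) M(1)] by simp
    then have "lpn q (scl (1 / c) (S x)) \<le> 1"
      using scl_lp(2)[OF assms(2) Sx, of "1/c"] c M by (simp add: norm_divide)
    then obtain y where y: "y \<in> F" "lpn r (T (scl (1 / c) (S x)) - y) \<le> \<epsilon> / (M + 1)"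
      using F(3)[OF scl_lp(1)[OF assms(2) Sx]] by blast
    have TS: "T (S x) \<in> lp r" "y \<in> lp r" using op_in[OF cpt_ops[OF assms(4)] Sx] y F(2) by auto
    have "T (scl (1 / c) (S x)) = scl (1 / c) (T (S x))" using op_scl[OF cpt_ops[OF assms(4)] Sx] .
    then have "T (S x) - scl c y = scl c (T (scl (1 / c) (S x)) - y)" using c by (simp add: scl_arith)
    moreover have "T (scl (1 / c) (S x)) - y \<in> lp r"
      using op_in[OF cpt_ops[OF assms(4)] scl_lp(1)[OF assms(2) Sx]] TS(2) diff_lp(1)[OF assms(3)] by blast
    ultimately have "lpn r (T (S x) - scl c y) = (M + 1) * lpn r (T (scl (1 / c) (S x)) - y)"
      using scl_lp(2)[OF assms(3)] c by metis
    also have "\<dots> \<le> (M + 1) * (\<epsilon> / (M + 1))" using y M by (intro mult_left_mono) auto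
    finally have "lpn r (T (S x) - scl c y) \<le> \<epsilon>" using M by simp
    then show ?thesis using y by auto
  qed
  then show "\<exists>F. finite F \<and> F \<subseteq> lp r \<and> (\<forall>x\<in>lp p. lpn p x \<le> 1 \<longrightarrow> (\<exists>y\<in>F. lpn r ((T \<circ> S) x - y) \<le> \<epsilon>))"
    using F(1,2) scl_lp(1)[OF assms(3)] by (intro exI[of _ "scl c ` F"]) auto
qed

text \<open>A net of mesh \<epsilon>/2 for a compact operator within \<epsilon>/2 of
  \<open>T\<close> is a net of mesh \<epsilon> for \<open>T\<close>.\<close>

lemma cpt_closed:
  assumes "1 \<le> p" "1 \<le> q" "T \<in> ops p q" "\<And>\<epsilon>. 0 < \<epsilon> \<Longrightarrow> \<exists>K. cpt p q K \<and> opb p q \<epsilon> (T - K)"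
  shows "cpt p q T"
proof (rule cptI[OF assms(3)])
  fix \<epsilon> :: real assume "0 < \<epsilon>"
  then have e: "0 < \<epsilon> / 2" by simp
  obtain K where K: "cpt p q K" "opb p q (\<epsilon> / 2) (T - K)" using assms(4)[OF e] by blast
  obtain F where F: "finite F" "F \<subseteq> lp q" "\<And>x. x \<in> lp p \<Longrightarrow> lpn p x \<le> 1 \<Longrightarrow> \<exists>y\<in>F. lpn q (K x - y) \<le> \<epsilon> / 2"
    using cptE[OF K(1) e] by metis
  have "\<exists>y\<in>F. lpn q (T x - y) \<le> \<epsilon>" if x: "x \<in> lp p" "lpn p x \<le> 1" for x
  proof -
    obtain y where y: "y \<in> F" "lpn q (K x - y) \<le> \<epsilon> / 2" using F(3)[OF x] by blast
    have i: "T x - K x \<in> lp q" "K x - y \<in> lp q"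
      using opb_in[OF K(2) x(1)] op_in[OF cpt_ops[OF K(1)] x(1)] y F(2) diff_lp(1)[OF assms(2)] by auto
    have "lpn q (T x - K x) \<le> \<epsilon> / 2"
      using order_trans[OF opb_le[OF K(2) x(1)] mult_left_mono[OF x(2), of "\<epsilon> / 2"]] e by simp
    then have "lpn q (T x - y) \<le> \<epsilon>" using add_lp(2)[OF assms(2) i] y(2) by simp
    then show ?thesis using y by blast
  qed
  then show "\<exists>F. finite F \<and> F \<subseteq> lp q \<and> (\<forall>x\<in>lp p. lpn p x \<le> 1 \<longrightarrow> (\<exists>y\<in>F. lpn q (T x - y) \<le> \<epsilon>))"
    using F(1,2) by blast
qed

text \<open>Infinitely many of the images lie near the same point of a finite net.\<close>

lemma cpt_pigeonhole:
  fixes x :: "nat \<Rightarrow> vec"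
  assumes "1 \<le> q" "cpt p q T" "infinite I" "\<And>i. i \<in> I \<Longrightarrow> x i \<in> lp p \<and> lpn p (x i) \<le> 1" "0 < \<epsilon>"
  obtains i j where "i \<in> I" "j \<in> I" "i < j" "lpn q (T (x i) - T (x j)) \<le> \<epsilon>"
proof -
  have e: "0 < \<epsilon> / 2" using assms by simp
  obtain F where F: "finite F" "F \<subseteq> lp q" "\<And>x. x \<in> lp p \<Longrightarrow> lpn p x \<le> 1 \<Longrightarrow> \<exists>y\<in>F. lpn q (T x - y) \<le> \<epsilon> / 2"
    using cptE[OF assms(2) e] by metis
  have "\<exists>y\<in>F. lpn q (T (x i) - y) \<le> \<epsilon> / 2" if "i \<in> I" for i using F(3) assms(4)[OF that] by blast
  then obtain f where f: "\<And>i. i \<in> I \<Longrightarrow> f i \<in> F \<and> lpn q (T (x i) - f i) \<le> \<epsilon> / 2" by metis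
  then have "finite (f ` I)" using F(1) by (meson finite_subset image_subsetI)
  then obtain a where a: "a \<in> I" "infinite {i \<in> I. f i = f a}"
    using pigeonhole_infinite[OF assms(3)] by blast
  obtain i where i: "i \<in> I" "f i = f a" using a by blast
  obtain j where j: "j > i" "j \<in> I" "f j = f a"
    using a(2) unfolding infinite_nat_iff_unbounded by blast
  have T: "T (x k) \<in> lp q" if "k \<in> I" for k using op_in[OF cpt_ops[OF assms(2)]] assms(4)[OF that] by blast
  have fa: "f a \<in> lp q" using f[OF a(1)] F(2) by blast
  have d: "T (x i) - f a \<in> lp q" "T (x j) - f a \<in> lp q" using T i(1) j(2) fa diff_lp(1)[OF assms(1)] by auto
  have "lpn q (T (x i) - T (x j)) \<le> \<epsilon>"
    using diff_lp(2)[OF assms(1) d] f[OF i(1)] f[OF j(2)] i(2) j(3) by simp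
  then show ?thesis using that i(1) j(1,2) by blast
qed

lemma id_not_cpt: assumes "1 \<le> p" shows "\<not> cpt p p id"
proof
  assume "cpt p p id"
  then obtain i j where ij: "i < j" "lpn p (id (unit i) - id (unit j)) \<le> 1 / 2"
    using cpt_pigeonhole[OF assms, of p id UNIV unit "1/2"] assms by auto
  have "cmod ((unit i - unit j) i) \<le> lpn p (unit i - unit j)"
    by (intro coord_le_lpn[OF assms] diff_lp assms unit_lp)
  then show False using ij by simp
qed

section \<open>Wielandt's argument modulo the compact operators\<close>

lemma ops_funpow: "B \<in> ops p p \<Longrightarrow> B ^^ n \<in> ops p p"
  by (induction n) (auto intro: ops_id ops_comp[where q=p] simp: id_def[symmetric] simp del: o_apply)

text \<open>Modulo the compact operators, [A, B^(n+1)] = (n+1) \<mu> B^n. For large n this expresses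
  B^n through itself with a factor below 1/2, so B^n is a norm limit of compact operators.
  Descending in the exponent makes the identity compact, which is absurd.\<close>

lemma commutator_scalar_mod_cpt:
  assumes p: "1 \<le> p" and AB: "A \<in> ops p p" "B \<in> ops p p" and K0: "cpt p p K0"
    and eq: "\<And>x. x \<in> lp p \<Longrightarrow> A (B x) - B (A x) = scl \<mu> x + K0 x"
  shows "\<mu> = 0"
proof (rule ccontr)
  assume \<mu>: "\<mu> \<noteq> 0"
  note cmp = ops_comp[where p=p and q=p and r=p]
  define S where "S n = B ^^ n" for n
  have S: "S n \<in> ops p p" for n unfolding S_def by (rule ops_funpow[OF AB(2)])
  have S_Suc: "S (Suc n) x = B (S n x)" "S (Suc n) x = S n (B x)" for n x
    by (simp_all add: S_def funpow_swap1)
  note [simp] = AB[THEN op_in] op_in[OF S] op_in[OF cpt_ops[OF K0]] scl_lp(1)[OF p] add_lp(1)[OF p] diff_lp(1)[OF p]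
    AB[THEN op_add] AB[THEN op_diff[OF p]] op_add[OF S] op_diff[OF p S] op_scl[OF S]
  \<comment> \<open>The error in Wielandt's identity. Peeling off one factor \<open>B\<close> on the
    right shows by induction that it is compact.\<close>
  define C where "C n = (A \<circ> S (Suc n)) - (S (Suc n) \<circ> A) - sop (of_nat (Suc n) * \<mu>) (S n)" for n
  have C: "cpt p p (C n)" for n
  proof (induction n)
    case 0
    show ?case by (rule cpt_cong[OF p K0]) (use eq in \<open>simp add: C_def S_def\<close>)
  next
    case (Suc n)
    show ?case
    proof (rule cpt_cong[OF p cpt_add[OF p cpt_comp_right[OF p p p Suc AB(2)] cpt_comp_left[OF p p K0 S[of "Suc n"]]]])
      fix x assume x: "x \<in> lp p"
      have 1: "A (S (Suc n) (B x)) = C n (B x) + S (Suc n) (A (B x)) + scl (of_nat (Suc n) * \<mu>) (S n (B x))"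
        by (simp add: C_def)
      have "A (B x) = B (A x) + (scl \<mu> x + K0 x)" using eq[OF x] by (simp add: algebra_simps)
      then have 2: "S (Suc n) (A (B x)) = S (Suc n) (B (A x)) + (scl \<mu> (S (Suc n) x) + S (Suc n) (K0 x))" using x by simp
      show "C (Suc n) x = ((C n \<circ> B) + (S (Suc n) \<circ> K0)) x"
        unfolding C_def[of "Suc n"] using 1 2 scl_arith(5)[of \<mu> \<mu> "S n (B x)"]
        by (simp add: S_Suc(2)[of "Suc n"] S_Suc(2)[of n] scl_arith distrib_right)
    qed
  qed
  obtain a where a: "0 \<le> a" "opb p p a A" using AB(1) by (rule opsE)
  obtain b where b: "0 \<le> b" "opb p p b B" using AB(2) by (rule opsE)
  \<comment> \<open>In the factor 4, one 2 stands for the two products \<open>A B E\<close> and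
    \<open>E B A\<close>, the other for the halving.\<close>
  obtain n where n: "4 * a * b / cmod \<mu> < real n" using reals_Archimedean2 by blast
  define \<nu> where "\<nu> = of_nat (Suc n) * \<mu>"
  have \<nu>: "\<nu> \<noteq> 0" "4 * a * b \<le> cmod \<nu>"
  proof -
    show "\<nu> \<noteq> 0" using \<mu> unfolding \<nu>_def by (simp del: of_nat_Suc)
    have "4 * a * b \<le> real n * cmod \<mu>" using n \<mu> by (simp add: field_simps)
    also have "\<dots> \<le> cmod \<nu>" unfolding \<nu>_def norm_mult norm_of_nat by (intro mult_right_mono) auto
    finally show "4 * a * b \<le> cmod \<nu>" .
  qed
  obtain s where s: "0 \<le> s" "opb p p s (S n)" using S by (rule opsE)
  have near: "\<exists>K. cpt p p K \<and> opb p p (s / 2 ^ k) (S n - K)" for k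
  proof (induction k)
    case 0
    show ?case using s(2) cpt_zero[of p p] by (metis diff_zero div_by_1 power_0)
  next
    case (Suc k)
    then obtain K where K: "cpt p p K" "opb p p (s / 2 ^ k) (S n - K)" by blast
    let ?E = "S n - K" and ?r = "s / 2 ^ k"
    have r: "0 \<le> ?r" using s by simp
    \<comment> \<open>Wielandt's identity solved for B^n, with \<open>K\<close> in place of B^n on
      the right. The error \<open>?E\<close> of \<open>K\<close> becomes (A B ?E - ?E B A) / \<nu>,
      which has half the bound.\<close>
    define K' where "K' = sop (1 / \<nu>) ((A \<circ> B \<circ> K) - (K \<circ> (B \<circ> A)) - C n)"
    have K': "cpt p p K'" unfolding K'_def
      by (intro cpt_sop cpt_diff cpt_comp_left[OF p p K(1)] cpt_comp_right[OF p p p K(1)] C p cmp AB)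
    note [simp] = op_in[OF cpt_ops[OF K(1)]] op_add[OF cpt_ops[OF K(1)]]
    have "opb p p (cmod (1 / \<nu>) * ((a * b) * ?r + ?r * (b * a))) (sop (1 / \<nu>) ((A \<circ> B \<circ> ?E) - (?E \<circ> (B \<circ> A))))"
      by (intro opb_sop opb_diff p opb_comp[OF K(2) opb_comp[OF b(2) a(2)]]
          opb_comp[OF opb_comp[OF a(2) b(2)] K(2)] mult_nonneg_nonneg a b r)
    moreover have "cmod (1 / \<nu>) * ((a * b) * ?r + ?r * (b * a)) \<le> s / 2 ^ Suc k"
    proof -
      have "(4 * a * b) * ?r \<le> cmod \<nu> * ?r" using \<nu>(2) r by (rule mult_right_mono)
      then show ?thesis using \<nu>(1) by (simp add: norm_divide divide_simps mult_ac)
    qed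
    ultimately have E': "opb p p (s / 2 ^ Suc k) (sop (1 / \<nu>) ((A \<circ> B \<circ> ?E) - (?E \<circ> (B \<circ> A))))"
      by (rule opb_mono)
    have "(S n - K') x = sop (1 / \<nu>) ((A \<circ> B \<circ> ?E) - (?E \<circ> (B \<circ> A))) x" if x: "x \<in> lp p" for x
    proof -
      have "scl \<nu> (S n x) = A (B (S n x)) - S n (B (A x)) - C n x"
        by (simp add: C_def \<nu>_def S_Suc(1)[of n x] S_Suc(2)[of n "A x"])
      then have Sx: "S n x = scl (1 / \<nu>) (A (B (S n x)) - S n (B (A x)) - C n x)" using \<nu>(1)
        by (metis (no_types, lifting) divide_inverse mult.left_neutral left_inverse scl_simps(2,4))
      have "(S n - K') x = scl (1 / \<nu>) (A (B (S n x)) - S n (B (A x)) - C n x)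
          - scl (1 / \<nu>) (A (B (K x)) - K (B (A x)) - C n x)"
        by (subst Sx[symmetric]) (simp add: K'_def)
      then show ?thesis using x by (simp add: scl_arith(2)[symmetric] del: minus_apply) (simp add: algebra_simps)
    qed
    with E' have "opb p p (s / 2 ^ Suc k) (S n - K')" by (rule opb_cong[OF p])
    then show ?case using K' by blast
  qed
  have "cpt p p (S n)"
  proof (rule cpt_closed[OF p p S])
    fix \<epsilon> :: real assume "0 < \<epsilon>"
    then obtain k where k: "s / \<epsilon> < 2 ^ k" using real_arch_pow[of 2 "s / \<epsilon>"] by auto
    then have "s / 2 ^ k \<le> \<epsilon>" using \<open>0 < \<epsilon>\<close> by (simp add: field_simps)
    then show "\<exists>K. cpt p p K \<and> opb p p \<epsilon> (S n - K)" using near[of k] opb_mono by blast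
  qed
  \<comment> \<open>If B^(n+1) is compact, so is its commutator with \<open>A\<close>, which is a
    nonzero multiple of B^n plus a compact operator.\<close>
  then have "cpt p p (S 0)"
  proof (induction n)
    case (Suc n)
    have "cpt p p (sop (1 / (of_nat (Suc n) * \<mu>)) ((A \<circ> S (Suc n)) - (S (Suc n) \<circ> A) - C n))"
      by (intro cpt_sop cpt_diff cpt_comp_left[OF p p Suc.prems AB(1)] cpt_comp_right[OF p p p Suc.prems AB(1)] C p)
    then have "cpt p p (S n)"
      by (rule cpt_cong[OF p]) (use \<mu> in \<open>simp add: C_def del: of_nat_Suc\<close>)
    then show ?case by (rule Suc.IH)
  qed
  then show False using id_not_cpt[OF p] by (simp add: S_def id_def)
qed

section \<open>Compact operators are commutators\<close>

text \<open>
  With \<open>G = \<Sum> L\<^sup>n T R\<^sup>n\<close> for the block shift \<open>R\<close> and its adjoint \<open>L\<close>, the operator \<open>T\<close> differs from the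
  commutator \<open>R (L G) - (L G) R\<close> by the first block row of \<open>G\<close>, which is \<open>S - R S L\<close>
  for the sum \<open>S\<close> of the ampliations of the entries of that row, moved to their diagonals.
\<close>

lemma commutator_of_shift_decay:
  assumes p: "1 \<le> p" and T: "T \<in> ops p p" and r: "0 \<le> r" "r < 1" and c: "0 \<le> c"
    and decay: "\<And>n. opb p p (c * r ^ n) (T \<circ> (shift ^^ n))"
  shows "is_commutator_on (ell p) T"
proof -
  note cmp = ops_comp[where p=p and q=p and r=p]
  note [simp] = ops_block[OF p, THEN op_in] block_lin op_in[OF T] add_lp(1)[OF p] diff_lp(1)[OF p]
  have sh: "opb p p 1 (shift ^^ n)" for n
  proof (induction n)
    case (Suc n)
    show ?case using opb_comp[OF Suc opb_block(1)[OF p]] by (simp only: funpow.simps mult_1)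
  qed (simp add: opb_id[unfolded id_def] id_def)
  have la: "opb p p 1 (shift_adj ^^ n)" for n
  proof (induction n)
    case (Suc n)
    show ?case using opb_comp[OF Suc opb_block(2)[OF p]] by (simp only: funpow.simps mult_1)
  qed (simp add: opb_id[unfolded id_def] id_def)
  note [simp] = op_in[OF opb_ops[OF sh]] op_in[OF opb_ops[OF la]]
  define g where "g n x = (shift_adj ^^ n) (T ((shift ^^ n) x))" for n x
  have g: "opb p p (c * r ^ n) (g n)" for n
    using opb_comp[OF decay[of n] la[of n]] by (simp add: g_def[abs_def] o_def)
  have sr: "summable (\<lambda>n. c * r ^ n)" using r by (intro summable_mult summable_geometric) auto
  define G where "G x = vsum (\<lambda>n. g n x)" for x
  have G: "G \<in> ops p p" using opb_ops[OF opb_series[OF p p g sr]] unfolding G_def .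
  note [simp] = op_in[OF G]
  have gx: "g n x \<in> lp p" "lpn p (g n x) \<le> c * r ^ n * lpn p x" if "x \<in> lp p" for n x
    using g[of n] that by (auto simp: opb_def)
  have g_Suc: "g (Suc n) x = shift_adj (g n (shift x))" for n x
    by (simp add: g_def funpow_swap1)
  \<comment> \<open>Dropping the first term of the series and pulling out one
    \<open>shift_adj\<close> and one \<open>shift\<close> gives G = T + L G R.\<close>
  have G_step: "G x = T x + shift_adj (G (shift x))" if x: "x \<in> lp p" for x
  proof -
    have "G x = sum (\<lambda>n. g n x) {..<1} + vsum (\<lambda>n. g (n + 1) x)"
      unfolding G_def by (rule vsum_split[OF p gx[OF x] summable_mult2[OF sr]])
    also have "vsum (\<lambda>n. g (n + 1) x) = shift_adj (G (shift x))"
      unfolding G_def Suc_eq_plus1[symmetric] g_Suc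
      by (rule op_vsum[OF p p ops_block(2)[OF p] gx summable_mult2[OF sr], symmetric]) (use x in auto)
    finally show ?thesis by (auto simp: g_def fun_eq_iff)
  qed
  define c' where "c' = c / (1 - r)"
  have c': "0 \<le> c'" using c r by (simp add: c'_def)
  \<comment> \<open>The decay along powers of the shift passes from \<open>T\<close> to
    \<open>G\<close>; the geometric series costs the factor 1 / (1 - r).\<close>
  have Gs: "opb p p (c' * r ^ j) (G \<circ> (shift ^^ j))" for j
  proof -
    have "opb p p (c * r ^ (n + j)) (g n \<circ> (shift ^^ j))" for n
      using opb_comp[OF decay[of "n + j"] la[of n]] by (simp add: g_def[abs_def] o_def funpow_add)
    then have "opb p p (\<Sum>n. c * r ^ (n + j)) (\<lambda>x. vsum (\<lambda>n. (g n \<circ> (shift ^^ j)) x))"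
      by (rule opb_series[OF p p]) (use r in \<open>simp add: power_add mult.assoc[symmetric] summable_mult2 sr\<close>)
    moreover have "(\<Sum>n. c * r ^ (n + j)) = c' * r ^ j"
    proof -
      have "(\<Sum>n. c * r ^ (n + j)) = (\<Sum>n. (c * r ^ j) * r ^ n)" by (simp add: power_add mult_ac)
      also have "\<dots> = (c * r ^ j) * (1 / (1 - r))"
        using r suminf_geometric[of r] by (subst suminf_mult) (auto intro: summable_geometric)
      finally show ?thesis by (simp add: c'_def)
    qed
    ultimately show ?thesis by (simp add: G_def o_def)
  qed
  \<comment> \<open>The entry of \<open>G\<close> in row 0 and column \<open>j\<close> of its block
    matrix. In \<open>S\<close> it is repeated along the j-th superdiagonal.\<close>
  define H where "H j = proj0 \<circ> (G \<circ> (shift ^^ j)) \<circ> incl0" for j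
  have H: "opb p p (c' * r ^ j) (H j)" for j
    using opb_comp[OF opb_block(3)[OF p] opb_comp[OF Gs[of j] opb_block(4)[OF p]]] c' r
    by (simp add: H_def o_assoc)
  have aH: "opb p p (c' * r ^ j) (amp (H j) \<circ> (shift_adj ^^ j))" for j
    using opb_comp[OF la[of j] opb_amp[OF p H[of j]]] c' r by simp
  have sr': "summable (\<lambda>n. c' * r ^ n)" using r by (intro summable_mult summable_geometric) auto
  define S where "S x = vsum (\<lambda>j. (amp (H j) \<circ> (shift_adj ^^ j)) x)" for x
  have S: "S \<in> ops p p" using opb_ops[OF opb_series[OF p p aH sr']] unfolding S_def .
  note [simp] = op_in[OF S]
  have aHx: "(amp (H j) \<circ> (shift_adj ^^ j)) x \<in> lp p"
    "lpn p ((amp (H j) \<circ> (shift_adj ^^ j)) x) \<le> c' * r ^ j * lpn p x" if "x \<in> lp p" for j x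
    using aH[of j] that unfolding opb_def by blast+
  have S_eq: "S x - shift (S (shift_adj x)) = incl0 (proj0 (G x))" if x: "x \<in> lp p" for x
  proof
    fix k
    let ?y = "\<lambda>j. (shift_adj ^^ j) x"
    have Lx: "shift_adj x \<in> lp p" using x by simp
    have "shift (S (shift_adj x)) = vsum (\<lambda>j. shift ((amp (H j) \<circ> (shift_adj ^^ j)) (shift_adj x)))"
      unfolding S_def by (rule op_vsum[OF p p ops_block(1)[OF p] aHx summable_mult2[OF sr']]) (use Lx in auto)
    moreover have sum1: "summable (\<lambda>j. (amp (H j) \<circ> (shift_adj ^^ j)) x k)"
      by (rule vsum_coord[OF p aHx[OF x] summable_mult2[OF sr']])
    moreover have sum2: "summable (\<lambda>j. shift ((amp (H j) \<circ> (shift_adj ^^ j)) (shift_adj x)) k)"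
    proof (rule vsum_coord[OF p _ _ summable_mult2[OF sr', of "lpn p (shift_adj x)"]])
      fix j
      show "shift ((amp (H j) \<circ> (shift_adj ^^ j)) (shift_adj x)) \<in> lp p" using aHx(1)[OF Lx] by simp
      show "lpn p (shift ((amp (H j) \<circ> (shift_adj ^^ j)) (shift_adj x))) \<le> c' * r ^ j * lpn p (shift_adj x)"
        using opb_le[OF opb_block(1)[OF p] aHx(1)[OF Lx, of j]] aHx(2)[OF Lx, of j] by linarith
    qed
    ultimately have "(S x - shift (S (shift_adj x))) k =
        (\<Sum>j. (amp (H j) \<circ> (shift_adj ^^ j)) x k - shift ((amp (H j) \<circ> (shift_adj ^^ j)) (shift_adj x)) k)"
      using suminf_diff[OF sum1 sum2] by (simp add: S_def vsum_def)
    moreover have "(\<lambda>j. (amp (H j) \<circ> (shift_adj ^^ j)) x k - shift ((amp (H j) \<circ> (shift_adj ^^ j)) (shift_adj x)) k)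
        sums incl0 (proj0 (G x)) k"
    proof -
      have H0: "H j 0 = 0" for j using op_zero[OF opb_ops[OF H]] .
      \<comment> \<open>\<open>amp (H j)\<close> commutes with the shift, so the difference contains
        the factor 1 - R L and only row 0 survives.\<close>
      have term_eq: "(amp (H j) \<circ> (shift_adj ^^ j)) x - shift ((amp (H j) \<circ> (shift_adj ^^ j)) (shift_adj x))
          = incl0 (proj0 (G ((shift ^^ j) (incl0 (proj0 (?y j))))))" for j
      proof -
        have 1: "(shift_adj ^^ j) (shift_adj x) = shift_adj (?y j)" by (simp add: funpow_swap1)
        have "shift (amp (H j) (shift_adj (?y j))) = amp (H j) (shift (shift_adj (?y j)))"
          using amp_rels(1)[where G = "H j", OF H0] by simp
        also have "shift (shift_adj (?y j)) = ?y j - incl0 (proj0 (?y j))"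
          using block_decomp[of "?y j"] by (simp add: algebra_simps)
        also have "amp (H j) \<dots> = amp (H j) (?y j) - incl0 (H j (proj0 (?y j)))"
          using op_diff[OF p ops_amp[OF p opb_ops[OF H]]] x amp_rels(3)[where G = "H j", OF H0] by simp
        finally have 2: "shift (amp (H j) (shift_adj (?y j))) = amp (H j) (?y j) - incl0 (H j (proj0 (?y j)))" .
        have 3: "H j z = proj0 (G ((shift ^^ j) (incl0 z)))" for z by (simp only: H_def o_apply)
        show ?thesis unfolding o_apply 1 2 3 by simp
      qed
      \<comment> \<open>R^j (1 - R L) L^j = R^j L^j - R^(j+1) L^(j+1), so the sum telescopes. The
        remainder carries \<open>G\<close> composed with R^m and tends to 0 by the decay.\<close>
      have partial: "(\<Sum>j<m. incl0 (proj0 (G ((shift ^^ j) (incl0 (proj0 (?y j))))))) =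
          incl0 (proj0 (G x)) - incl0 (proj0 (G ((shift ^^ m) (?y m))))" for m
      proof (induction m)
        case 0
        show ?case by (simp only: lessThan_0 sum.empty funpow_0 diff_self)
      next
        case (Suc m)
        have "(shift ^^ Suc m) (?y (Suc m)) = (shift ^^ m) (shift (shift_adj (?y m)))"
          by (simp add: funpow_swap1)
        also have "shift (shift_adj (?y m)) = ?y m - incl0 (proj0 (?y m))"
          using block_decomp[of "?y m"] by (simp add: algebra_simps)
        also have "(shift ^^ m) \<dots> = (shift ^^ m) (?y m) - (shift ^^ m) (incl0 (proj0 (?y m)))"
          using op_diff[OF p opb_ops[OF sh]] x by simp
        finally have eqG: "G ((shift ^^ Suc m) (?y (Suc m))) = G ((shift ^^ m) (?y m)) - G ((shift ^^ m) (incl0 (proj0 (?y m))))"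
          using op_diff[OF p G] x by simp
        show ?case unfolding sum.lessThan_Suc Suc.IH eqG block_lin by (simp only: algebra_simps)
      qed
      have "(\<lambda>m. incl0 (proj0 (G ((shift ^^ m) (?y m)))) k) \<longlonglongrightarrow> 0"
      proof (rule Lim_null_comparison)
        show "\<forall>\<^sub>F m in sequentially. norm (incl0 (proj0 (G ((shift ^^ m) (?y m)))) k) \<le> (c' * lpn p x) * r ^ m"
        proof (intro always_eventually allI)
          fix m
          have y: "?y m \<in> lp p" "lpn p (?y m) \<le> lpn p x" using opb_in[OF la x] opb_le[OF la x] by auto
          have "opb p p (c' * r ^ m) (incl0 \<circ> (proj0 \<circ> (G \<circ> (shift ^^ m))))"
            using opb_comp[OF opb_comp[OF Gs[of m] opb_block(4)[OF p]] opb_block(3)[OF p]] by simp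
          from opb_in[OF this y(1)] opb_le[OF this y(1)]
          have z: "incl0 (proj0 (G ((shift ^^ m) (?y m)))) \<in> lp p"
            "lpn p (incl0 (proj0 (G ((shift ^^ m) (?y m))))) \<le> c' * r ^ m * lpn p (?y m)" by simp_all
          have "norm (incl0 (proj0 (G ((shift ^^ m) (?y m)))) k) \<le> c' * r ^ m * lpn p (?y m)"
            using coord_le_lpn[OF p z(1), of k] z(2) by linarith
          also have "\<dots> \<le> c' * r ^ m * lpn p x" using y(2) c' r by (intro mult_left_mono) auto
          finally show "norm (incl0 (proj0 (G ((shift ^^ m) (?y m)))) k) \<le> (c' * lpn p x) * r ^ m"
            by (simp add: mult_ac)
        qed
        show "(\<lambda>m. (c' * lpn p x) * r ^ m) \<longlonglongrightarrow> 0"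
          using r by (intro tendsto_mult_right_zero LIMSEQ_realpow_zero) auto
      qed
      then have "(\<lambda>m. incl0 (proj0 (G x)) k - incl0 (proj0 (G ((shift ^^ m) (?y m)))) k) \<longlonglongrightarrow> incl0 (proj0 (G x)) k - 0"
        by (intro tendsto_diff tendsto_const)
      moreover have "incl0 (proj0 (G x)) k - incl0 (proj0 (G ((shift ^^ m) (?y m)))) k =
          (\<Sum>j<m. (amp (H j) \<circ> (shift_adj ^^ j)) x k - shift ((amp (H j) \<circ> (shift_adj ^^ j)) (shift_adj x)) k)" for m
      proof -
        have "(amp (H j) \<circ> (shift_adj ^^ j)) x k - shift ((amp (H j) \<circ> (shift_adj ^^ j)) (shift_adj x)) k
            = incl0 (proj0 (G ((shift ^^ j) (incl0 (proj0 (?y j)))))) k" for j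
          using fun_cong[OF term_eq[of j], of k] by (simp only: minus_apply)
        then show ?thesis using fun_cong[OF partial[of m], of k] by (simp only: sum_fun_apply minus_apply)
      qed
      ultimately show ?thesis by (simp add: sums_def)
    qed
    ultimately show "(S x - shift (S (shift_adj x))) k = incl0 (proj0 (G x)) k"
      by (simp add: sums_iff)
  qed
  show ?thesis
  proof (rule commutatorI)
    \<comment> \<open>Commuting S L - L G with R gives (S - R S L) + (G - L G R) minus the first
      block row of \<open>G\<close>. The first bracket equals that row and the second equals
      \<open>T\<close>.\<close>
    show "(S \<circ> shift_adj) - (shift_adj \<circ> G) \<in> ops p p" "shift \<in> ops p p"
      by (intro ops_diff cmp S G ops_block p)+
    fix x assume x: "x \<in> lp p"
    have 1: "shift (shift_adj (G x)) = G x - incl0 (proj0 (G x))"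
      using block_decomp[of "G x"] by (simp add: algebra_simps)
    have "S (shift_adj (shift x)) - shift_adj (G (shift x)) - (shift (S (shift_adj x)) - shift (shift_adj (G x)))
        = (S x - shift (S (shift_adj x))) + (G x - shift_adj (G (shift x))) - incl0 (proj0 (G x))"
      unfolding 1 by simp
    also have "\<dots> = T x" using S_eq[OF x] G_step[OF x] by simp
    finally show "T x = ((S \<circ> shift_adj) - (shift_adj \<circ> G)) (shift x) - shift (((S \<circ> shift_adj) - (shift_adj \<circ> G)) x)"
      by simp
  qed
qed

section \<open>Making a compact operator small on the range of the block shift\<close>

lemma sidx_gt: "k < sidx k"
proof -
  obtain i j where k: "k = prod_encode (i, j)" by (metis prod_decode_inverse surj_pair)
  show ?thesis unfolding k sidx_encode by (simp add: prod_encode_def)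
qed

text \<open>Moving down rows raises the code, so \<open>n\<close> shifts push \<open>unit k\<close>
  to an index at least k + n. Smallness of far columns thereby becomes decay in
  \<open>n\<close>.\<close>

lemma sidx_funpow_ge: "k + n \<le> (sidx ^^ n) k"
  by (induction n) (use sidx_gt Suc_le_eq in \<open>fastforce simp: Suc_le_eq intro: le_less_trans\<close>)+

text \<open>Unit vectors alone do not suffice: on l_1 the rank one operator sending x to (\<Sum>k. x
  k) times \<open>unit 0\<close> keeps them all large. Differences of unit vectors with nearby
  images exist by compactness, and interlacing keeps all indices distinct.\<close>

lemma unit_diff_small:
  assumes p: "1 \<le> p" and T: "cpt p q T" and q: "1 \<le> q"
  obtains a b :: "nat \<Rightarrow> nat" where "strict_mono a" "\<And>m. a m < b m" "\<And>m. b m < a (Suc m)"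
    "\<And>m. lpn q (T (unit (a m) - unit (b m))) \<le> (1 / 2) ^ m"
proof -
  have ex: "\<exists>a b. N \<le> a \<and> a < b \<and> lpn q (T (unit a - unit b)) \<le> (1 / 2) ^ m" for N m
  proof -
    obtain i j where "i \<in> {N..}" "j \<in> {N..}" "i < j" "lpn q (T (unit i) - T (unit j)) \<le> (1 / 2) ^ m"
      using cpt_pigeonhole[OF q T, of "{N..}" unit "(1 / 2) ^ m"] p infinite_Ici by auto
    then show ?thesis using op_diff[OF p cpt_ops[OF T]] p by (intro exI[of _ i] exI[of _ j]) auto
  qed
  have "\<exists>f. \<forall>m. (fst (f m) < snd (f m) \<and> lpn q (T (unit (fst (f m)) - unit (snd (f m)))) \<le> (1 / 2) ^ m)
      \<and> snd (f m) < fst (f (Suc m))"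
  proof (rule dependent_nat_choice)
    show "\<exists>x. fst x < snd x \<and> lpn q (T (unit (fst x) - unit (snd x))) \<le> (1 / 2) ^ 0"
      using ex[of 0 0] by auto
    fix x :: "nat \<times> nat" and m :: nat
    show "\<exists>y. (fst y < snd y \<and> lpn q (T (unit (fst y) - unit (snd y))) \<le> (1 / 2) ^ Suc m) \<and> snd x < fst y"
      using ex[of "Suc (snd x)" "Suc m"] by (metis Suc_le_eq fst_conv snd_conv)
  qed
  then obtain f where f: "\<And>m. fst (f m) < snd (f m)" "\<And>m. snd (f m) < fst (f (Suc m))"
    "\<And>m. lpn q (T (unit (fst (f m)) - unit (snd (f m)))) \<le> (1 / 2) ^ m" by blast
  have "strict_mono (fst \<circ> f)" using f(1,2) by (auto simp: strict_mono_Suc_iff intro: less_trans)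
  with f show ?thesis using that[of "fst \<circ> f" "snd \<circ> f"] by simp
qed

text \<open>A similarity carries the range of the shift to the span of the chosen differences of
  unit vectors. The transformed operator has geometrically small columns there, as the decay
  criterion requires.\<close>

lemma cpt_commutator:
  assumes p: "1 \<le> p" and T: "cpt p p T"
  shows "is_commutator_on (ell p) T"
proof -
  note cmp = ops_comp[where p=p and q=p and r=p]
  note To = cpt_ops[OF T]
  obtain a b :: "nat \<Rightarrow> nat" where ab: "strict_mono a" "\<And>m. a m < b m" "\<And>m. b m < a (Suc m)"
    and small: "\<And>m. lpn p (T (unit (a m) - unit (b m))) \<le> (1 / 2) ^ m"
    using unit_diff_small[OF p T p] by blast
  have a_neq_b: "a m \<noteq> b n" for m n
  proof (cases "m \<le> n")
    case True
    then have "a m \<le> a n" using ab(1) by (simp add: strict_mono_less_eq)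
    then show ?thesis using ab(2)[of n] by simp
  next
    case False
    then have "a (Suc n) \<le> a m" using ab(1) by (simp add: strict_mono_less_eq)
    then show ?thesis using ab(3)[of n] by simp
  qed
  have inj_a: "inj a" using ab(1) by (rule strict_mono_imp_inj_on)
  have "strict_mono b" using ab(2,3) by (auto simp: strict_mono_Suc_iff intro: less_trans)
  then have inj_b: "inj b" by (rule strict_mono_imp_inj_on)
  \<comment> \<open>\<open>J\<close> sends \<open>unit (a m)\<close> to
    \<open>unit (a m) - unit (b m)\<close> and fixes the other unit vectors. Since \<open>a\<close>
    and \<open>b\<close> have disjoint ranges, the correction has square zero and \<open>J'\<close>
    is the inverse.\<close>
  define J where "J = id - (emb b \<circ> res a)"
  define J' where "J' = id + (emb b \<circ> res a)"
  have J: "J \<in> ops p p" "J' \<in> ops p p"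
    unfolding J_def J'_def by (intro ops_add ops_diff ops_id cmp ops_emb ops_res inj_a inj_b p)+
  have J_apply: "J x = x - emb b (res a x)" "J' x = x + emb b (res a x)" for x by (simp_all add: J_def J'_def)
  have res0: "res a (emb b x) = 0" for x
    by (rule ext) (use a_neq_b in \<open>auto simp: emb_def\<close>)
  have res_add: "res a (x + y) = res a x + res a y" "res a (x - y) = res a x - res a y" for x y
    by (rule ext; simp)+
  have JJ': "J (J' x) = x" "J' (J x) = x" for x
    by (simp_all add: J_apply res_add res0)
  have J_unit: "J (unit (a m)) = unit (a m) - unit (b m)" for m
  proof -
    have "res a (unit (a m)) = unit m" using inj_a by (auto simp: fun_eq_iff inj_eq)
    then show ?thesis by (simp add: J_apply emb_unit[OF inj_b])
  qed
  \<comment> \<open>Row 0 needs an infinite set of indices outside the range of \<open>a\<close>;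
    the range of \<open>b\<close> lies there.\<close>
  have "range b \<subseteq> - range a" using a_neq_b by (auto simp: image_iff) (metis)
  then have "infinite (- range a)" using inj_b by (meson finite_subset range_inj_infinite)
  then have h: "bij_betw (enumerate (- range a)) UNIV (- range a)" by (rule bij_enumerate)
  \<comment> \<open>A bijection of the indices that puts the range of \<open>a\<close> on the rows
    below row 0, in shifted order, and everything else on row 0.\<close>
  define \<beta> where "\<beta> k = (case prod_decode k of (0, j) \<Rightarrow> enumerate (- range a) j | (Suc i, j) \<Rightarrow> a (prod_encode (i, j)))" for k
  have \<beta>_0: "\<beta> (prod_encode (0, j)) = enumerate (- range a) j" and \<beta>_s: "\<beta> (sidx k) = a k" for j k
    by (simp_all add: \<beta>_def sidx_def)
  have cases_k: "(\<exists>j. k = prod_encode (0, j)) \<or> (\<exists>l. k = sidx l)" for k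
  proof -
    obtain i j where "k = prod_encode (i, j)" by (metis prod_decode_inverse surj_pair)
    then show ?thesis by (cases i) (auto simp flip: sidx_encode)
  qed
  have h_inj: "enumerate (- range a) i = enumerate (- range a) j \<longleftrightarrow> i = j" for i j
    using h by (auto simp: bij_betw_def inj_on_def)
  have h_in: "enumerate (- range a) j \<noteq> a k" for j k
    using bij_betwE[OF h] by auto
  have inj_\<beta>: "inj \<beta>"
  proof (rule injI)
    fix k l assume eq: "\<beta> k = \<beta> l"
    show "k = l"
      using cases_k[of k] cases_k[of l] eq h_in h_in[symmetric]
      by (auto simp: \<beta>_0 \<beta>_s h_inj inj_eq[OF inj_a])
  qed
  have range_\<beta>: "range \<beta> = UNIV"
  proof (intro equalityI subsetI)
    fix k :: nat
    show "k \<in> range \<beta>"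
    proof (cases "k \<in> range a")
      case True
      then show ?thesis by (metis \<beta>_s rangeE rangeI)
    next
      case False
      then have "k \<in> range (enumerate (- range a))" using h by (simp add: bij_betw_def)
      then obtain j where "k = enumerate (- range a) j" by blast
      then show ?thesis by (metis \<beta>_0 rangeI)
    qed
  qed auto
  define G where "G = res \<beta> \<circ> J'"
  define G' where "G' = J \<circ> emb \<beta>"
  have G: "G \<in> ops p p" "G' \<in> ops p p" unfolding G_def G'_def by (intro cmp ops_emb ops_res J inj_\<beta> p)+
  have GG': "G (G' x) = x" "G' (G x) = x" for x
    using emb_res[OF inj_\<beta>, of "J' x"] by (auto simp: G_def G'_def JJ' res_emb[OF inj_\<beta>] range_\<beta> cut_def)
  define T' where "T' = G \<circ> T \<circ> G'"
  have T': "T' \<in> ops p p" unfolding T'_def by (intro cmp G To)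
  obtain M where M: "0 \<le> M" "opb p p M G" using G(1) by (rule opsE)
  obtain C where C: "0 \<le> C" "opb p p C T'" using T' by (rule opsE)
  define v where "v k = T' (unit (sidx k))" for k
  have v_eq: "v k = G (T (unit (a k) - unit (b k)))" for k
    by (simp add: v_def T'_def G'_def emb_unit[OF inj_\<beta>] \<beta>_s J_unit)
  have ud: "unit (a k) - unit (b k) \<in> lp p" for k using p by (intro diff_lp) auto
  have v: "v k \<in> lp p" "lpn p (v k) \<le> M * (1 / 2) ^ k" for k
  proof -
    show "v k \<in> lp p" unfolding v_eq using op_in[OF G(1) op_in[OF To ud]] .
    show "lpn p (v k) \<le> M * (1 / 2) ^ k"
      unfolding v_eq using opb_le[OF M(2) op_in[OF To ud]] mult_left_mono[OF small[of k] M(1)] by (meson order_trans)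
  qed
  have shift_unit: "(shift ^^ n) (unit k) = unit ((sidx ^^ n) k)" for n k
    by (induction n) (simp_all add: shift_def emb_unit[OF inj_sidx] del: unit_apply)
  have decay_Suc: "opb p p (2 * M * (1 / 2) ^ n) (T' \<circ> (shift ^^ Suc n))" for n
  proof -
    define w where "w k = v ((sidx ^^ n) k)" for k
    have "lpn p (w k) \<le> M * (1 / 2) ^ n * (1 / 2) ^ k" for k
    proof -
      have "(1 / 2 :: real) ^ ((sidx ^^ n) k) \<le> (1 / 2) ^ (k + n)"
        by (rule power_decreasing[OF sidx_funpow_ge]) auto
      then have "M * (1 / 2 :: real) ^ ((sidx ^^ n) k) \<le> M * (1 / 2) ^ n * (1 / 2) ^ k"
        using M(1) mult_left_mono by (fastforce simp: power_add mult_ac)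
      then show ?thesis using v(2)[of "(sidx ^^ n) k"] unfolding w_def by linarith
    qed
    moreover have "w k \<in> lp p" for k using v(1) by (simp add: w_def)
    moreover have "summable (\<lambda>k. M * (1 / 2) ^ n * (1 / 2 :: real) ^ k)"
      by (intro summable_mult summable_geometric) auto
    ultimately have "opb p p (\<Sum>k. M * (1 / 2) ^ n * (1 / 2) ^ k) (colop w)"
      by (intro opb_colop[OF p p]) auto
    moreover have "(\<Sum>k. M * (1 / 2) ^ n * (1 / 2 :: real) ^ k) = 2 * M * (1 / 2) ^ n"
      using suminf_geometric[of "1/2 :: real"] by (subst suminf_mult) (auto intro: summable_geometric)
    ultimately have W: "opb p p (2 * M * (1 / 2) ^ n) (colop w)" by simp
    have TS: "T' \<circ> (shift ^^ Suc n) \<in> ops p p"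
      by (rule cmp[OF ops_funpow[OF ops_block(1)[OF p]] T'])
    show ?thesis
    proof (rule opb_cong[OF p W])
      fix x assume "x \<in> lp p"
      then show "(T' \<circ> (shift ^^ Suc n)) x = colop w x"
      proof (rule op_ext[OF p p TS opb_ops[OF W], rotated])
        fix k
        show "(T' \<circ> (shift ^^ Suc n)) (unit k) = colop w (unit k)"
          unfolding o_apply shift_unit colop_unit by (simp add: w_def v_def)
      qed
    qed
  qed
  \<comment> \<open>\<open>C\<close> covers n = 0. For n = m + 1 the bound 2 M / 2^m equals 4 M /
    2^(m+1).\<close>
  have "opb p p ((C + 4 * M) * (1 / 2) ^ n) (T' \<circ> (shift ^^ n))" for n
  proof (cases n)
    case 0
    then show ?thesis using opb_mono[OF C(2), of "C + 4 * M"] M(1) by (simp add: id_def[symmetric])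
  next
    case (Suc m)
    show ?thesis unfolding Suc by (rule opb_mono[OF decay_Suc]) (use C(1) M(1) in \<open>simp add: field_simps\<close>)
  qed
  then have "is_commutator_on (ell p) T'"
    using C(1) M(1) by (intro commutator_of_shift_decay[OF p T', of "1/2" "C + 4 * M"]) auto
  then show ?thesis unfolding T'_def by (rule commutator_similar[OF p G To GG'])
qed

section \<open>Gliding humps\<close>

text \<open>Bolzano-Weierstrass, one coordinate at a time, each time thinning out the index set that
  was left.\<close>

lemma coord_pigeonhole:
  fixes g :: "'i \<Rightarrow> nat \<Rightarrow> complex"
  assumes "finite A" "infinite I" "0 < \<eta>" "\<And>a n. a \<in> A \<Longrightarrow> cmod (g a n) \<le> C"
  shows "\<exists>J\<subseteq>I. infinite J \<and> (\<forall>a\<in>A. \<forall>i\<in>J. \<forall>j\<in>J. cmod (g a i - g a j) \<le> \<eta>)"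
  using assms(1,4)
proof (induction A rule: finite_induct)
  case empty
  then show ?case using assms(2) by blast
next
  case (insert a A)
  then obtain J where J: "J \<subseteq> I" "infinite J" "\<And>a i j. a \<in> A \<Longrightarrow> i \<in> J \<Longrightarrow> j \<in> J \<Longrightarrow> cmod (g a i - g a j) \<le> \<eta>"
    by (metis insertCI)
  define e where "e = enumerate J"
  have e: "strict_mono e" "\<And>n. e n \<in> J"
    using J(2) strict_mono_enumerate enumerate_in_set by (auto simp: e_def)
  have "bounded (range (\<lambda>n. g a (e n)))" using insert.prems by (auto simp: bounded_iff)
  then obtain l r where r: "strict_mono r" "((\<lambda>n. g a (e n)) \<circ> r) \<longlonglongrightarrow> l"
    using bounded_imp_convergent_subsequence by blast
  have "0 < \<eta> / 2" using assms(3) by simp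
  then obtain N where N: "\<And>n. n \<ge> N \<Longrightarrow> cmod (g a (e (r n)) - l) < \<eta> / 2"
    using LIMSEQ_D[OF r(2)] by (metis comp_apply)
  let ?J = "(\<lambda>n. e (r n)) ` {N..}"
  have "inj_on (\<lambda>n. e (r n)) {N..}"
    using strict_mono_o[OF e(1) r(1)] by (auto simp: o_def dest: strict_mono_imp_inj_on intro: inj_on_subset)
  then have "infinite ?J" by (simp add: finite_image_iff infinite_Ici)
  moreover have "?J \<subseteq> J" using e(2) by auto
  moreover have "cmod (g a i - g a j) \<le> \<eta>" if ij: "i \<in> ?J" "j \<in> ?J" for i j
  proof -
    have "cmod (g a i - l) < \<eta> / 2" "cmod (g a j - l) < \<eta> / 2" using ij N by auto
    then show ?thesis using norm_triangle_ineq4[of "g a i - l" "g a j - l"] by simp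
  qed
  ultimately have "?J \<subseteq> I \<and> infinite ?J \<and> (\<forall>a\<in>insert a A. \<forall>i\<in>?J. \<forall>j\<in>?J. cmod (g a i - g a j) \<le> \<eta>)"
    using J(1,3) by (metis insertE subset_iff)
  then show ?case by blast
qed

lemma infinite_two:
  assumes "infinite (J :: nat set)" obtains i j where "i \<in> J" "j \<in> J" "i < j"
  using assms unfolding infinite_nat_iff_unbounded by (metis assms finite.emptyI equals0I)

text \<open>Without a finite net, vectors of the unit ball can be chosen greedily with
  \<epsilon>-separated images. Two of them that nearly agree on the first \<open>K\<close>
  coordinates, as do their images, have a difference that is a hump. No weak limits are
  used.\<close>

lemma hump_exists:
  assumes p: "1 \<le> p" and q: "1 \<le> q" and T: "T \<in> ops p q" and nc: "\<not> cpt p q T"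
  obtains \<epsilon> where "0 < \<epsilon>" "\<And>K \<eta>. 0 < \<eta> \<Longrightarrow>
    \<exists>z\<in>lp p. lpn p z \<le> 2 \<and> \<epsilon> \<le> lpn q (T z) \<and> (\<forall>k<K. cmod (z k) \<le> \<eta> \<and> cmod (T z k) \<le> \<eta>)"
proof -
  obtain \<epsilon> where \<epsilon>: "0 < \<epsilon>" and no: "\<And>F. finite F \<Longrightarrow> F \<subseteq> lp q \<Longrightarrow>
      \<exists>x\<in>lp p. lpn p x \<le> 1 \<and> (\<forall>y\<in>F. \<epsilon> < lpn q (T x - y))"
    using nc T unfolding cpt_def by (metis not_le)
  have "\<exists>f :: nat \<Rightarrow> vec. \<forall>n. f n \<in> lp p \<and> lpn p (f n) \<le> 1 \<and> (\<forall>m<n. \<epsilon> < lpn q (T (f n) - T (f m)))"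
  proof (rule dependent_wellorder_choice)
    fix n :: nat and f :: "nat \<Rightarrow> vec"
    assume h: "\<And>y. y < n \<Longrightarrow> f y \<in> lp p \<and> lpn p (f y) \<le> 1 \<and> (\<forall>m<y. \<epsilon> < lpn q (T (f y) - T (f m)))"
    have "(\<lambda>m. T (f m)) ` {..<n} \<subseteq> lp q" using h op_in[OF T] by auto
    then show "\<exists>r. r \<in> lp p \<and> lpn p r \<le> 1 \<and> (\<forall>m<n. \<epsilon> < lpn q (T r - T (f m)))"
      using no[of "(\<lambda>m. T (f m)) ` {..<n}"] by auto
  qed auto
  then obtain x :: "nat \<Rightarrow> vec" where x: "\<And>n. x n \<in> lp p" "\<And>n. lpn p (x n) \<le> 1"
    "\<And>m n. m < n \<Longrightarrow> \<epsilon> < lpn q (T (x n) - T (x m))" by blast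
  obtain M where M: "0 \<le> M" "opb p q M T" using T by (rule opsE)
  have Tx: "T (x n) \<in> lp q" for n using op_in[OF T x(1)] .
  have "\<exists>z\<in>lp p. lpn p z \<le> 2 \<and> \<epsilon> \<le> lpn q (T z) \<and> (\<forall>k<K. cmod (z k) \<le> \<eta> \<and> cmod (T z k) \<le> \<eta>)"
    if \<eta>: "0 < \<eta>" for K \<eta>
  proof -
    have "cmod (x n k) \<le> 1" for n k using coord_le_lpn[OF p x(1)] x(2) order_trans by blast
    then obtain J where J: "infinite J" "\<And>k i j. k < K \<Longrightarrow> i \<in> J \<Longrightarrow> j \<in> J \<Longrightarrow> cmod (x i k - x j k) \<le> \<eta>"
      using coord_pigeonhole[of "{..<K}" UNIV \<eta> "\<lambda>k n. x n k" 1] \<eta> by auto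
    have "cmod (T (x n) k) \<le> M" for n k
      using coord_le_lpn[OF q Tx, of n k] opb_le[OF M(2) x(1), of n] mult_left_mono[OF x(2) M(1), of n] by linarith
    then obtain J' where J': "J' \<subseteq> J" "infinite J'" "\<And>k i j. k < K \<Longrightarrow> i \<in> J' \<Longrightarrow> j \<in> J' \<Longrightarrow> cmod (T (x i) k - T (x j) k) \<le> \<eta>"
      using coord_pigeonhole[of "{..<K}" J \<eta> "\<lambda>k n. T (x n) k" M] \<eta> J(1) by auto
    obtain i j where ij: "i \<in> J'" "j \<in> J'" "i < j" using infinite_two[OF J'(2)] .
    have "x j - x i \<in> lp p" "T (x j - x i) = T (x j) - T (x i)"
      using diff_lp(1)[OF p x(1) x(1)] op_diff[OF p T x(1) x(1)] by auto
    moreover have "lpn p (x j - x i) \<le> 2" using diff_lp(2)[OF p x(1) x(1), of j i] x(2)[of i] x(2)[of j] by linarith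
    ultimately show ?thesis using x(3)[OF ij(3)] J(2) J' ij by (intro bexI[of _ "x j - x i"]) (auto simp: less_imp_le subset_iff)
  qed
  then show ?thesis using that \<epsilon> by blast
qed

text \<open>Head and tail of a hump are cut off. Both pieces are small in norm, so the image changes
  little.\<close>

lemma hump_finite:
  assumes p: "1 \<le> p" and q: "1 \<le> q" and T: "T \<in> ops p q" and nc: "\<not> cpt p q T"
  obtains \<epsilon> where "0 < \<epsilon>" "\<And>K \<eta>. 0 < \<eta> \<Longrightarrow> \<exists>z n. (\<forall>k. k < K \<or> n \<le> k \<longrightarrow> z k = 0) \<and> z \<in> lp p \<and>
    lpn p z \<le> 2 \<and> \<epsilon> \<le> lpn q (T z) \<and> (\<forall>k<K. cmod (T z k) \<le> \<eta>)"
proof -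
  obtain \<epsilon> where \<epsilon>: "0 < \<epsilon>" and hump: "\<And>K \<eta>. 0 < \<eta> \<Longrightarrow>
    \<exists>z\<in>lp p. lpn p z \<le> 2 \<and> \<epsilon> \<le> lpn q (T z) \<and> (\<forall>k<K. cmod (z k) \<le> \<eta> \<and> cmod (T z k) \<le> \<eta>)"
    using hump_exists[OF assms] by blast
  obtain M where M: "0 \<le> M" "opb p q M T" using T by (rule opsE)
  have "\<exists>z n. (\<forall>k. k < K \<or> n \<le> k \<longrightarrow> z k = 0) \<and> z \<in> lp p \<and>
    lpn p z \<le> 2 \<and> \<epsilon> / 2 \<le> lpn q (T z) \<and> (\<forall>k<K. cmod (T z k) \<le> \<eta>)" if \<eta>: "0 < \<eta>" for K \<eta>
  proof -
    \<comment> \<open>The allowed norm of the removed part: its image then costs at most \<eta>/2 in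
      a coordinate and \<epsilon>/2 in norm. The divisor is \<open>M + 1\<close> because
      \<open>M\<close> may be 0.\<close>
    define \<delta> where "\<delta> = min (\<eta> / 2) (\<epsilon> / 2) / (M + 1)"
    have \<delta>: "0 < \<delta>" using \<eta> \<epsilon> M by (simp add: \<delta>_def)
    have M\<delta>: "M * \<delta> \<le> min (\<eta> / 2) (\<epsilon> / 2)"
    proof -
      have "M * \<delta> \<le> (M + 1) * \<delta>" using \<delta> by simp
      then show ?thesis using M by (simp add: \<delta>_def)
    qed
    \<comment> \<open>\<open>K\<close> coordinates of this size add up to at most \<delta>/2; the
      tail takes the other half of \<delta>.\<close>
    define \<eta>' where "\<eta>' = min (\<eta> / 2) (\<delta> / (2 * (real K + 1)))"
    have \<eta>': "0 < \<eta>'" using \<eta> \<delta> by (simp add: \<eta>'_def)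
    obtain y where y: "y \<in> lp p" "lpn p y \<le> 2" "\<epsilon> \<le> lpn q (T y)" "\<And>k. k < K \<Longrightarrow> cmod (y k) \<le> \<eta>' \<and> cmod (T y k) \<le> \<eta>'"
      using hump[OF \<eta>', of K] by blast
    have "0 < \<delta> / 2" using \<delta> by simp
    then obtain n where n: "\<And>S. S \<subseteq> {n..} \<Longrightarrow> lpn p (cut S y) \<le> \<delta> / 2" using lp_tail_small[OF p y(1)] by blast
    define m where "m = max n K"
    define z where "z = cut {K..<m} y"
    have z: "z \<in> lp p" "lpn p z \<le> 2" using cut_lp[OF p y(1)] y(2) order_trans unfolding z_def by blast+
    have split: "y - z = cut {..<K} y + cut {m..} y" by (auto simp: z_def m_def fun_eq_iff)
    have "lpn p (cut {..<K} y) \<le> real K * \<eta>'" using lp_head_le[OF p y(1)] y(4) by blast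
    also have "\<dots> \<le> real K * (\<delta> / (2 * (real K + 1)))" by (intro mult_left_mono) (auto simp: \<eta>'_def)
    also have "\<dots> \<le> \<delta> / 2" using \<delta> by (simp add: field_simps)
    finally have "lpn p (y - z) \<le> \<delta>"
      using add_lp(2)[OF p cut_lp(1)[OF p y(1)] cut_lp(1)[OF p y(1)], of "{..<K}" "{m..}"] n[of "{m..}"]
      unfolding split by (simp add: m_def)
    then have "M * lpn p (y - z) \<le> M * \<delta>" using M(1) by (rule mult_left_mono)
    then have d: "lpn q (T (y - z)) \<le> min (\<eta> / 2) (\<epsilon> / 2)"
      using opb_le[OF M(2) diff_lp(1)[OF p y(1) z(1)]] M\<delta> by linarith
    have Td: "T (y - z) = T y - T z" by (rule op_diff[OF p T y(1) z(1)])
    have i: "T y \<in> lp q" "T z \<in> lp q" "T (y - z) \<in> lp q"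
      using op_in[OF T] y(1) z(1) diff_lp(1)[OF p] by blast+
    have "lpn q (T y) \<le> lpn q (T y - T z) + lpn q (T z)" by (rule lpn_triangle_sub[OF q i(1,2)])
    then have "\<epsilon> / 2 \<le> lpn q (T z)" using d y(3) unfolding Td by simp
    moreover have "cmod (T z k) \<le> \<eta>" if "k < K" for k
    proof -
      have "cmod (T y k - T z k) \<le> \<eta> / 2" using coord_le_lpn[OF q i(3), of k] d by (simp add: Td)
      moreover have "cmod (T y k) \<le> \<eta> / 2" using y(4)[OF that] by (simp add: \<eta>'_def)
      ultimately show ?thesis using norm_triangle_ineq4[of "T y k" "T y k - T z k"] by simp
    qed
    moreover have "\<forall>k. k < K \<or> m \<le> k \<longrightarrow> z k = 0" by (auto simp: z_def)
    ultimately show ?thesis using z by blast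
  qed
  then show ?thesis using that[of "\<epsilon> / 2"] \<epsilon> by simp
qed

text \<open>Each new hump starts where the previous block ended, and its block is extended until
  nearly all of its image lies inside. \<open>Good\<close> is left open so that Pitt's theorem and
  the factorisation can require different properties of the humps.\<close>

lemma gliding_hump:
  assumes q: "1 \<le> q" and \<eta>0: "0 < \<eta>0"
    and hump: "\<And>K \<eta>. 0 < \<eta> \<Longrightarrow> \<exists>z\<in>Good. \<exists>n. (\<forall>k. k < K \<or> n \<le> k \<longrightarrow> z k = 0) \<and> (\<forall>k<K. cmod (T z k) \<le> \<eta>)"
    and T: "\<And>z. z \<in> Good \<Longrightarrow> T z \<in> lp q"
  obtains \<kappa> :: "nat \<Rightarrow> nat" and z :: "nat \<Rightarrow> vec" where "strict_mono \<kappa>" "\<kappa> 0 = 0" "\<And>n. z n \<in> Good"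
    "\<And>n k. k \<notin> {\<kappa> n..<\<kappa> (Suc n)} \<Longrightarrow> z n k = 0"
    "\<And>n. lpn q (T (z n) - cut {\<kappa> n..<\<kappa> (Suc n)} (T (z n))) \<le> \<eta>0 * (1 / 2) ^ n"
proof -
  have ex: "\<exists>z\<in>Good. \<exists>n>K. (\<forall>k. k \<notin> {K..<n} \<longrightarrow> z k = 0) \<and> lpn q (T z - cut {K..<n} (T z)) \<le> \<eta>0 * (1 / 2) ^ m" for K m
  proof -
    define \<delta> where "\<delta> = \<eta>0 * (1 / 2) ^ m"
    have \<delta>: "0 < \<delta>" using \<eta>0 by (simp add: \<delta>_def)
    have "0 < \<delta> / (2 * (real K + 1))" using \<delta> by simp
    then obtain z n where z: "z \<in> Good" "\<And>k. k < K \<or> n \<le> k \<Longrightarrow> z k = 0" "\<And>k. k < K \<Longrightarrow> cmod (T z k) \<le> \<delta> / (2 * (real K + 1))"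
      using hump by meson
    have "0 < \<delta> / 2" using \<delta> by simp
    then obtain n' where n': "\<And>S. S \<subseteq> {n'..} \<Longrightarrow> lpn q (cut S (T z)) \<le> \<delta> / 2"
      using lp_tail_small[OF q T[OF z(1)]] by blast
    \<comment> \<open>The block must be nonempty, contain the support of \<open>z\<close>, and leave
      at most \<delta>/2 of the image to its right.\<close>
    define N where "N = max (Suc K) (max n n')"
    have N_n': "{N..} \<subseteq> {n'..}" by (auto simp: N_def)
    have split: "T z - cut {K..<N} (T z) = cut {..<K} (T z) + cut {N..} (T z)" by (auto simp: N_def fun_eq_iff)
    have "lpn q (cut {..<K} (T z)) \<le> real K * (\<delta> / (2 * (real K + 1)))" by (rule lp_head_le[OF q T[OF z(1)] z(3)])
    also have "\<dots> \<le> \<delta> / 2" using \<delta> by (simp add: field_simps)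
    finally have "lpn q (T z - cut {K..<N} (T z)) \<le> \<delta>"
      using add_lp(2)[OF q cut_lp(1)[OF q T[OF z(1)]] cut_lp(1)[OF q T[OF z(1)]], of "{..<K}" "{N..}"] n'[of "{N..}"] N_n'
      unfolding split by simp
    moreover have "\<forall>k. k \<notin> {K..<N} \<longrightarrow> z k = 0" by (intro allI impI z(2)) (auto simp: N_def)
    ultimately show ?thesis using z(1) by (intro bexI[of _ z] exI[of _ N]) (auto simp: N_def \<delta>_def)
  qed
  \<comment> \<open>A state consists of the left end of a block, its vector and its right end. The
    last clause starts the first block at 0, so that the blocks cover all indices.\<close>
  define P where "P m s \<longleftrightarrow> fst (snd s) \<in> Good \<and> fst s < snd (snd s) \<and> (\<forall>k. k \<notin> {fst s..<snd (snd s)} \<longrightarrow> fst (snd s) k = 0)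
      \<and> lpn q (T (fst (snd s)) - cut {fst s..<snd (snd s)} (T (fst (snd s)))) \<le> \<eta>0 * (1 / 2) ^ m \<and> (m = 0 \<longrightarrow> fst s = 0)"
    for m :: nat and s :: "nat \<times> vec \<times> nat"
  have "\<exists>f. \<forall>m. P m (f m) \<and> fst (f (Suc m)) = snd (snd (f m))"
  proof (rule dependent_nat_choice)
    show "\<exists>s. P 0 s" using ex[of 0 0] unfolding P_def by (metis fst_conv snd_conv)
    fix s :: "nat \<times> vec \<times> nat" and m :: nat
    obtain z n where "z \<in> Good" "n > snd (snd s)" "\<forall>k. k \<notin> {snd (snd s)..<n} \<longrightarrow> z k = 0"
      "lpn q (T z - cut {snd (snd s)..<n} (T z)) \<le> \<eta>0 * (1 / 2) ^ Suc m" using ex by blast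
    then show "\<exists>y. P (Suc m) y \<and> fst y = snd (snd s)" unfolding P_def
      by (intro exI[of _ "(snd (snd s), z, n)"]) auto
  qed
  then obtain f where f: "\<And>m. P m (f m)" "\<And>m. fst (f (Suc m)) = snd (snd (f m))" by blast
  show ?thesis
  proof (rule that[of "\<lambda>m. fst (f m)" "\<lambda>m. fst (snd (f m))"])
    show "strict_mono (\<lambda>m. fst (f m))" using f by (auto simp: strict_mono_Suc_iff P_def)
  qed (use f in \<open>auto simp: P_def\<close>)
qed

section \<open>Block operators and norming functionals\<close>

locale blocks =
  fixes \<kappa> :: "nat \<Rightarrow> nat"
  assumes mono: "strict_mono \<kappa>" and zero: "\<kappa> 0 = 0"
begin

abbreviation "I n \<equiv> {\<kappa> n..<\<kappa> (Suc n)}"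

definition blk :: "nat \<Rightarrow> nat" where "blk k = (LEAST n. k < \<kappa> (Suc n))"

lemma self_le: "n \<le> \<kappa> n"
  by (rule strict_mono_imp_increasing[OF mono])

lemma blk_in: "k \<in> I (blk k)"
proof -
  have "k < \<kappa> (Suc k)" using self_le[of "Suc k"] by simp
  then have 1: "k < \<kappa> (Suc (blk k))" unfolding blk_def by (rule LeastI)
  have "\<kappa> (blk k) \<le> k"
  proof (cases "blk k")
    case (Suc n)
    have "n < (LEAST n. k < \<kappa> (Suc n))" using Suc by (simp add: blk_def)
    from not_less_Least[OF this] show ?thesis by (simp add: Suc)
  qed (simp add: zero)
  then show ?thesis using 1 by simp
qed

lemma blk_eq: assumes "k \<in> I n" shows "blk k = n"
proof (rule ccontr)
  assume "blk k \<noteq> n"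
  then consider "Suc (blk k) \<le> n" | "Suc n \<le> blk k" by linarith
  then show False
  proof cases
    case 1
    then have "\<kappa> (Suc (blk k)) \<le> \<kappa> n" using mono by (simp add: strict_mono_less_eq)
    then show False using assms blk_in[of k] by simp
  next
    case 2
    then have "\<kappa> (Suc n) \<le> \<kappa> (blk k)" using mono by (simp add: strict_mono_less_eq)
    then show False using assms blk_in[of k] by simp
  qed
qed

lemma sum_blocks: "(\<Sum>k<\<kappa> m. f k) = (\<Sum>n<m. \<Sum>k\<in>I n. f k)" for f :: "nat \<Rightarrow> real"
proof (induction m)
  case (Suc m)
  have "\<kappa> m \<le> \<kappa> (Suc m)" using mono by (simp add: strict_mono_less_eq)
  then have "(\<Sum>k<\<kappa> (Suc m). f k) = (\<Sum>k<\<kappa> m. f k) + (\<Sum>k\<in>I m. f k)"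
    using sum.atLeastLessThan_concat[of 0 "\<kappa> m" "\<kappa> (Suc m)" f] by (simp add: atLeast0LessThan)
  then show ?case using Suc by simp
qed (simp add: zero)

text \<open>The operator whose n-th column is the part of \<open>w n\<close> in the n-th
  block.\<close>

definition bop :: "(nat \<Rightarrow> vec) \<Rightarrow> vec \<Rightarrow> vec" where
  "bop w c = (\<lambda>k. c (blk k) * w (blk k) k)"

lemma bop_unit: "bop w (unit n) = cut (I n) (w n)"
proof
  show "bop w (unit n) k = cut (I n) (w n) k" for k
    using blk_in[of k] blk_eq[of k n] by (auto simp: bop_def simp del: atLeastLessThan_iff)
qed

text \<open>The columns have disjoint supports, so the p-th powers of their norms add up and a
  uniform bound on the columns suffices.\<close>

lemma opb_bop:
  assumes p: "1 \<le> p" and w: "\<And>n. w n \<in> lp p" "\<And>n. lpn p (w n) \<le> C" and C: "0 \<le> C"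
  shows "opb p p C (bop w)"
proof -
  have "bop w c \<in> lp p \<and> lpn p (bop w c) \<le> C * lpn p c" if c: "c \<in> lp p" for c
  proof -
    have "(\<Sum>k<m. cmod (bop w c k) powr p) \<le> (C * lpn p c) powr p" for m
    proof -
      have "(\<Sum>k<m. cmod (bop w c k) powr p) \<le> (\<Sum>k<\<kappa> m. cmod (bop w c k) powr p)"
        using self_le[of m] by (intro sum_mono2) auto
      also have "\<dots> = (\<Sum>n<m. \<Sum>k\<in>I n. cmod (bop w c k) powr p)" by (rule sum_blocks)
      also have "\<dots> = (\<Sum>n<m. cmod (c n) powr p * (\<Sum>k\<in>I n. cmod (w n k) powr p))"
        unfolding sum_distrib_left
        by (intro sum.cong refl) (simp add: bop_def blk_eq norm_mult powr_mult)
      also have "\<dots> \<le> (\<Sum>n<m. cmod (c n) powr p * C powr p)"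
      proof (intro sum_mono mult_left_mono)
        fix n
        have "(\<Sum>k\<in>I n. cmod (w n k) powr p) \<le> lpn p (w n) powr p" by (rule lp_bound_sum[OF p w(1)]) simp
        also have "\<dots> \<le> C powr p" using w(2) p by (intro powr_mono2) auto
        finally show "(\<Sum>k\<in>I n. cmod (w n k) powr p) \<le> C powr p" .
      qed auto
      also have "\<dots> = (\<Sum>n<m. cmod (c n) powr p) * C powr p" by (simp add: sum_distrib_right)
      also have "\<dots> \<le> lpn p c powr p * C powr p" by (intro mult_right_mono lp_bound_sum[OF p c]) auto
      finally show ?thesis using C by (simp add: powr_mult mult.commute)
    qed
    then show ?thesis using lpI[OF p, of "C * lpn p c" "bop w c"] C by auto
  qed
  moreover have "bop w (c + d) = bop w c + bop w d" "bop w (scl a c) = scl a (bop w c)" for a c d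
    by (auto simp: bop_def fun_eq_iff algebra_simps)
  ultimately show ?thesis by (auto simp: opb_def)
qed

definition mass :: "real \<Rightarrow> (nat \<Rightarrow> vec) \<Rightarrow> nat \<Rightarrow> real" where
  "mass q w n = (\<Sum>k\<in>I n. cmod (w n k) powr q)"

text \<open>
  The \<open>n\<close>-th coordinate is the norming functional of \<open>w n\<close> restricted to \<open>I n\<close>, normalised to
  take the value 1 there. The summand is 0 where \<open>w n k = 0\<close>.
\<close>

definition nop :: "real \<Rightarrow> (nat \<Rightarrow> vec) \<Rightarrow> vec \<Rightarrow> vec" where
  "nop q w y = (\<lambda>n. \<Sum>k\<in>I n. of_real (cmod (w n k) powr q / mass q w n) * (y k / w n k))"

lemma mass_pos:
  assumes q: "1 \<le> q" and D: "0 < D" and w: "D \<le> lpn q (cut (I n) (w n))"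
  shows "D powr q \<le> mass q w n"
proof -
  have fin: "cut (I n) (w n) \<in> lp q" by (rule finite_support_lp[OF q, of "\<kappa> (Suc n)"]) auto
  have "lpn q (cut (I n) (w n)) \<le> mass q w n powr (1 / q)"
  proof (rule lpI(2)[OF q])
    fix m
    have "(\<Sum>k<m. cmod (cut (I n) (w n) k) powr q) = (\<Sum>k\<in>{..<m} \<inter> I n. cmod (w n k) powr q)"
      using q by (subst sum.inter_restrict) (auto intro!: sum.cong)
    also have "\<dots> \<le> mass q w n" unfolding mass_def by (intro sum_mono2) auto
    finally show "(\<Sum>k<m. cmod (cut (I n) (w n) k) powr q) \<le> (mass q w n powr (1 / q)) powr q"
      using q by (simp add: powr_powr mass_def sum_nonneg)
  qed auto
  then have "D \<le> mass q w n powr (1 / q)" using w by simp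
  then have "D powr q \<le> (mass q w n powr (1 / q)) powr q" using D q by (intro powr_mono2) auto
  then show ?thesis using q by (simp add: powr_powr mass_def sum_nonneg)
qed

lemma nop_cut:
  assumes q: "1 \<le> q" and D: "0 < D" and w: "\<And>n. D \<le> lpn q (cut (I n) (w n))"
  shows "nop q w (cut (I n) (w n)) = unit n"
proof
  fix m
  show "nop q w (cut (I n) (w n)) m = unit n m"
  proof (cases "m = n")
    case True
    have "mass q w n > 0" using mass_pos[where w = w and n = n, OF q D w] D by (smt (verit) powr_gt_zero)
    moreover have "nop q w (cut (I n) (w n)) n = (\<Sum>k\<in>I n. of_real (cmod (w n k) powr q / mass q w n))"
      unfolding nop_def by (intro sum.cong) (use q in auto)
    moreover have "\<dots> = of_real ((\<Sum>k\<in>I n. cmod (w n k) powr q) / mass q w n)"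
      by (simp add: sum_divide_distrib)
    ultimately show ?thesis using True by (simp add: mass_def)
  next
    case False
    have "cut (I n) (w n) k = 0" if "k \<in> I m" for k
      using blk_eq[OF that] blk_eq[of k n] False by (auto simp del: atLeastLessThan_iff)
    then show ?thesis using False by (simp add: nop_def del: cut_apply)
  qed
qed

text \<open>In each block the functional averages y k / w n k with the weights |w n k|^q / mass,
  which sum to 1. Jensen's inequality for the q-th power bounds its q-th power by the sum of |y k|^q
  over the block, divided by the mass.\<close>

lemma opb_nop:
  assumes q: "1 \<le> q" and D: "0 < D" and w: "\<And>n. D \<le> lpn q (cut (I n) (w n))"
  shows "opb q q (1 / D) (nop q w)"
proof -
  have jensen: "cmod (nop q w y n) powr q \<le> (1 / D) powr q * (\<Sum>k\<in>I n. cmod (y k) powr q)" for y n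
  proof -
    let ?S = "mass q w n"
    have Dq: "0 < D powr q" using D by simp
    have S: "D powr q \<le> ?S" "0 < ?S" using mass_pos[where w = w and n = n, OF q D w] Dq by linarith+
    have ne: "I n \<noteq> {}" using mono by (auto simp: strict_mono_Suc_iff)
    define u where "u k = cmod (w n k) powr q / ?S" for k
    have u: "sum u (I n) = 1" "\<And>k. 0 \<le> u k" using S by (auto simp: u_def mass_def simp flip: sum_divide_distrib)
    have "cmod (nop q w y n) \<le> (\<Sum>k\<in>I n. u k * (cmod (y k) / cmod (w n k)))"
      unfolding nop_def u_def using S by (intro order_trans[OF norm_sum] sum_mono) (simp add: norm_mult norm_divide)
    then have "cmod (nop q w y n) powr q \<le> (\<Sum>k\<in>I n. u k *\<^sub>R (cmod (y k) / cmod (w n k))) powr q"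
      using q by (intro powr_mono2) auto
    also have "\<dots> \<le> (\<Sum>k\<in>I n. u k * (cmod (y k) / cmod (w n k)) powr q)"
      by (rule convex_on_sum[OF _ ne convex_on_powr_nonneg[OF q] u(1)]) (use u in auto)
    also have "\<dots> \<le> (\<Sum>k\<in>I n. (1 / D) powr q * cmod (y k) powr q)"
    proof (rule sum_mono)
      fix k
      \<comment> \<open>Where \<open>w n k = 0\<close> the weight vanishes, and the left side is
        0.\<close>
      have "u k * (cmod (y k) / cmod (w n k)) powr q \<le> cmod (y k) powr q / ?S"
        using S by (cases "w n k = 0") (auto simp: u_def powr_divide)
      also have "\<dots> \<le> cmod (y k) powr q / D powr q" by (intro divide_left_mono mult_pos_pos S Dq) auto
      finally show "u k * (cmod (y k) / cmod (w n k)) powr q \<le> (1 / D) powr q * cmod (y k) powr q"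
        using D by (simp add: powr_divide)
    qed
    finally show ?thesis by (simp add: sum_distrib_left)
  qed
  have "nop q w y \<in> lp q \<and> lpn q (nop q w y) \<le> 1 / D * lpn q y" if y: "y \<in> lp q" for y
  proof -
    have "(\<Sum>n<m. cmod (nop q w y n) powr q) \<le> (1 / D * lpn q y) powr q" for m
    proof -
      have "(\<Sum>n<m. cmod (nop q w y n) powr q) \<le> (1 / D) powr q * (\<Sum>n<m. \<Sum>k\<in>I n. cmod (y k) powr q)"
        unfolding sum_distrib_left[of _ _ "{..<m}"] by (intro sum_mono jensen)
      also have "\<dots> = (1 / D) powr q * (\<Sum>k<\<kappa> m. cmod (y k) powr q)" by (simp only: sum_blocks)
      also have "\<dots> \<le> (1 / D) powr q * lpn q y powr q" by (intro mult_left_mono lp_bound_sum[OF q y]) auto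
      also have "\<dots> = (1 / D * lpn q y) powr q" using D by (subst powr_mult) auto
      finally show ?thesis .
    qed
    then show ?thesis using lpI[OF q, of "1 / D * lpn q y" "nop q w y"] D by auto
  qed
  moreover have "nop q w (y + z) = nop q w y + nop q w z" "nop q w (scl c y) = scl c (nop q w y)" for y z c
    by (auto simp: nop_def fun_eq_iff sum_distrib_left add_divide_distrib distrib_left sum.distrib mult_ac)
  ultimately show ?thesis unfolding opb_def by blast
qed

end

section \<open>Pitt's theorem\<close>

text \<open>The sum of the first m unit vectors has norm m^(1/r) in the space with exponent r. For
  large m the quotient m^(1/q - 1/p) exceeds every constant.\<close>

lemma no_formal_inclusion:
  assumes p: "1 \<le> p" and q: "1 \<le> q" and pq: "q < p" and F: "F \<in> ops p q" and unit: "\<And>n. F (unit n) = unit n"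
  shows False
proof -
  obtain K where K: "0 \<le> K" "opb p q K F" using F by (rule opsE)
  define e where "e m = (\<Sum>n<m. unit n)" for m
  have e_eq: "e m = (\<lambda>k. if k < m then 1 else 0)" for m by (auto simp: e_def sum_fun_apply fun_eq_iff)
  have norm_e: "lpn r (e m) = real m powr (1 / r)" if "1 \<le> r" for r m
  proof -
    have "(\<lambda>k. cmod (e m k) powr r) = (\<lambda>k. if k \<in> {..<m} then 1 else 0)" using that by (auto simp: e_eq)
    moreover have "(\<lambda>k. if k \<in> {..<m} then 1 else (0::real)) sums (\<Sum>k<m. 1)" by (rule sums_If_finite_set) simp
    ultimately show ?thesis by (simp add: lpn_def sums_iff)
  qed
  have e_lp: "e m \<in> lp p" for m unfolding e_def using p by (intro sum_lp) auto
  have Fe: "F (e m) = e m" for m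
    unfolding e_def using op_sum[OF p F, of "{..<m}" unit] p unit by simp
  have "real m powr (1 / q - 1 / p) \<le> K" if "0 < m" for m
  proof -
    have "real m powr (1 / q) \<le> K * real m powr (1 / p)"
      using opb_le[OF K(2) e_lp[of m]] norm_e[OF p, of m] norm_e[OF q, of m] Fe by simp
    then show ?thesis using that by (simp add: powr_diff divide_le_eq)
  qed
  moreover have "0 < 1 / q - 1 / p" using pq q by (simp add: field_simps)
  moreover obtain m :: nat where "max 1 ((K + 1) powr (1 / (1 / q - 1 / p))) < real m" using reals_Archimedean2 by blast
  ultimately have "((K + 1) powr (1 / (1 / q - 1 / p))) powr (1 / q - 1 / p) \<le> K"
    by (smt (verit) of_nat_0_less_iff powr_ge_zero powr_mono2)
  then show False using pq K(1) by (simp add: powr_powr)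
qed

lemma opb_halves:
  assumes "1 \<le> p" "1 \<le> q" "\<And>n. v n \<in> lp q" "\<And>n. lpn q (v n) \<le> c * (1 / 2) ^ n"
  shows "opb p q (2 * c) (colop v)"
proof -
  have s: "summable (\<lambda>n. c * (1 / 2) ^ n)" by (intro summable_mult summable_geometric) auto
  have "suminf (\<lambda>n. c * (1 / 2) ^ n) = 2 * c"
    using suminf_geometric[of "1/2 :: real"] by (subst suminf_mult) (auto intro: summable_geometric)
  then show ?thesis using opb_colop[OF assms s] by simp
qed

text \<open>Humps of a non-compact operator span a copy of the domain, and norming functionals for
  their images, composed with \<open>T\<close>, send \<open>unit n\<close> to itself up to
  geometrically small columns. Subtracting these columns leaves a bounded formal inclusion into a
  smaller exponent.\<close>

theorem pitt:
  assumes q: "1 \<le> q" and pq: "q < p" and T: "T \<in> ops p q"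
  shows "cpt p q T"
proof (rule ccontr)
  assume nc: "\<not> cpt p q T"
  have p: "1 \<le> p" using q pq by simp
  obtain \<epsilon> where \<epsilon>: "0 < \<epsilon>" and hump: "\<And>K \<eta>. 0 < \<eta> \<Longrightarrow> \<exists>z n. (\<forall>k. k < K \<or> n \<le> k \<longrightarrow> z k = 0) \<and> z \<in> lp p \<and>
    lpn p z \<le> 2 \<and> \<epsilon> \<le> lpn q (T z) \<and> (\<forall>k<K. cmod (T z k) \<le> \<eta>)"
    using hump_finite[OF p q T nc] by blast
  define Good where "Good = {z \<in> lp p. lpn p z \<le> 2 \<and> \<epsilon> \<le> lpn q (T z)}"
  have "0 < \<epsilon> / 2" using \<epsilon> by simp
  then obtain \<kappa> z where \<kappa>: "strict_mono \<kappa>" "\<kappa> 0 = 0" and z: "\<And>n. z n \<in> Good"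
    "\<And>n k. k \<notin> {\<kappa> n..<\<kappa> (Suc n)} \<Longrightarrow> z n k = 0"
    "\<And>n. lpn q (T (z n) - cut {\<kappa> n..<\<kappa> (Suc n)} (T (z n))) \<le> \<epsilon> / 2 * (1 / 2) ^ n"
  proof (rule gliding_hump[OF q, where Good = Good and T = T])
    show "\<exists>z\<in>Good. \<exists>n. (\<forall>k. k < K \<or> n \<le> k \<longrightarrow> z k = 0) \<and> (\<forall>k<K. cmod (T z k) \<le> \<eta>)" if "0 < \<eta>" for K \<eta>
      using hump[OF that, of K] unfolding Good_def by blast
    show "T z \<in> lp q" if "z \<in> Good" for z using op_in[OF T] that by (simp add: Good_def)
  qed blast+
  interpret blocks \<kappa> by unfold_locales (use \<kappa> in auto)
  have z_lp: "z n \<in> lp p" "lpn p (z n) \<le> 2" "\<epsilon> \<le> lpn q (T (z n))" for n using z(1)[of n] by (auto simp: Good_def)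
  have cutz: "cut (I n) (z n) = z n" for n using z(2)[of _ n] by (auto simp: fun_eq_iff simp del: atLeastLessThan_iff)
  define r where "r n = T (z n) - cut (I n) (T (z n))" for n
  have Tz: "T (z n) \<in> lp q" "cut (I n) (T (z n)) \<in> lp q" "r n \<in> lp q" for n
    using op_in[OF T z_lp(1)[of n]] cut_lp(1)[OF q] diff_lp(1)[OF q] by (auto simp: r_def)
  have r: "lpn q (r n) \<le> \<epsilon> / 2 * (1 / 2) ^ n" for n unfolding r_def by (rule z(3))
  \<comment> \<open>The image has norm at least \<epsilon>, and at most \<epsilon>/2 of it lies
    outside the block.\<close>
  have big: "\<epsilon> / 2 \<le> lpn q (cut (I n) (T (z n)))" for n
  proof -
    have "\<epsilon> / 2 * (1 / 2) ^ n \<le> \<epsilon> / 2 * 1" using \<epsilon> by (intro mult_left_mono) (auto simp: power_le_one)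
    then show ?thesis
      using lpn_triangle_sub[OF q Tz(1,2), of n n] r[of n] z_lp(3)[of n] unfolding r_def by linarith
  qed
  have U: "bop z \<in> ops p p" using opb_ops[OF opb_bop[OF p z_lp(1,2)]] by simp
  define \<Psi> where "\<Psi> = nop q (\<lambda>n. T (z n))"
  have \<Psi>: "opb q q (1 / (\<epsilon> / 2)) \<Psi>" unfolding \<Psi>_def by (rule opb_nop[OF q _ big]) (use \<epsilon> in simp)
  have \<Psi>r: "\<Psi> (r n) \<in> lp q" "lpn q (\<Psi> (r n)) \<le> 1 * (1 / 2) ^ n" for n
  proof -
    show "\<Psi> (r n) \<in> lp q" by (rule opb_in[OF \<Psi> Tz(3)])
    have "lpn q (\<Psi> (r n)) \<le> 1 / (\<epsilon> / 2) * (\<epsilon> / 2 * (1 / 2) ^ n)"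
      by (rule order_trans[OF opb_le[OF \<Psi> Tz(3)] mult_left_mono[OF r]]) (use \<epsilon> in simp)
    then show "lpn q (\<Psi> (r n)) \<le> 1 * (1 / 2) ^ n" using \<epsilon> by simp
  qed
  have E: "colop (\<lambda>n. \<Psi> (r n)) \<in> ops p q" by (rule opb_ops[OF opb_halves[OF p q \<Psi>r]])
  have "(\<Psi> \<circ> (T \<circ> bop z)) - colop (\<lambda>n. \<Psi> (r n)) \<in> ops p q"
    by (intro ops_diff q E ops_comp[OF ops_comp[OF U T] opb_ops[OF \<Psi>]])
  moreover have "((\<Psi> \<circ> (T \<circ> bop z)) - colop (\<lambda>n. \<Psi> (r n))) (unit n) = unit n" for n
  proof -
    have "T (z n) = cut (I n) (T (z n)) + r n" by (simp add: r_def)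
    then have "\<Psi> (T (z n)) = \<Psi> (cut (I n) (T (z n))) + \<Psi> (r n)"
      using op_add[OF opb_ops[OF \<Psi>] Tz(2,3)] by metis
    moreover have "\<Psi> (cut (I n) (T (z n))) = unit n"
      unfolding \<Psi>_def by (rule nop_cut[OF q _ big]) (use \<epsilon> in simp)
    moreover have "((\<Psi> \<circ> (T \<circ> bop z)) - colop (\<lambda>n. \<Psi> (r n))) (unit n) = \<Psi> (T (z n)) - \<Psi> (r n)"
      by (simp only: minus_apply o_apply bop_unit cutz colop_unit)
    ultimately show ?thesis by simp
  qed
  ultimately show False by (rule no_formal_inclusion[OF p q pq])
qed

section \<open>Operators that are not scalar modulo the compact operators\<close>

text \<open>The multiple \<open>T z a\<close> is the one for which the difference vanishes at the
  coordinate \<open>a\<close>. So the difference is the image of \<open>T z\<close> under the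
  projection along \<open>z\<close> that kills the coordinate \<open>a\<close>.\<close>

definition humped :: "real \<Rightarrow> (vec \<Rightarrow> vec) \<Rightarrow> bool" where
  "humped p T \<longleftrightarrow> (\<exists>C \<delta>. 0 < \<delta> \<and> (\<forall>K. \<forall>\<eta>>0. \<exists>z n a. (\<forall>k. k < K \<or> n \<le> k \<longrightarrow> z k = 0) \<and> z \<in> lp p \<and>
     lpn p z \<le> C \<and> z a = 1 \<and> \<delta> \<le> lpn p (T z - scl (T z a) z) \<and> (\<forall>k<K. cmod (T z k) \<le> \<eta>)))"

text \<open>
  The vectors \<open>z n\<close> span a copy of the space, complemented by \<open>U \<circ> res a\<close>, and the functionals
  norming \<open>T (z n) - T (z n) (a n) z n\<close>, composed with the complementary projection, provide \<open>V\<close>.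
\<close>

lemma humped_commutator:
  assumes p: "1 \<le> p" and T: "T \<in> ops p p" and h: "humped p T"
  shows "is_commutator_on (ell p) T"
proof -
  note cmp = ops_comp[where p=p and q=p and r=p]
  obtain C0 \<delta> where \<delta>: "0 < \<delta>" and hump0: "\<And>K \<eta>. 0 < \<eta> \<Longrightarrow> \<exists>z n a. (\<forall>k. k < K \<or> n \<le> k \<longrightarrow> z k = 0) \<and> z \<in> lp p \<and>
     lpn p z \<le> C0 \<and> z a = 1 \<and> \<delta> \<le> lpn p (T z - scl (T z a) z) \<and> (\<forall>k<K. cmod (T z k) \<le> \<eta>)"
    using h unfolding humped_def by blast
  define C where "C = max 0 C0"
  have C: "0 \<le> C" "C0 \<le> C" by (auto simp: C_def)
  define Good where "Good = {z \<in> lp p. lpn p z \<le> C \<and> (\<exists>a. z a = 1 \<and> \<delta> \<le> lpn p (T z - scl (T z a) z))}"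
  \<comment> \<open>The bound of the operator \<open>V\<close> below: 2/\<delta> for the norming
    functionals times 1 + C for the complementary projection.\<close>
  define M where "M = 1 / (\<delta> / 2) * (1 + C * 1)"
  have M: "0 < M" using \<delta> C by (auto simp: M_def intro!: mult_pos_pos)
  \<comment> \<open>Half of \<delta> must survive in each block, and the columns of the error
    \<open>E\<close> must stay below (1/4) (1/2)^n, so that \<open>E\<close> has bound 1/2.\<close>
  define \<eta>0 where "\<eta>0 = min (\<delta> / 2) (1 / (4 * M))"
  have \<eta>0: "0 < \<eta>0" "\<eta>0 \<le> \<delta> / 2" "M * \<eta>0 \<le> 1 / 4"
  proof -
    have "M * \<eta>0 \<le> M * (1 / (4 * M))" using M by (intro mult_left_mono) (auto simp: \<eta>0_def)
    then show "M * \<eta>0 \<le> 1 / 4" using M by simp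
  qed (use \<delta> M in \<open>auto simp: \<eta>0_def\<close>)
  obtain \<kappa> z where \<kappa>: "strict_mono \<kappa>" "\<kappa> 0 = 0" and z: "\<And>n. z n \<in> Good"
    "\<And>n k. k \<notin> {\<kappa> n..<\<kappa> (Suc n)} \<Longrightarrow> z n k = 0"
    "\<And>n. lpn p (T (z n) - cut {\<kappa> n..<\<kappa> (Suc n)} (T (z n))) \<le> \<eta>0 * (1 / 2) ^ n"
  proof (rule gliding_hump[OF p \<eta>0(1), where Good = Good and T = T])
    show "\<exists>z\<in>Good. \<exists>n. (\<forall>k. k < K \<or> n \<le> k \<longrightarrow> z k = 0) \<and> (\<forall>k<K. cmod (T z k) \<le> \<eta>)" if "0 < \<eta>" for K \<eta>
      using hump0[OF that, of K] C(2) unfolding Good_def by (smt (verit, best) mem_Collect_eq)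
    show "T z \<in> lp p" if "z \<in> Good" for z using op_in[OF T] that by (simp add: Good_def)
  qed blast
  interpret blocks \<kappa> by unfold_locales (use \<kappa> in auto)
  have z_lp: "z n \<in> lp p" "lpn p (z n) \<le> C" for n using z(1)[of n] by (auto simp: Good_def)
  have "\<exists>a. z n a = 1 \<and> \<delta> \<le> lpn p (T (z n) - scl (T (z n) a) (z n))" for n using z(1)[of n] by (auto simp: Good_def)
  then obtain a where a: "\<And>n. z n (a n) = 1" "\<And>n. \<delta> \<le> lpn p (T (z n) - scl (T (z n) (a n)) (z n))" by metis
  have a_in: "a n \<in> I n" for n using z(2)[of "a n" n] a(1)[of n] by fastforce
  have inj_a: "inj a" using blk_eq[OF a_in] by (metis injI)
  have cutz: "cut (I n) (z n) = z n" for n using z(2)[of _ n] by (auto simp: fun_eq_iff simp del: atLeastLessThan_iff)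
  define r where "r n = T (z n) - cut (I n) (T (z n))" for n
  define w where "w n = T (z n) - scl (T (z n) (a n)) (z n)" for n
  have in_lp: "T (z n) \<in> lp p" "cut (I n) (T (z n)) \<in> lp p" "r n \<in> lp p" "w n \<in> lp p" "cut (I n) (w n) \<in> lp p" for n
    using op_in[OF T z_lp(1)[of n]] cut_lp(1)[OF p] diff_lp(1)[OF p] scl_lp(1)[OF p z_lp(1)] by (auto simp: r_def w_def)
  have r: "lpn p (r n) \<le> \<eta>0 * (1 / 2) ^ n" for n unfolding r_def by (rule z(3))
  have cut_w: "cut (I n) (w n) = cut (I n) (T (z n)) - scl (T (z n) (a n)) (z n)" for n
    using z(2)[of _ n] by (auto simp: w_def fun_eq_iff simp del: atLeastLessThan_iff)
  have w_r: "w n - cut (I n) (w n) = r n" for n unfolding cut_w unfolding w_def r_def by simp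
  have big: "\<delta> / 2 \<le> lpn p (cut (I n) (w n))" for n
  proof -
    have "\<eta>0 * (1 / 2) ^ n \<le> \<eta>0 * 1" using \<eta>0 by (intro mult_left_mono) (auto simp: power_le_one)
    then show ?thesis
      using lpn_triangle_sub[OF p in_lp(4,5), of n n] r[of n] a(2)[of n] \<eta>0(2)
      unfolding w_r unfolding w_def by linarith
  qed
  define U where "U = bop z"
  have U: "opb p p C U" unfolding U_def by (rule opb_bop[OF p z_lp C(1)])
  have U_unit: "U (unit n) = z n" for n by (simp only: U_def bop_unit cutz)
  have resU: "res a (U c) = c" for c
    by (rule ext) (simp add: U_def bop_def blk_eq[OF a_in] a(1))
  define \<Psi> where "\<Psi> = nop p w"
  have \<Psi>: "opb p p (1 / (\<delta> / 2)) \<Psi>" unfolding \<Psi>_def by (rule opb_nop[OF p _ big]) (use \<delta> in simp)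
  \<comment> \<open>\<open>res a\<close> is a left inverse of \<open>U\<close>, so the bracket
    projects along the range of \<open>U\<close> and \<open>V U = 0\<close>.\<close>
  define V where "V = \<Psi> \<circ> (id - (U \<circ> res a))"
  have V: "opb p p M V" unfolding V_def M_def
    by (rule opb_comp[OF opb_diff[OF p opb_id opb_comp[OF opb_res[OF p inj_a] U C(1)]] \<Psi>]) (use \<delta> in simp)
  have VU: "V (U c) = 0" for c
    using op_zero[OF opb_ops[OF \<Psi>]] by (simp add: V_def resU)
  \<comment> \<open>Only the coordinate \<open>a n\<close> lies in block \<open>n\<close>, so the
    projection subtracts exactly \<open>T (z n) (a n)\<close> times \<open>z n\<close> and leaves
    the part of \<open>w n\<close> in the block.\<close>
  have V_cut: "V (cut (I n) (T (z n))) = unit n" for n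
  proof -
    have "res a (cut (I n) (T (z n))) = scl (T (z n) (a n)) (unit n)"
    proof
      fix m
      show "res a (cut (I n) (T (z n))) m = scl (T (z n) (a n)) (unit n) m"
        using a_in[of n] blk_eq[OF a_in[of m]] blk_eq[of "a m" n] by (auto simp del: atLeastLessThan_iff)
    qed
    then have "U (res a (cut (I n) (T (z n)))) = scl (T (z n) (a n)) (z n)"
      using op_scl[OF opb_ops[OF U] unit_lp(1)[OF p]] U_unit by metis
    then have "V (cut (I n) (T (z n))) = \<Psi> (cut (I n) (w n))" by (simp only: V_def o_apply minus_apply id_apply cut_w)
    also have "\<dots> = unit n" unfolding \<Psi>_def by (rule nop_cut[OF p _ big]) (use \<delta> in simp)
    finally show ?thesis .
  qed
  have Vr: "V (r n) \<in> lp p" "lpn p (V (r n)) \<le> 1 / 4 * (1 / 2) ^ n" for n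
  proof -
    show "V (r n) \<in> lp p" by (rule opb_in[OF V in_lp(3)])
    have "lpn p (V (r n)) \<le> M * (\<eta>0 * (1 / 2) ^ n)"
      by (rule order_trans[OF opb_le[OF V in_lp(3)] mult_left_mono[OF r]]) (use M in simp)
    also have "\<dots> \<le> 1 / 4 * (1 / 2) ^ n"
      using mult_right_mono[OF \<eta>0(3), of "(1 / 2) ^ n"] by (simp add: mult.assoc)
    finally show "lpn p (V (r n)) \<le> 1 / 4 * (1 / 2) ^ n" .
  qed
  define E where "E = colop (\<lambda>n. V (r n))"
  have E: "opb p p (2 * (1 / 4)) E" unfolding E_def by (rule opb_halves[OF p p Vr])
  have VTU: "V (T (U x)) = x + E x" if x: "x \<in> lp p" for x
  proof -
    have "(V \<circ> T \<circ> U) x = (id + E) x"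
    proof (rule op_ext[OF p p _ _ _ x])
      show "V \<circ> T \<circ> U \<in> ops p p" by (intro cmp opb_ops[OF U] opb_ops[OF V] T)
      show "id + E \<in> ops p p" by (intro ops_add p ops_id opb_ops[OF E])
      fix n
      have "T (z n) = cut (I n) (T (z n)) + r n" by (simp add: r_def)
      then have "V (T (z n)) = V (cut (I n) (T (z n))) + V (r n)"
        using op_add[OF opb_ops[OF V] in_lp(2,3)] by metis
      then show "(V \<circ> T \<circ> U) (unit n) = (id + E) (unit n)"
        by (simp only: o_apply U_unit V_cut plus_fun_apply id_apply E_def colop_unit)
    qed
    then show ?thesis by simp
  qed
  \<comment> \<open>\<open>V T U = 1 + E\<close> with \<open>E\<close> of bound 1/2; the Rosenblum
    equation with \<mu> = 1 and zero left coefficient supplies a left inverse.\<close>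
  obtain Z where Z: "Z \<in> ops p p" "\<And>x. x \<in> lp p \<Longrightarrow> scl 1 (Z x) + 0 (Z x) + Z (E x) = id x"
    using rosenblum[OF p p opb_zero E _ _ ops_id, of 1] by auto
  have Zx: "Z (x + E x) = x" if "x \<in> lp p" for x
    using Z(2)[OF that] op_add[OF Z(1) that opb_in[OF E that]] by simp
  show ?thesis
  proof (rule commutator_of_factorization[OF p T opb_ops[OF U], of "Z \<circ> V"])
    show "Z \<circ> V \<in> ops p p" by (intro cmp Z(1) opb_ops[OF V])
    show "(Z \<circ> V) (U x) = 0" for x using op_zero[OF Z(1)] by (simp add: VU)
    show "(Z \<circ> V) (T (U x)) = x" if "x \<in> lp p" for x using that by (simp add: VTU Zx)
  qed
qed

text \<open>Differences of far unit vectors can be chosen with images small on any initial segment.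
  If \<open>T\<close> is not humped, they are nearly eigenvectors; their approximate eigenvalues are
  bounded, and \<mu> is a cluster point.\<close>

lemma near_eigenvectors:
  assumes p: "1 \<le> p" and T: "T \<in> ops p p" and nh: "\<not> humped p T"
  obtains \<mu> where "\<And>\<delta> K. 0 < \<delta> \<Longrightarrow>
    \<exists>a b. K \<le> a \<and> a < b \<and> lpn p (T (unit a - unit b) - scl \<mu> (unit a - unit b)) \<le> \<delta>"
proof -
  obtain M where M: "0 \<le> M" "opb p p M T" using T by (rule opsE)
  have uu: "unit a - unit b \<in> lp p" "lpn p (unit a - unit b) \<le> 2" for a b
    using diff_lp[OF p unit_lp(1)[OF p] unit_lp(1)[OF p], of a b] p by auto
  have ex: "\<exists>a b. K \<le> a \<and> a < b \<and> lpn p (T (unit a - unit b) - scl (T (unit a - unit b) a) (unit a - unit b)) \<le> \<delta>"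
    if \<delta>: "0 < \<delta>" for \<delta> K
  proof -
    \<comment> \<open>The negation of \<open>humped\<close> with bound 2: beyond \<open>K0\<close>,
      every admissible vector is nearly mapped to a multiple of itself.\<close>
    obtain K0 \<eta> where \<eta>: "0 < \<eta>" and K0: "\<And>z n a. (\<forall>k. k < K0 \<or> n \<le> k \<longrightarrow> z k = 0) \<Longrightarrow> z \<in> lp p \<Longrightarrow>
       lpn p z \<le> 2 \<Longrightarrow> z a = 1 \<Longrightarrow> (\<forall>k<K0. cmod (T z k) \<le> \<eta>) \<Longrightarrow> lpn p (T z - scl (T z a) z) < \<delta>"
      using nh \<delta> unfolding humped_def by (metis not_le)
    have "cmod (T (unit n) k) \<le> M" for n k
      using coord_le_lpn[OF p op_in[OF T unit_lp(1)[OF p]], of n k] opb_le[OF M(2) unit_lp(1)[OF p], of n] p by simp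
    then obtain J where J: "J \<subseteq> {max K K0..}" "infinite J"
      "\<And>k i j. k < K0 \<Longrightarrow> i \<in> J \<Longrightarrow> j \<in> J \<Longrightarrow> cmod (T (unit i) k - T (unit j) k) \<le> \<eta>"
      using coord_pigeonhole[of "{..<K0}" "{max K K0..}" \<eta> "\<lambda>k n. T (unit n) k" M] \<eta> infinite_Ici[of "max K K0"] by auto
    obtain a b where ab: "a \<in> J" "b \<in> J" "a < b" using infinite_two[OF J(2)] .
    have ge: "max K K0 \<le> a" using J(1) ab by auto
    have Tu: "T (unit a - unit b) = T (unit a) - T (unit b)" using op_diff[OF p T] p by simp
    have "lpn p (T (unit a - unit b) - scl (T (unit a - unit b) a) (unit a - unit b)) < \<delta>"
    proof (rule K0[OF _ uu])
      show "\<forall>k. k < K0 \<or> Suc b \<le> k \<longrightarrow> (unit a - unit b) k = 0" using ge ab(3) by auto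
      show "(unit a - unit b) a = 1" using ab(3) by simp
      show "\<forall>k<K0. cmod (T (unit a - unit b) k) \<le> \<eta>" unfolding Tu using J(3)[OF _ ab(1,2)] by simp
    qed
    then show ?thesis using ge ab(3) by (intro exI[of _ a] exI[of _ b]) auto
  qed
  have "\<forall>m. \<exists>a b. m \<le> a \<and> a < b \<and> lpn p (T (unit a - unit b) - scl (T (unit a - unit b) a) (unit a - unit b)) \<le> 1 / (real m + 1)"
    using ex by simp
  then obtain a b where ab: "\<And>m :: nat. m \<le> a m" "\<And>m. a m < b m"
    "\<And>m. lpn p (T (unit (a m) - unit (b m)) - scl (T (unit (a m) - unit (b m)) (a m)) (unit (a m) - unit (b m))) \<le> 1 / (real m + 1)"
    by metis
  define f where "f m = unit (a m) - unit (b m)" for m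
  have f: "f m \<in> lp p" "lpn p (f m) \<le> 2" for m unfolding f_def by (rule uu)+
  define \<nu> where "\<nu> m = T (f m) (a m)" for m
  have "cmod (\<nu> m) \<le> M * 2" for m
    using coord_le_lpn[OF p op_in[OF T f(1)], of m "a m"] opb_le[OF M(2) f(1)[of m]] mult_left_mono[OF f(2)[of m] M(1)]
    unfolding \<nu>_def by linarith
  then have "bounded (range \<nu>)" by (auto simp: bounded_iff)
  then obtain \<mu> s where s: "strict_mono s" "(\<nu> \<circ> s) \<longlonglongrightarrow> \<mu>" using bounded_imp_convergent_subsequence by blast
  have "\<exists>a b. K \<le> a \<and> a < b \<and> lpn p (T (unit a - unit b) - scl \<mu> (unit a - unit b)) \<le> \<delta>" if \<delta>: "0 < \<delta>" for \<delta> K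
  proof -
    obtain N where N: "\<And>n. n \<ge> N \<Longrightarrow> cmod (\<nu> (s n) - \<mu>) < \<delta> / 4"
      using LIMSEQ_D[OF s(2), of "\<delta> / 4"] \<delta> by auto
    obtain N' :: nat where N': "2 / \<delta> < real N'" using reals_Archimedean2 by blast
    define n where "n = max N (max N' K)"
    define m where "m = s n"
    have m: "n \<le> m" unfolding m_def by (rule strict_mono_imp_increasing[OF s(1)])
    have "real N' \<le> real m" using m by (simp add: n_def)
    then have "2 / \<delta> < real m" using N' by linarith
    then have "2 < \<delta> * real m" using \<delta> by (simp add: divide_less_eq mult.commute)
    then have "1 / (real m + 1) \<le> \<delta> / 2" using \<delta> by (simp add: field_simps)
    then have 1: "lpn p (T (f m) - scl (\<nu> m) (f m)) \<le> \<delta> / 2" using ab(3)[of m] by (simp add: f_def \<nu>_def)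
    have 2: "lpn p (scl (\<nu> m - \<mu>) (f m)) \<le> \<delta> / 2"
    proof -
      have "lpn p (scl (\<nu> m - \<mu>) (f m)) = cmod (\<nu> m - \<mu>) * lpn p (f m)" by (rule scl_lp(2)[OF p f(1)])
      also have "\<dots> \<le> \<delta> / 4 * 2"
        using N[of n] f(2)[of m] \<delta> by (intro mult_mono) (auto simp: m_def n_def less_imp_le)
      finally show ?thesis by simp
    qed
    have eq: "T (f m) - scl \<mu> (f m) = (T (f m) - scl (\<nu> m) (f m)) + scl (\<nu> m - \<mu>) (f m)" by (simp add: scl_arith)
    have "lpn p (T (f m) - scl \<mu> (f m)) \<le> \<delta>"
      unfolding eq using add_lp(2)[OF p diff_lp(1)[OF p op_in[OF T f(1)] scl_lp(1)[OF p f(1)]] scl_lp(1)[OF p f(1)], of m "\<nu> m" m "\<nu> m - \<mu>" m] 1 2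
      by linarith
    then show ?thesis using ab(1,2)[of m] m by (intro exI[of _ "a m"] exI[of _ "b m"]) (auto simp: f_def n_def)
  qed
  then show ?thesis by (rule that)
qed

text \<open>A hump \<open>z\<close> of a non-compact T - \<mu> may have only tiny coordinates, so it
  cannot be normalised at one of them. Adding a near eigenvector \<open>f\<close> far to the right
  provides a coordinate equal to 1, and T - \<mu> hardly notices \<open>f\<close>; hence z + f shows
  that \<open>T\<close> is humped.\<close>

lemma scalar_mod_cpt_or_humped:
  assumes p: "1 \<le> p" and T: "T \<in> ops p p" and nh: "\<not> humped p T"
  obtains \<mu> where "cpt p p (T - sop \<mu> id)"
proof -
  obtain \<mu> where near: "\<And>\<delta> K. 0 < \<delta> \<Longrightarrow>
    \<exists>a b. K \<le> a \<and> a < b \<and> lpn p (T (unit a - unit b) - scl \<mu> (unit a - unit b)) \<le> \<delta>"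
    using near_eigenvectors[OF assms] by blast
  define S where "S = T - sop \<mu> id"
  have S: "S \<in> ops p p" unfolding S_def by (intro ops_diff ops_sop ops_id T p)
  have S_apply: "S x = T x - scl \<mu> x" "T x = S x + scl \<mu> x" for x by (simp_all add: S_def)
  have "cpt p p S"
  proof (rule ccontr)
    assume "\<not> cpt p p S"
    then obtain \<epsilon> where \<epsilon>: "0 < \<epsilon>" and hump: "\<And>K \<eta>. 0 < \<eta> \<Longrightarrow> \<exists>z n. (\<forall>k. k < K \<or> n \<le> k \<longrightarrow> z k = 0) \<and> z \<in> lp p \<and>
      lpn p z \<le> 2 \<and> \<epsilon> \<le> lpn p (S z) \<and> (\<forall>k<K. cmod (S z k) \<le> \<eta>)"
      using hump_finite[OF p p S] by blast
    have "\<exists>z n a. (\<forall>k. k < K \<or> n \<le> k \<longrightarrow> z k = 0) \<and> z \<in> lp p \<and>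
     lpn p z \<le> 4 \<and> z a = 1 \<and> \<epsilon> / 2 \<le> lpn p (T z - scl (T z a) z) \<and> (\<forall>k<K. cmod (T z k) \<le> \<eta>)" if \<eta>: "0 < \<eta>" for K \<eta>
    proof -
      have "0 < \<eta> / 2" using \<eta> by simp
      then obtain z n where z: "\<And>k. k < K \<or> n \<le> k \<Longrightarrow> z k = 0" "z \<in> lp p" "lpn p z \<le> 2" "\<epsilon> \<le> lpn p (S z)"
        "\<And>k. k < K \<Longrightarrow> cmod (S z k) \<le> \<eta> / 2" using hump by meson
      have Sz: "S z \<in> lp p" by (rule op_in[OF S z(2)])
      have "0 < \<epsilon> / 64" using \<epsilon> by simp
      then obtain N where N: "\<And>k. k \<ge> N \<Longrightarrow> cmod (S z k) \<le> \<epsilon> / 64" using lp_coord_small[OF p Sz] by blast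
      define \<delta> where "\<delta> = min (\<eta> / 2) (\<epsilon> / 32)"
      have \<delta>: "0 < \<delta>" "\<delta> \<le> \<eta> / 2" "\<delta> \<le> \<epsilon> / 32" using \<eta> \<epsilon> by (auto simp: \<delta>_def)
      obtain a b where ab: "max K (max n N) \<le> a" "a < b" "lpn p (T (unit a - unit b) - scl \<mu> (unit a - unit b)) \<le> \<delta>"
        using near[OF \<delta>(1)] by blast
      define f where "f = unit a - unit b"
      have f: "f \<in> lp p" "lpn p f \<le> 2" "f a = 1" "\<And>k. k < a \<or> b < k \<Longrightarrow> f k = 0"
        using diff_lp[OF p unit_lp(1)[OF p] unit_lp(1)[OF p], of a b] p ab(2) by (auto simp: f_def)
      have Sf: "S f \<in> lp p" "lpn p (S f) \<le> \<delta>" using op_in[OF S f(1)] ab(3) by (auto simp: S_apply(1) f_def)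
      have Sfk: "cmod (S f k) \<le> \<delta>" for k using coord_le_lpn[OF p Sf(1), of k] Sf(2) by linarith
      define y where "y = z + f"
      have y: "y \<in> lp p" "lpn p y \<le> 4" using add_lp[OF p z(2) f(1)] z(3) f(2) by (auto simp: y_def)
      have ya: "y a = 1" using z(1)[of a] ab(1) f(3) by (simp add: y_def)
      have supp: "\<forall>k. k < K \<or> Suc b \<le> k \<longrightarrow> y k = 0" using z(1) f(4) ab(1,2) by (auto simp: y_def)
      have Sy: "S y = S z + S f" unfolding y_def by (rule op_add[OF S z(2) f(1)])
      have Sya: "cmod (S y a) \<le> \<epsilon> / 64 + \<epsilon> / 32"
        using norm_triangle_ineq[of "S z a" "S f a"] N[of a] Sfk[of a] ab(1) \<delta>(3) by (simp add: Sy)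
      have head: "\<forall>k<K. cmod (T y k) \<le> \<eta>"
      proof (intro allI impI)
        fix k assume k: "k < K"
        have "T y k = S z k + S f k" using supp k by (simp add: S_apply(2)[of y] Sy)
        then show "cmod (T y k) \<le> \<eta>"
          using norm_triangle_ineq[of "S z k" "S f k"] z(5)[OF k] Sfk[of k] \<delta>(2) by simp
      qed
      \<comment> \<open>Because \<open>y a = 1\<close>, the scalar \<mu> drops out of the
        difference.\<close>
      have Ty: "T y - scl (T y a) y = S y - scl (S y a) y"
        by (simp add: S_apply(2)[of y] ya scl_arith)
      have Sy_lp: "S y \<in> lp p" by (rule op_in[OF S y(1)])
      have sc: "scl (S y a) y \<in> lp p" "lpn p (scl (S y a) y) \<le> (\<epsilon> / 64 + \<epsilon> / 32) * 4"
        using scl_lp[OF p y(1), of "S y a"] mult_mono[OF Sya y(2)] \<epsilon> by auto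
      have "lpn p (S y) \<le> lpn p (S y - scl (S y a) y) + lpn p (scl (S y a) y)"
        by (rule lpn_triangle_sub[OF p Sy_lp sc(1)])
      moreover have "lpn p (S z) \<le> lpn p (S y) + lpn p (S f)"
        using diff_lp(2)[OF p Sy_lp Sf(1)] by (simp add: Sy)
      \<comment> \<open>The losses are \<epsilon>/32 from \<open>S f\<close> and 4 (\<epsilon>/64 +
        \<epsilon>/32) from the subtracted multiple of \<open>y\<close>, together less than
        \<epsilon>/2.\<close>
      moreover have "\<epsilon> / 2 \<le> s"
        if "t \<le> s + u" "v \<le> t + d" "\<epsilon> \<le> v" "d \<le> \<delta>" "u \<le> (\<epsilon> / 64 + \<epsilon> / 32) * 4" for s t u v d :: real
        using that \<delta>(3) \<epsilon> by simp
      ultimately have "\<epsilon> / 2 \<le> lpn p (T y - scl (T y a) y)"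
        unfolding Ty using z(4) Sf(2) sc(2) by blast
      then show ?thesis using supp y ya head by blast
    qed
    then have "humped p T" unfolding humped_def using \<epsilon> by (intro exI[of _ 4] exI[of _ "\<epsilon> / 2"]) auto
    then show False using nh by simp
  qed
  then show ?thesis using that by (simp add: S_def)
qed

theorem commutator_plus_cpt:
  assumes p: "1 \<le> p" and A: "A \<in> ops p p" and B: "B \<in> ops p p" and K: "cpt p p K"
    and eq: "\<And>x. x \<in> lp p \<Longrightarrow> T x = A (B x) - B (A x) + K x"
  shows "is_commutator_on (ell p) T"
proof -
  have "(A \<circ> B) - (B \<circ> A) + K \<in> ops p p"
    by (intro ops_add ops_diff ops_comp[where q=p] A B cpt_ops[OF K] p)
  then have T: "T \<in> ops p p" by (rule ops_cong[OF p]) (simp add: eq)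
  show ?thesis
  proof (cases "humped p T")
    case True
    then show ?thesis by (rule humped_commutator[OF p T])
  next
    case False
    then obtain \<mu> where \<mu>: "cpt p p (T - sop \<mu> id)" using scalar_mod_cpt_or_humped[OF p T] by blast
    \<comment> \<open>This is the compact part of A B - B A = \<mu> + compact, to which Wielandt's
      argument applies.\<close>
    have "cpt p p ((T - sop \<mu> id) - K)" by (rule cpt_diff[OF p \<mu> K])
    then have "\<mu> = 0" by (rule commutator_scalar_mod_cpt[OF p A B]) (simp add: eq)
    then have "cpt p p T" using cpt_cong[OF p \<mu>, of T] by simp
    then show ?thesis by (rule cpt_commutator[OF p])
  qed
qed

section \<open>Operator matrices on the direct sum\<close>

locale lp_sum =
  fixes I :: "nat set" and p :: "nat \<Rightarrow> real"
  assumes fin: "finite I" and p1: "\<And>i. i \<in> I \<Longrightarrow> 1 \<le> p i"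
begin

abbreviation "X \<equiv> direct_sum I (\<lambda>i. ell (p i))"

lemma vecs_X: "x \<in> vecs X \<longleftrightarrow> (\<forall>i\<in>I. x i \<in> lp (p i)) \<and> (\<forall>i. i \<notin> I \<longrightarrow> x i = 0)"
  by (simp add: direct_sum_def)

lemma smul_X: "smul X c x = (\<lambda>i. scl c (x i))"
  by (simp add: direct_sum_def smul_ell)

lemma nrm_X: "nrm X x = (\<Sum>i\<in>I. lpn (p i) (x i))"
  by (simp add: direct_sum_def)

lemma bounded_operatorsD:
  assumes "T \<in> bounded_operators X"
  shows "\<And>x. x \<in> vecs X \<Longrightarrow> T x \<in> vecs X"
    "\<And>x y. x \<in> vecs X \<Longrightarrow> y \<in> vecs X \<Longrightarrow> T (x + y) = T x + T y"
    "\<And>c x. x \<in> vecs X \<Longrightarrow> T (\<lambda>i. scl c (x i)) = (\<lambda>i. scl c (T x i))"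
    "\<exists>K. \<forall>x\<in>vecs X. nrm X (T x) \<le> K * nrm X x"
  using assms by (simp_all add: bounded_operators_def smul_X)

lemma incl_apply: "summand_incl j y i = (if i = j then y else 0)"
  by (simp add: summand_incl_def)

lemma incl_in: "j \<in> I \<Longrightarrow> y \<in> lp (p j) \<Longrightarrow> summand_incl j y \<in> vecs X"
  by (auto simp: vecs_X incl_apply)

lemma nrm_incl: assumes "j \<in> I" shows "nrm X (summand_incl j y) = lpn (p j) y"
proof -
  have "nrm X (summand_incl j y) = (\<Sum>i\<in>I. if i = j then lpn (p j) y else 0)"
    unfolding nrm_X by (rule sum.cong) (auto simp: incl_apply)
  then show ?thesis using assms fin by simp
qed

definition entry :: "((nat \<Rightarrow> vec) \<Rightarrow> (nat \<Rightarrow> vec)) \<Rightarrow> nat \<Rightarrow> nat \<Rightarrow> vec \<Rightarrow> vec" where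
  "entry T i j y = T (summand_incl j y) i"

lemma entry_ops:
  assumes T: "T \<in> bounded_operators X" and i: "i \<in> I" and j: "j \<in> I"
  shows "entry T i j \<in> ops (p j) (p i)"
proof -
  obtain K where K: "\<And>x. x \<in> vecs X \<Longrightarrow> nrm X (T x) \<le> K * nrm X x" using bounded_operatorsD(4)[OF T] by blast
  have "lpn (p i) (entry T i j y) \<le> K * lpn (p j) y" if y: "y \<in> lp (p j)" for y
  proof -
    have "lpn (p i) (T (summand_incl j y) i) \<le> nrm X (T (summand_incl j y))"
      unfolding nrm_X by (rule member_le_sum[OF i _ fin]) simp
    then show ?thesis using K[OF incl_in[OF j y]] nrm_incl[OF j] by (simp add: entry_def)
  qed
  moreover have "entry T i j y \<in> lp (p i)" if y: "y \<in> lp (p j)" for y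
    using bounded_operatorsD(1)[OF T incl_in[OF j y]] i by (simp add: entry_def vecs_X)
  moreover have "entry T i j (y + z) = entry T i j y + entry T i j z" if "y \<in> lp (p j)" "z \<in> lp (p j)" for y z
  proof -
    have 1: "summand_incl j (y + z) = summand_incl j y + summand_incl j z" by (rule ext) (simp add: incl_apply)
    show ?thesis unfolding entry_def 1 bounded_operatorsD(2)[OF T incl_in[OF j that(1)] incl_in[OF j that(2)]]
      by (rule plus_fun_apply)
  qed
  moreover have "entry T i j (scl c y) = scl c (entry T i j y)" if "y \<in> lp (p j)" for c y
  proof -
    have 1: "summand_incl j (scl c y) = (\<lambda>i. scl c (summand_incl j y i))" by (rule ext) (simp add: incl_apply)
    show ?thesis unfolding entry_def 1 bounded_operatorsD(3)[OF T incl_in[OF j that], of c] ..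
  qed
  ultimately have "opb (p j) (p i) K (entry T i j)" unfolding opb_def by blast
  then show ?thesis by (rule opb_ops)
qed

lemma sum_X:
  assumes T: "T \<in> bounded_operators X" and x: "\<And>j. j \<in> J \<Longrightarrow> x j \<in> vecs X"
  shows "sum x J \<in> vecs X \<and> T (sum x J) = (\<Sum>j\<in>J. T (x j))"
  using x
proof (induction J rule: infinite_finite_induct)
  case (insert j J)
  then have s: "x j \<in> vecs X" "sum x J \<in> vecs X" "T (sum x J) = (\<Sum>j\<in>J. T (x j))" by auto
  have "x j + sum x J \<in> vecs X" using s(1,2) add_lp(1)[OF p1] by (simp add: vecs_X)
  then show ?case
    unfolding sum.insert[OF insert(1,2)] using bounded_operatorsD(2)[OF T s(1,2)] s(3) by (simp only: simp_thms)
next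
  have z: "0 \<in> vecs X" by (simp add: vecs_X)
  have "T (0 + 0) = T 0 + T 0" by (rule bounded_operatorsD(2)[OF T z z])
  then have T0: "T 0 = 0" by (metis add_0 add_cancel_right_right)
  {
    case (infinite J)
    then show ?case using z T0 by (simp only: sum.infinite simp_thms)
  next
    case empty
    then show ?case using z T0 by (simp only: sum.empty simp_thms)
  }
qed

lemma apply_entries:
  assumes T: "T \<in> bounded_operators X" and x: "x \<in> vecs X"
  shows "T x i = (\<Sum>j\<in>I. entry T i j (x j))"
proof -
  have x_eq: "x = (\<Sum>j\<in>I. summand_incl j (x j))"
  proof
    fix k
    have "(\<Sum>j\<in>I. summand_incl j (x j)) k = (\<Sum>j\<in>I. if j = k then x k else 0)"
      by (subst sum_fun_apply, rule sum.cong) (auto simp: incl_apply)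
    also have "\<dots> = x k" using x fin by (simp add: vecs_X)
    finally show "x k = (\<Sum>j\<in>I. summand_incl j (x j)) k" by simp
  qed
  have "T (\<Sum>j\<in>I. summand_incl j (x j)) = (\<Sum>j\<in>I. T (summand_incl j (x j)))"
    using sum_X[OF T, of I "\<lambda>j. summand_incl j (x j)"] incl_in x by (simp add: vecs_X)
  then have "T x = (\<Sum>j\<in>I. T (summand_incl j (x j)))" using x_eq by metis
  then have "T x i = (\<Sum>j\<in>I. T (summand_incl j (x j))) i" by (rule fun_cong)
  also have "\<dots> = (\<Sum>j\<in>I. T (summand_incl j (x j)) i)" by (rule sum_fun_apply)
  finally show ?thesis unfolding entry_def .
qed

definition of_entries :: "(nat \<Rightarrow> nat \<Rightarrow> vec \<Rightarrow> vec) \<Rightarrow> (nat \<Rightarrow> vec) \<Rightarrow> (nat \<Rightarrow> vec)" where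
  "of_entries m x = (\<lambda>i. if i \<in> I then \<Sum>j\<in>I. m i j (x j) else 0)"

lemma of_entries_bounded:
  assumes m: "\<And>i j. i \<in> I \<Longrightarrow> j \<in> I \<Longrightarrow> m i j \<in> ops (p j) (p i)"
  shows "of_entries m \<in> bounded_operators X"
proof -
  have "\<exists>K. 0 \<le> K \<and> (i \<in> I \<and> j \<in> I \<longrightarrow> opb (p j) (p i) K (m i j))" for i j
    using m by (metis opsE order_refl)
  then obtain K where K: "\<And>i j. 0 \<le> K i j" "\<And>i j. i \<in> I \<Longrightarrow> j \<in> I \<Longrightarrow> opb (p j) (p i) (K i j) (m i j)"
    by metis
  have in_lp: "m i j (x j) \<in> lp (p i)" if "x \<in> vecs X" "i \<in> I" "j \<in> I" for x i j
    using op_in[OF m] that by (simp add: vecs_X)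
  have "of_entries m x \<in> vecs X" if x: "x \<in> vecs X" for x
    unfolding vecs_X of_entries_def using in_lp[OF x] by (auto intro!: sum_lp(1)[OF p1])
  moreover have "of_entries m (x + y) = of_entries m x + of_entries m y" if "x \<in> vecs X" "y \<in> vecs X" for x y
  proof
    fix i
    have "(\<Sum>j\<in>I. m i j ((x + y) j)) = (\<Sum>j\<in>I. m i j (x j) + m i j (y j))" if "i \<in> I"
      using op_add[OF m] that \<open>x \<in> vecs X\<close> \<open>y \<in> vecs X\<close> by (intro sum.cong) (auto simp: vecs_X)
    then show "of_entries m (x + y) i = (of_entries m x + of_entries m y) i"
      by (simp add: of_entries_def sum.distrib)
  qed
  moreover have "of_entries m (smul X c x) = smul X c (of_entries m x)" if x: "x \<in> vecs X" for c x
  proof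
    fix i
    have "(\<Sum>j\<in>I. m i j (scl c (x j))) = scl c (\<Sum>j\<in>I. m i j (x j))" if i: "i \<in> I"
    proof -
      have "(\<Sum>j\<in>I. m i j (scl c (x j))) = (\<Sum>j\<in>I. scl c (m i j (x j)))"
        using op_scl[OF m] i x by (intro sum.cong) (auto simp: vecs_X)
      then show ?thesis by (simp add: fun_eq_iff sum_fun_apply sum_distrib_left)
    qed
    then show "of_entries m (smul X c x) i = smul X c (of_entries m x) i"
      by (simp add: of_entries_def smul_X)
  qed
  moreover have "nrm X (of_entries m x) \<le> (\<Sum>i\<in>I. \<Sum>j\<in>I. K i j) * nrm X x" if x: "x \<in> vecs X" for x
  proof -
    have "lpn (p i) (of_entries m x i) \<le> (\<Sum>j\<in>I. K i j) * nrm X x" if i: "i \<in> I" for i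
    proof -
      have "lpn (p i) (of_entries m x i) \<le> (\<Sum>j\<in>I. lpn (p i) (m i j (x j)))"
        using sum_lp(2)[OF p1[OF i], of I "\<lambda>j. m i j (x j)"] in_lp[OF x i] i by (simp add: of_entries_def)
      also have "\<dots> \<le> (\<Sum>j\<in>I. K i j * nrm X x)"
      proof (rule sum_mono)
        fix j assume j: "j \<in> I"
        have "lpn (p j) (x j) \<le> nrm X x" unfolding nrm_X by (rule member_le_sum[OF j _ fin]) simp
        then have "K i j * lpn (p j) (x j) \<le> K i j * nrm X x" by (rule mult_left_mono[OF _ K(1)])
        moreover have "x j \<in> lp (p j)" using x j by (simp add: vecs_X)
        ultimately show "lpn (p i) (m i j (x j)) \<le> K i j * nrm X x"
          using opb_le[OF K(2)[OF i j], of "x j"] by linarith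
      qed
      finally show ?thesis by (simp add: sum_distrib_right)
    qed
    then show ?thesis unfolding nrm_X[of "of_entries m x"] sum_distrib_right by (rule sum_mono)
  qed
  ultimately show ?thesis unfolding bounded_operators_def by blast
qed

text \<open>The compression in the theorem is the diagonal entry of the operator matrix; the
  flanking projections do not alter it.\<close>

lemma on_summand_entry: "on_summand i (summand_proj i \<circ> T \<circ> summand_proj i) = entry T i i"
proof
  fix y :: vec
  have "summand_proj i (summand_incl i y) = summand_incl i y"
    by (rule ext) (simp add: summand_proj_def incl_apply)
  then show "on_summand i (summand_proj i \<circ> T \<circ> summand_proj i) y = entry T i i y"
    by (simp add: on_summand_def entry_def summand_proj_def)
qed

lemma cpt_sum:
  assumes "1 \<le> q" "\<And>j. j \<in> J \<Longrightarrow> cpt q q (K j)" shows "cpt q q (sum K J)"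
  using assms(2)
proof (induction J rule: infinite_finite_induct)
  case (insert j J)
  then show ?case unfolding sum.insert[OF insert(1,2)] by (intro cpt_add[OF assms(1)]) blast+
next
  case (infinite J)
  show ?case unfolding sum.infinite[OF infinite(1)] by (rule cpt_zero)
next
  case empty
  show ?case unfolding sum.empty by (rule cpt_zero)
qed

text \<open>
  An off-diagonal product passes through a summand with a different exponent, so one of its two
  factors goes from a larger to a smaller exponent and is compact by Pitt's theorem.
\<close>

lemma commutator_entries:
  assumes inj: "inj_on p I" and T: "is_commutator_on X T" and i: "i \<in> I"
  shows "is_commutator_on (ell (p i)) (entry T i i)"
proof -
  obtain A B where A: "A \<in> bounded_operators X" and B: "B \<in> bounded_operators X"
    and eq: "\<And>x. x \<in> vecs X \<Longrightarrow> T x = A (B x) - B (A x)"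
    using T unfolding is_commutator_on_def by blast
  define K where "K j = (entry A i j \<circ> entry B j i) - (entry B i j \<circ> entry A j i)" for j
  have prod: "cpt (p i) (p i) (entry C i j \<circ> entry D j i)"
    if "C \<in> bounded_operators X" "D \<in> bounded_operators X" "j \<in> I" "j \<noteq> i" for C D j
  \<comment> \<open>If \<open>p j < p i\<close>, the factor applied first is the compact one;
    otherwise it is the second.\<close>
  proof (cases "p j < p i")
    case True
    show ?thesis
      by (rule cpt_comp_left[OF p1[OF that(3)] p1[OF i] _ entry_ops[OF that(1) i that(3)]])
        (rule pitt[OF p1[OF that(3)] True entry_ops[OF that(2,3) i]])
  next
    case False
    then have "p i < p j" using inj that(3,4) i by (metis inj_on_def linorder_neqE_linordered_idom)
    then show ?thesis
      by (intro cpt_comp_right[OF p1[OF i] p1[OF that(3)] p1[OF i] _ entry_ops[OF that(2,3) i]]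
          pitt[OF p1[OF i] _ entry_ops[OF that(1) i that(3)]])
  qed
  have "cpt (p i) (p i) (sum K (I - {i}))"
    unfolding K_def using prod A B by (intro cpt_sum cpt_diff p1 i) auto
  then show ?thesis
  proof (rule commutator_plus_cpt[OF p1[OF i] entry_ops[OF A i i] entry_ops[OF B i i]])
    fix y assume y: "y \<in> lp (p i)"
    have C: "C (D (summand_incl i y)) i = (\<Sum>j\<in>I. entry C i j (entry D j i y))"
      if "C \<in> bounded_operators X" "D \<in> bounded_operators X" for C D
      using apply_entries[OF that(1) bounded_operatorsD(1)[OF that(2) incl_in[OF i y]]] by (simp only: entry_def)
    have "entry T i i y = (\<Sum>j\<in>I. entry A i j (entry B j i y) - entry B i j (entry A j i y))"
      using eq[OF incl_in[OF i y]] C[OF A B] C[OF B A] by (simp add: entry_def[of T] sum_subtractf)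
    also have "\<dots> = (\<Sum>j\<in>I. K j y)" by (simp add: K_def)
    also have "\<dots> = K i y + (\<Sum>j\<in>I - {i}. K j y)" by (rule sum.remove[OF fin i])
    also have "\<dots> = entry A i i (entry B i i y) - entry B i i (entry A i i y) + sum K (I - {i}) y"
      by (simp add: K_def sum_fun_apply)
    finally show "entry T i i y = entry A i i (entry B i i y) - entry B i i (entry A i i y) + sum K (I - {i}) y" .
  qed
qed

text \<open>
  Shifting the diagonal entries of \<open>A\<close> by well-separated scalars does not change the diagonal
  commutators and makes the off-diagonal equations solvable.
\<close>

lemma commutator_of_entries:
  assumes T: "T \<in> bounded_operators X" and comm: "\<And>i. i \<in> I \<Longrightarrow> is_commutator_on (ell (p i)) (entry T i i)"
  shows "is_commutator_on X T"
proof -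
  have "\<exists>A B a. i \<in> I \<longrightarrow> A \<in> ops (p i) (p i) \<and> B \<in> ops (p i) (p i) \<and> 0 \<le> a \<and> opb (p i) (p i) a A \<and>
      (\<forall>x\<in>lp (p i). entry T i i x = A (B x) - B (A x))" for i
    using comm[of i] commutatorE[of "p i" "entry T i i"] opsE by (smt (verit))
  then obtain A B a where AB: "\<And>i. i \<in> I \<Longrightarrow> A i \<in> ops (p i) (p i)" "\<And>i. i \<in> I \<Longrightarrow> B i \<in> ops (p i) (p i)"
    "\<And>i. i \<in> I \<Longrightarrow> 0 \<le> a i" "\<And>i. i \<in> I \<Longrightarrow> opb (p i) (p i) (a i) (A i)"
    "\<And>i x. i \<in> I \<Longrightarrow> x \<in> lp (p i) \<Longrightarrow> entry T i i x = A i (B i x) - B i (A i x)"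
    by metis
  \<comment> \<open>Distinct indices give scalars at least \<open>L\<close> apart, and
    \<open>L\<close> exceeds the sum of any two of the bounds \<open>a i\<close>.\<close>
  define L where "L = 1 + 2 * sum a I"
  define \<mu> where "\<mu> i = complex_of_real (L * real i)" for i
  have a_le: "a i \<le> sum a I" if "i \<in> I" for i by (rule member_le_sum[OF that _ fin]) (use AB(3) in auto)
  have L1: "0 < L" using sum_nonneg[of I a] AB(3) by (simp add: L_def)
  have \<mu>: "a i + a j < cmod (\<mu> i - \<mu> j)" if "i \<in> I" "j \<in> I" "i \<noteq> j" for i j
  proof -
    have "\<mu> i - \<mu> j = complex_of_real (L * (real i - real j))" by (simp add: \<mu>_def algebra_simps)
    then have "cmod (\<mu> i - \<mu> j) = L * \<bar>real i - real j\<bar>" using L1 by (simp only: norm_of_real abs_mult abs_of_pos)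
    moreover have "L * 1 \<le> L * \<bar>real i - real j\<bar>" using that(3) L1 by (intro mult_left_mono) auto
    moreover have "a i + a j < L" using a_le[OF that(1)] a_le[OF that(2)] by (simp add: L_def)
    ultimately show ?thesis by linarith
  qed
  have "\<exists>Z. i \<in> I \<and> j \<in> I \<longrightarrow> Z \<in> ops (p j) (p i) \<and>
      (\<forall>x\<in>lp (p j). scl (\<mu> i - \<mu> j) (Z x) + A i (Z x) - Z (A j x) = entry T i j x)" for i j
  proof (cases "i \<in> I \<and> j \<in> I \<and> i \<noteq> j")
    case True
    then have ij: "i \<in> I" "j \<in> I" "i \<noteq> j" by auto
    obtain Z where Z: "Z \<in> ops (p j) (p i)"
      "\<And>x. x \<in> lp (p j) \<Longrightarrow> scl (\<mu> i - \<mu> j) (Z x) + A i (Z x) + Z ((- A j) x) = entry T i j x"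
      using rosenblum[OF p1[OF ij(2)] p1[OF ij(1)] AB(4)[OF ij(1)] opb_uminus[OF p1[OF ij(2)] AB(4)[OF ij(2)]]
          AB(3)[OF ij(1)] AB(3)[OF ij(2)] entry_ops[OF T ij(1,2)] \<mu>[OF ij]] by blast
    have "Z ((- A j) x) = - Z (A j x)" if "x \<in> lp (p j)" for x
      using op_uminus[OF Z(1) op_in[OF AB(1)[OF ij(2)] that]] by simp
    then show ?thesis using Z by (intro exI[of _ Z]) simp
  next
    \<comment> \<open>On the diagonal the scalar difference is 0 and the equation is the given
      commutator, solved by \<open>B i\<close>; for indices outside \<open>I\<close> nothing is
      claimed.\<close>
    case False
    then show ?thesis using AB(2,5) by (intro exI[of _ "B i"]) auto
  qed
  then obtain Z where Z: "\<And>i j. i \<in> I \<Longrightarrow> j \<in> I \<Longrightarrow> Z i j \<in> ops (p j) (p i)"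
    "\<And>i j x. i \<in> I \<Longrightarrow> j \<in> I \<Longrightarrow> x \<in> lp (p j) \<Longrightarrow>
      scl (\<mu> i - \<mu> j) (Z i j x) + A i (Z i j x) - Z i j (A j x) = entry T i j x"
    by metis
  \<comment> \<open>The diagonal matrix of the \<open>A i\<close> shifted by \<mu> i. Its commutator
    with the full matrix \<open>Z\<close> has as its entries the left sides of the equations just
    solved.\<close>
  define m where "m i j = (if i = j then A i + sop (\<mu> i) id else 0)" for i j
  have m: "m i j \<in> ops (p j) (p i)" if "i \<in> I" "j \<in> I" for i j
    using that AB(1) p1 by (auto simp: m_def intro!: ops_add ops_sop ops_id ops_zero)
  have mx: "of_entries m x i = A i (x i) + scl (\<mu> i) (x i)" if "i \<in> I" for x i
  proof -
    have "(\<Sum>j\<in>I. m i j (x j)) = (\<Sum>j\<in>I. if j = i then A i (x i) + scl (\<mu> i) (x i) else 0)"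
      by (rule sum.cong) (auto simp: m_def)
    then show ?thesis using that fin by (simp add: of_entries_def)
  qed
  have "T x = of_entries m (of_entries Z x) - of_entries Z (of_entries m x)" if x: "x \<in> vecs X" for x
  proof
    fix i
    show "T x i = (of_entries m (of_entries Z x) - of_entries Z (of_entries m x)) i"
    proof (cases "i \<in> I")
      case False
      then have "T x i = 0" using bounded_operatorsD(1)[OF T x] by (simp add: vecs_X)
      then show ?thesis using False by (simp add: of_entries_def)
    next
      case True
      have xj: "x j \<in> lp (p j)" "A j (x j) \<in> lp (p j)" "Z i j (x j) \<in> lp (p i)" if "j \<in> I" for j
        using x that True op_in[OF AB(1)] op_in[OF Z(1)] by (auto simp: vecs_X)
      have 1: "of_entries m (of_entries Z x) i = (\<Sum>j\<in>I. A i (Z i j (x j)) + scl (\<mu> i) (Z i j (x j)))"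
      proof -
        have "A i (\<Sum>j\<in>I. Z i j (x j)) = (\<Sum>j\<in>I. A i (Z i j (x j)))"
          by (rule op_sum[OF p1[OF True] AB(1)[OF True] xj(3)])
        moreover have "scl (\<mu> i) (\<Sum>j\<in>I. Z i j (x j)) = (\<Sum>j\<in>I. scl (\<mu> i) (Z i j (x j)))"
          by (simp add: fun_eq_iff sum_fun_apply sum_distrib_left)
        ultimately show ?thesis using True by (simp add: mx of_entries_def[of Z] sum.distrib)
      qed
      have 2: "of_entries Z (of_entries m x) i = (\<Sum>j\<in>I. Z i j (A j (x j)) + scl (\<mu> j) (Z i j (x j)))"
      proof -
        have "(\<Sum>j\<in>I. Z i j (of_entries m x j)) = (\<Sum>j\<in>I. Z i j (A j (x j)) + scl (\<mu> j) (Z i j (x j)))"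
        proof (rule sum.cong[OF refl])
          fix j assume j: "j \<in> I"
          show "Z i j (of_entries m x j) = Z i j (A j (x j)) + scl (\<mu> j) (Z i j (x j))"
            unfolding mx[OF j] using op_add[OF Z(1)[OF True j] xj(2)[OF j] scl_lp(1)[OF p1[OF j] xj(1)[OF j]]]
              op_scl[OF Z(1)[OF True j] xj(1)[OF j]] by simp
        qed
        then show ?thesis using True by (simp add: of_entries_def[of Z])
      qed
      have "T x i = (\<Sum>j\<in>I. entry T i j (x j))" by (rule apply_entries[OF T x])
      also have "\<dots> = (\<Sum>j\<in>I. (A i (Z i j (x j)) + scl (\<mu> i) (Z i j (x j))) - (Z i j (A j (x j)) + scl (\<mu> j) (Z i j (x j))))"
      proof (rule sum.cong[OF refl])
        fix j assume j: "j \<in> I"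
        show "entry T i j (x j) = (A i (Z i j (x j)) + scl (\<mu> i) (Z i j (x j))) - (Z i j (A j (x j)) + scl (\<mu> j) (Z i j (x j)))"
          unfolding Z(2)[OF True j xj(1)[OF j], symmetric] by (simp add: scl_arith)
      qed
      also have "\<dots> = of_entries m (of_entries Z x) i - of_entries Z (of_entries m x) i"
        unfolding 1 2 by (rule sum_subtractf)
      finally show ?thesis by (simp only: minus_apply)
    qed
  qed
  then show ?thesis
    unfolding is_commutator_on_def using of_entries_bounded[OF m] of_entries_bounded[OF Z(1)] by blast
qed

end

theorem corollary5p3:
  fixes n :: nat and p :: "nat \<Rightarrow> real"
    and T :: "(nat \<Rightarrow> nat \<Rightarrow> complex) \<Rightarrow> (nat \<Rightarrow> nat \<Rightarrow> complex)"
  assumes "n \<ge> 1"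
    and "1 \<le> p n"
    and "\<And>i j. 1 \<le> i \<Longrightarrow> i < j \<Longrightarrow> j \<le> n \<Longrightarrow> p j < p i"
    and "T \<in> bounded_operators (direct_sum {1..n} (\<lambda>i. ell (p i)))"
  shows "is_commutator_on (direct_sum {1..n} (\<lambda>i. ell (p i))) T \<longleftrightarrow>
    (\<forall>i\<in>{1..n}. is_commutator_on (ell (p i))
       (on_summand i (summand_proj i \<circ> T \<circ> summand_proj i)))"
proof -
  interpret lp_sum "{1..n}" p
  proof
    fix i assume "i \<in> {1..n}"
    then show "1 \<le> p i" using assms(2) assms(3)[of i n] by (cases "i = n") auto
  qed simp
  have "inj_on p {1..n}"
    by (rule linorder_inj_onI) (use assms(3) in fastforce)+
  then show ?thesis
    unfolding on_summand_entry using commutator_entries commutator_of_entries[OF assms(4)] by blast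
qed

end
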